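(* Every convex body $K\subset\mathbb{R}^2$ satisfies $\mathrm{Sym}_1(K)\ge \frac{2}{41}(10+3\sqrt2)$. Moreover, there is a sequence of convex quadrilaterals $Q_j$ with $\mathrm{Sym}_1(Q_j)\to \frac13(\sqrt2+1)$. Consequently $$\frac{2}{41}(10+3\sqrt2)\le \sigma(2,1)\le \frac13(\sqrt2+1).$$
   Context: A convex body is a compact convex set with nonempty interior. For a convex body $K\subset\mathbb{R}^n$ and an integer $0\le k<n$, the $k$-symmetry of $K$ is $$\mathrm{Sym}_k(K)=\frac{1}{\mathrm{vol}_n(K)}\max_{\mathcal L}\mathrm{vol}_n\big(K\cap \mathrm{refl}_{\mathcal L}(K)\big),$$ where the maximum is over all $k$-dimensional affine flats $\mathcal L\subset\mathbb{R}^n$, $\mathrm{vol}_n$ is Lebesgue measure, and $\mathrm{refl}_{\mathcal L}$ is the orthogonal reflection through $\mathcal L$ (the isometry fixing $\mathcal L$ pointwise and acting as $-\mathrm{id}$ on directions orthogonal to $\mathcal L$). For $n=2,k=1$ this is the axiality of $K$. Define $\sigma(n,k)=\inf\{\mathrm{Sym}_k(K): K\subset\mathbb{R}^n \text{ a convex body}\}$. *)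

theory Defs
  imports "HOL-Analysis.Analysis"
begin

definition convex_body :: "'a::euclidean_space set \<Rightarrow> bool" where
  "convex_body K \<longleftrightarrow> convex K \<and> compact K \<and> interior K \<noteq> {}"

definition affine_flats :: "nat \<Rightarrow> 'a::euclidean_space set set" where
  "affine_flats k = {L. affine L \<and> aff_dim L = int k}"

definition refl_flat :: "'a::euclidean_space set \<Rightarrow> 'a \<Rightarrow> 'a" where
  "refl_flat L x = 2 *\<^sub>R closest_point L x - x"

definition Sym :: "nat \<Rightarrow> 'a::euclidean_space set \<Rightarrow> real" where
  "Sym k K = (SUP L\<in>affine_flats k. measure lebesgue (K \<inter> refl_flat L ` K)) / measure lebesgue K"

text \<open>sigma(n,k), with the ambient space R^n given as the type 'a.\<close>
definition sigma :: "'a::euclidean_space itself \<Rightarrow> nat \<Rightarrow> real" where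
  "sigma _ k = Inf {Sym k K | K::'a set. convex_body K}"

definition convex_quadrilateral :: "'a::euclidean_space set \<Rightarrow> bool" where
  "convex_quadrilateral Q \<longleftrightarrow>
     (\<exists>S. card S = 4 \<and> Q = convex hull S \<and> (\<forall>x\<in>S. x \<notin> convex hull (S - {x}))
          \<and> interior Q \<noteq> {})"

end

theory Submission
  imports Defs
begin

text \<open>
  Lower bound.  For each direction \<open>u\<close> a strictly convex body has exactly one inscribed rhombus with a side
  parallel to \<open>u\<close>, so the rhombus depends continuously on \<open>u\<close>.  Turning the direction until the two pairs of
  sides have changed places, one finds a rhombus such that the two caps cut off over one pair of opposite sides have
  the same total area as those over the other pair.  An affine map turns this rhombus into the unit square.  The
  reflections in its diagonals map each cap to an adjacent one; the overlap of two adjacent caps is estimated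
  from below by means of the concavity of the widths of their slices, and lines of support at the corners show that the caps
  have total area at most 1.  The better one of the two diagonals yields the bound 0.6948, which exceeds
  \<open>2/41 * (10 + 3 * sqrt 2)\<close>.  An arbitrary convex body is the limit of a decreasing sequence of strictly convex ones.

  Upper bound.  Cut the triangle with vertices \<open>(0, 0)\<close>, \<open>(2, 0)\<close>, \<open>(1, 1)\<close> along the line \<open>x = sqrt 2\<close> and contract
  the remaining quadrilateral by a factor \<open>e\<close> towards the base.  After undoing the contraction, a reflection that
  does not map the quadrilateral almost off itself is up to an error of order \<open>e^2\<close> of the form
  \<open>(x, y) \<mapsto> (b - x, y + l x)\<close> or \<open>(x, y) \<mapsto> (x, l x - y)\<close> with \<open>l x\<close> affine in \<open>x\<close>.  In both cases
  the overlap has area at most \<open>2/3\<close>, while the quadrilateral has area \<open>2 * sqrt 2 - 2\<close>.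
\<close>

section \<open>Planar frames and slices\<close>

text \<open>A rhombus is used because the affine map onto the unit square then turns the reflections
  in its diagonals into coordinate swaps, while ratios of areas are preserved. The two diagonals
  serve complementary pairs of corners, so averaging them requires only a bound on the sum of the
  four corner overlaps. Balance helps this sum twice. Let \<open>a\<close>, \<open>b\<close>,
  \<open>c\<close>, \<open>d\<close> be the doubled cap areas in cyclic order, so that
  \<open>a + c = b + d = X\<close>. The inequality \<open>(a + c) * (b + d) \<le> 1\<close> from the
  supports becomes \<open>X \<le> 1\<close>, and the linear term of the overlap estimate is a
  multiple of \<open>(a + c) * (b + d) = X^2\<close>. Strict convexity secures uniqueness of the
  rhombus; continuity then follows from compactness of the set of rhombi with side bounded away from
  0. The value 0.6948 is a short decimal just above the constant 0.69476... of the statement. On the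
  other side 2/3 bounds the folds along the base even for the uncut triangle, and
  \<open>(2/3) / (2 * sqrt 2 - 2) = (sqrt 2 + 1) / 3\<close>.\<close>

definition cross2 :: "real^2 \<Rightarrow> real^2 \<Rightarrow> real" where
  "cross2 u v = u$1 * v$2 - u$2 * v$1"

definition frame :: "real^2 \<Rightarrow> real^2 \<Rightarrow> real^2 \<Rightarrow> real \<times> real \<Rightarrow> real^2" where
  "frame p u v = (\<lambda>(x, y). p + x *\<^sub>R u + y *\<^sub>R v)"

lemma continuous_on_frame [continuous_intros]: "continuous_on S (frame p u v)"
  unfolding frame_def case_prod_beta by (intro continuous_intros)

lemma borel_measurable_frame [measurable]: "frame p u v \<in> borel_measurable borel"
  by (intro borel_measurable_continuous_onI continuous_on_frame)

lemma inj_frame: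
  assumes "cross2 u v \<noteq> 0"
  shows "inj (frame p u v)"
proof (rule injI)
  fix a b assume "frame p u v a = frame p u v b"
  then have *: "fst a *\<^sub>R u + snd a *\<^sub>R v = fst b *\<^sub>R u + snd b *\<^sub>R v"
    by (simp add: frame_def case_prod_beta)
  have 1: "fst a * u$1 + snd a * v$1 = fst b * u$1 + snd b * v$1"
    and 2: "fst a * u$2 + snd a * v$2 = fst b * u$2 + snd b * v$2"
    using arg_cong[OF *, of "\<lambda>z. z$1"] arg_cong[OF *, of "\<lambda>z. z$2"] by simp_all
  have "(fst a - fst b) * cross2 u v = 0" "(snd a - snd b) * cross2 u v = 0"
    using 1 2 unfolding cross2_def by algebra+
  with assms show "a = b" by (simp add: prod_eq_iff)
qed

text \<open>Slicing takes place in the product of two real lines, whereas the bodies live in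
  \<open>real^2\<close>; comparing both measures on boxes identifies them.\<close>

lemma distr_lborel_frame_std:
  "distr lborel borel (frame 0 (axis 1 1) (axis 2 1)) = (lborel :: (real^2) measure)"
proof (rule lborel_eqI[symmetric])
  let ?T = "frame 0 (axis 1 1) (axis 2 1)"
  fix l u :: "real^2"
  assume le: "\<And>b. b \<in> Basis \<Longrightarrow> l \<bullet> b \<le> u \<bullet> b"
  have le': "l$1 \<le> u$1" "l$2 \<le> u$2"
    using le[of "axis 1 1"] le[of "axis 2 1"] by (auto simp: axis_in_Basis_iff inner_axis)
  have T: "?T z $ 1 = fst z" "?T z $ 2 = snd z" for z
    by (auto simp: frame_def case_prod_beta axis_def)
  have "?T -` box l u = box (l$1, l$2) (u$1, u$2)"
  proof (rule set_eqI)
    fix z :: "real \<times> real"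
    show "z \<in> ?T -` box l u \<longleftrightarrow> z \<in> box (l$1, l$2) (u$1, u$2)"
      unfolding vimage_eq mem_box_cart forall_2 T
      by (cases z) (auto simp: box_prod)
  qed
  then have "emeasure (distr lborel borel ?T) (box l u) = emeasure lborel (box (l$1, l$2) (u$1, u$2))"
    by (subst emeasure_distr) auto
  also have "\<dots> = ennreal ((u$1 - l$1) * (u$2 - l$2))"
    using le' by (simp add: emeasure_lborel_box_eq Basis_prod_def inner_prod_def)
  also have "(u$1 - l$1) * (u$2 - l$2) = (\<Prod>b\<in>Basis. (u - l) \<bullet> b)"
  proof -
    have B: "(Basis :: (real^2) set) = {axis 1 1, axis 2 1}"
      by (auto simp: Basis_vec_def UNIV_2)
    have "axis 1 1 \<noteq> (axis 2 1 :: real^2)"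
      by (simp add: axis_eq_axis)
    then show ?thesis unfolding B by (simp add: inner_axis)
  qed
  finally show "emeasure (distr lborel borel ?T) (box l u) = (\<Prod>b\<in>Basis. (u - l) \<bullet> b)"
    by simp
qed auto

text \<open>The frame map is the standard identification followed by a linear map of determinant
  \<open>cross2 u v\<close> and a translation.\<close>

lemma measure_frame:
  fixes K :: "(real^2) set"
  assumes K: "K \<in> sets borel" "bounded K" and nz: "cross2 u v \<noteq> 0"
  shows "measure lebesgue K = \<bar>cross2 u v\<bar> * measure lborel (frame p u v -` K)"
proof -
  let ?T = "frame 0 (axis 1 1) (axis 2 1)"
  define f :: "real^2 \<Rightarrow> real^2" where "f = (\<lambda>z. z$1 *\<^sub>R u + z$2 *\<^sub>R v)"
  have lin: "linear f" unfolding f_def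
    by (auto intro!: linearI simp: algebra_simps)
  have T: "?T z $ 1 = fst z" "?T z $ 2 = snd z" for z
    by (auto simp: frame_def case_prod_beta axis_def)
  have fr: "frame p u v = (\<lambda>z. p + f (?T z))"
    by (auto simp: frame_def f_def case_prod_beta T[unfolded frame_def case_prod_beta] axis_def)
  have det: "det (matrix f) = cross2 u v"
    by (simp add: det_2 matrix_def f_def cross2_def axis_def)
  have injf: "inj f"
    using lin det nz by (metis det_nz_iff_inj)
  define C where "C = f -` ((\<lambda>z. z - p) ` K)"
  have trK: "(\<lambda>z. z - p) ` K = (\<lambda>z. z + p) -` K"
    by force
  have fm: "f \<in> borel_measurable borel"
    using lin by (intro borel_measurable_continuous_onI linear_continuous_on)
      (simp add: linear_conv_bounded_linear)
  have Cb: "C \<in> sets borel"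
  proof -
    have "(\<lambda>z. z + p) -` K \<inter> space borel \<in> sets borel"
      by (rule measurable_sets[of _ borel borel]) (use K in auto)
    then show ?thesis unfolding C_def trK
      using measurable_sets[OF fm] by fastforce
  qed
  have surjf: "surj f" using injf lin by (simp add: linear_injective_imp_surjective)
  have fC: "f ` C = (\<lambda>z. z - p) ` K"
    unfolding C_def using surjf by (simp add: surj_image_vimage_eq)
  have Cbd: "bounded C"
  proof -
    obtain g where g: "linear g" "g \<circ> f = id"
      using linear_injective_left_inverse[OF lin injf] by blast
    have "C = g ` (f ` C)" using g(2) by (simp add: image_comp)
    also have "bounded \<dots>" unfolding fC
      using bounded_linear_image[OF bounded_translation_minus[OF K(2)]] g(1)
      by (simp add: linear_conv_bounded_linear)
    finally show ?thesis .
  qed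
  have Cl: "C \<in> lmeasurable"
    using Cb Cbd by (intro bounded_set_imp_lmeasurable) auto
  have "measure lebesgue K = measure lebesgue ((\<lambda>z. z - p) ` K)"
    using measure_translation_subtract[of p K] by simp
  also have "\<dots> = \<bar>cross2 u v\<bar> * measure lebesgue C"
    using measure_linear_image[OF lin Cl] by (simp add: fC det)
  also have "measure lebesgue C = measure lborel C"
    using Cb by simp
  also have "\<dots> = measure (distr lborel borel ?T) C"
    by (simp add: distr_lborel_frame_std)
  also have "\<dots> = measure lborel (?T -` C)"
    using Cb by (subst measure_distr) auto
  also have "?T -` C = frame p u v -` K"
  proof -
    have "f w \<in> (\<lambda>z. z - p) ` K \<longleftrightarrow> p + f w \<in> K" for w
      by (auto simp: trK add.commute)
    then show ?thesis by (auto simp: C_def fr)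
  qed
  finally show ?thesis .
qed

lemma bounded_slice:
  assumes "bounded (S :: (real \<times> real) set)"
  shows "bounded {x. (x, y) \<in> S}" "bounded {y. (x, y) \<in> S}"
proof -
  have "{x. (x, y) \<in> S} \<subseteq> fst ` S" "{y. (x, y) \<in> S} \<subseteq> snd ` S" by force+
  then show "bounded {x. (x, y) \<in> S}" "bounded {y. (x, y) \<in> S}"
    using assms bounded_subset bounded_fst bounded_snd by metis+
qed

lemma borel_slice:
  assumes "S \<in> sets (borel :: (real \<times> real) measure)"
  shows "{x. (x, y) \<in> S} \<in> sets borel" "{y. (x, y) \<in> S} \<in> sets borel"
proof -
  have 1: "(\<lambda>x. (x, y)) \<in> measurable borel borel"
    by (intro borel_measurable_continuous_onI continuous_intros)
  show "{x. (x, y) \<in> S} \<in> sets borel"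
    using measurable_sets[OF 1 assms] by (simp add: vimage_def)
  have 2: "(\<lambda>y. (x, y)) \<in> measurable borel borel"
    by (intro borel_measurable_continuous_onI continuous_intros)
  show "{y. (x, y) \<in> S} \<in> sets borel"
    using measurable_sets[OF 2 assms] by (simp add: vimage_def)
qed

lemma emeasure_bounded_eq_measure:
  assumes "bounded (S :: 'a::euclidean_space set)"
  shows "emeasure lborel S = ennreal (measure lborel S)"
  using emeasure_bounded_finite[OF assms] by (simp add: emeasure_eq_ennreal_measure less_top)

lemma measure_mono_bounded:
  fixes S T :: "'a::euclidean_space set"
  assumes "S \<subseteq> T" "T \<in> sets borel" "bounded T" "S \<in> sets borel"
  shows "measure lborel S \<le> measure lborel T"
  using assms emeasure_bounded_finite[of T]
  by (intro measure_mono_fmeasurable) (auto simp: fmeasurable_def)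

text \<open>Cavalieri's principle in both directions. Boundedness keeps the slices of finite length,
  and the form \<open>has_bochner_integral\<close> lets areas be compared through pointwise bounds
  on slices.\<close>

lemma has_bochner_integral_slices:
  fixes S :: "(real \<times> real) set"
  assumes "S \<in> sets borel" "bounded S"
  shows slices_snd: "has_bochner_integral lborel (\<lambda>y. measure lborel {x. (x, y) \<in> S}) (measure lborel S)"
    and slices_fst: "has_bochner_integral lborel (\<lambda>x. measure lborel {y. (x, y) \<in> S}) (measure lborel S)"
proof -
  have S: "S \<in> sets (lborel \<Otimes>\<^sub>M lborel)"
    using assms(1) by (metis lborel_prod sets_lborel)
  have e1: "emeasure lborel S = (\<integral>\<^sup>+y. ennreal (measure lborel {x. (x, y) \<in> S}) \<partial>lborel)"
    using lborel_pair.emeasure_pair_measure_alt2[OF S] bounded_slice[OF assms(2)]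
    by (simp add: lborel_prod vimage_def emeasure_bounded_eq_measure)
  have e2: "emeasure lborel S = (\<integral>\<^sup>+x. ennreal (measure lborel {y. (x, y) \<in> S}) \<partial>lborel)"
    using lborel.emeasure_pair_measure_alt[OF S] bounded_slice[OF assms(2)]
    by (simp add: lborel_prod vimage_def emeasure_bounded_eq_measure)
  have "(\<lambda>y. emeasure lborel ((\<lambda>x. (x, y)) -` S)) \<in> borel_measurable lborel"
    using lborel_pair.measurable_emeasure_Pair2[OF S] .
  then have "(\<lambda>y. enn2real (emeasure lborel ((\<lambda>x. (x, y)) -` S))) \<in> borel_measurable lborel"
    by measurable
  then have m1: "(\<lambda>y. measure lborel {x. (x, y) \<in> S}) \<in> borel_measurable lborel"
    by (simp add: measure_def vimage_def)
  have "(\<lambda>x. emeasure lborel (Pair x -` S)) \<in> borel_measurable lborel"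
    using lborel.measurable_emeasure_Pair[OF S] .
  then have "(\<lambda>x. enn2real (emeasure lborel (Pair x -` S))) \<in> borel_measurable lborel"
    by measurable
  then have m2: "(\<lambda>x. measure lborel {y. (x, y) \<in> S}) \<in> borel_measurable lborel"
    by (simp add: measure_def vimage_def)
  show "has_bochner_integral lborel (\<lambda>y. measure lborel {x. (x, y) \<in> S}) (measure lborel S)"
    by (rule has_bochner_integral_nn_integral)
      (use m1 e1 emeasure_bounded_eq_measure[OF assms(2)] in auto)
  show "has_bochner_integral lborel (\<lambda>x. measure lborel {y. (x, y) \<in> S}) (measure lborel S)"
    by (rule has_bochner_integral_nn_integral)
      (use m2 e2 emeasure_bounded_eq_measure[OF assms(2)] in auto)
qed

section \<open>The inequality at the corners of the square\<close>

text \<open>The left-hand side is affine in \<open>w\<close>, so only \<open>w = 0\<close> and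
  \<open>w = 1/4\<close> need checking. Equality holds for \<open>t = 0\<close>,
  \<open>w = 1/4\<close>.\<close>

lemma corner_form_bound_aux:
  fixes t w :: real
  assumes t: "0 \<le> t" "t \<le> 1/2" and w: "0 \<le> w" "w \<le> 1/4"
  shows "2 - 2*t*(1-t) - 2*w - (1-t)^2*(1-3*w) - t^3*(1-2*w) \<le> 5/4"
proof -
  let ?F = "\<lambda>w. 2 - 2*t*(1-t) - 2*w - (1-t)^2*(1-3*w) - t^3*(1-2*w)"
  have "?F 0 = 1 + t^2 - t^3" by (simp add: power2_eq_square power3_eq_cube algebra_simps)
  moreover have "t^2 \<le> 1/4" using power_mono[OF t(2) t(1), of 2] by (simp add: power2_eq_square)
  ultimately have F0: "?F 0 \<le> 5/4" using zero_le_power[OF t(1), of 3] by linarith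
  have "?F (1/4) = 5/4 - t*(3/2 - 7/4*t) - t^3/2"
    by (simp add: power2_eq_square power3_eq_cube field_simps)
  moreover have "0 \<le> t*(3/2 - 7/4*t)" using t by (intro mult_nonneg_nonneg) auto
  ultimately have F1: "?F (1/4) \<le> 5/4" using zero_le_power[OF t(1), of 3] by linarith
  have "?F w = (1 - 4*w) * ?F 0 + 4*w * ?F (1/4)" by (simp add: field_simps)
  also have "\<dots> \<le> (1 - 4*w) * (5/4) + 4*w * (5/4)"
    using F0 F1 w by (intro add_mono mult_left_mono) auto
  also have "\<dots> = 5/4" by (simp add: field_simps)
  finally show ?thesis .
qed

text \<open>Collects what the terms \<open>min a b * Z^2/2\<close> of the corner estimates
  contribute when each \<open>Z\<close> is proportional to the product of its two variables.\<close>

definition corner_form :: "real \<Rightarrow> real \<Rightarrow> real \<Rightarrow> real \<Rightarrow> real" where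
  "corner_form a b c d = min a b * (a*b)^2 + min b c * (b*c)^2 + min c d * (c*d)^2 + min d a * (d*a)^2"

lemma corner_form_sym:
  "corner_form c b a d = corner_form a b c d"
  "corner_form a d c b = corner_form a b c d"
  "corner_form b a d c = corner_form a b c d"
  by (simp_all add: corner_form_def min.commute mult.commute)

text \<open>Once the variables are ordered every minimum is known, and the linear constraints leave
  only \<open>c\<close> and \<open>w = b * d\<close>.\<close>

lemma corner_form_bound_ordered:
  fixes a b c d :: real
  assumes "0 \<le> c" "c \<le> d" "d \<le> b" "b \<le> a" "a + c = 1" "b + d = 1"
  shows "a^2 + b^2 + c^2 + d^2 - corner_form a b c d \<le> 5/4"
proof -
  define w where "w = b * d"
  have a: "a = 1 - c" and b: "b = 1 - d" using assms by auto
  have "w \<le> 1/4" using zero_le_power2[of "2*d - 1"] unfolding w_def b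
    by (simp add: power2_eq_square algebra_simps)
  moreover have "0 \<le> w" using assms by (simp add: w_def)
  moreover have "a^2 + b^2 + c^2 + d^2 - corner_form a b c d
      = 2 - 2*c*(1-c) - 2*w - (1-c)^2*(1-3*w) - c^3*(1-2*w)"
  proof -
    have "min a b = b" "min b c = c" "min c d = c" "min d a = d" using assms by auto
    then show ?thesis unfolding corner_form_def w_def a b
      by (simp add: power2_eq_square power3_eq_cube algebra_simps)
  qed
  ultimately show ?thesis using corner_form_bound_aux[of c w] assms by simp
qed

lemma corner_form_bound_unit:
  fixes a b c d :: real
  assumes pos: "0 \<le> a" "0 \<le> b" "0 \<le> c" "0 \<le> d" and "a + c = 1" "b + d = 1"
  shows "a^2 + b^2 + c^2 + d^2 - corner_form a b c d \<le> 5/4"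
proof -
  have 1: "a^2 + b^2 + c^2 + d^2 - corner_form a b c d \<le> 5/4"
    if "0 \<le> c" "c \<le> a" "0 \<le> d" "d \<le> b" "a + c = 1" "b + d = 1" for a b c d :: real
  proof (cases "b \<le> a")
    case True
    then show ?thesis using that by (intro corner_form_bound_ordered) auto
  next
    case False
    then show ?thesis using that corner_form_bound_ordered[of d c a b]
      by (simp add: corner_form_sym algebra_simps)
  qed
  have 2: "a^2 + b^2 + c^2 + d^2 - corner_form a b c d \<le> 5/4"
    if "0 \<le> a" "0 \<le> c" "0 \<le> d" "d \<le> b" "a + c = 1" "b + d = 1" for a b c d :: real
    using that 1[of c a d b] 1[of a c d b] by (cases "c \<le> a") (simp_all add: corner_form_sym algebra_simps)
  show ?thesis
    using assms 2[of a c d b] 2[of a c b d] by (cases "d \<le> b") (simp_all add: corner_form_sym algebra_simps)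
qed

text \<open>Scaling reduces to \<open>X = 1\<close>, but \<open>corner_form\<close> has degree 5 and
  the other term degree 3. The mismatch is resolved by interpolating, with weights
  \<open>1 - X^2\<close> and \<open>X^2\<close>, between the bound 2 for the sum of squares alone
  and the bound 5/4 for the difference.\<close>

lemma corner_form_bound:
  fixes a b c d X :: real
  assumes pos: "0 \<le> a" "0 \<le> b" "0 \<le> c" "0 \<le> d" and X: "a + c = X" "b + d = X" "0 < X" "X \<le> 1"
  shows "X * (a^2 + b^2 + c^2 + d^2) - corner_form a b c d \<le> X^3 * (2 - 3/4 * X^2)"
proof -
  define a' b' c' d' where "a' = a/X" "b' = b/X" "c' = c/X" "d' = d/X"
  note defs = this
  have sc: "a = X*a'" "b = X*b'" "c = X*c'" "d = X*d'" using X by (auto simp: defs)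
  have pos': "0 \<le> a'" "0 \<le> b'" "0 \<le> c'" "0 \<le> d'" using pos X by (auto simp: defs)
  have sum': "a' + c' = 1" "b' + d' = 1" using X by (auto simp: defs add_divide_distrib[symmetric])
  define S where "S = a'^2 + b'^2 + c'^2 + d'^2"
  have c1: "a'^2 + c'^2 = 1 - 2*(a'*c')" "b'^2 + d'^2 = 1 - 2*(b'*d')"
    using sum' by (metis add_diff_cancel_right' mult.assoc one_power2 power2_sum)+
  have S2: "S \<le> 2" unfolding S_def using c1 pos' by (smt (verit) mult_nonneg_nonneg)
  have S1: "S - corner_form a' b' c' d' \<le> 5/4"
    unfolding S_def by (rule corner_form_bound_unit) (use pos' sum' in auto)
  have mn: "min (X*p) (X*q) = X * min p q" for p q using X by (simp add: min_mult_distrib_left)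
  have cf: "corner_form a b c d = X^5 * corner_form a' b' c' d'"
    unfolding corner_form_def sc mn by (simp add: power2_eq_square eval_nat_numeral algebra_simps)
  have "X * (a^2 + b^2 + c^2 + d^2) - corner_form a b c d = X^3 * (S - X^2 * corner_form a' b' c' d')"
    unfolding cf S_def unfolding sc by (simp add: power2_eq_square eval_nat_numeral algebra_simps)
  also have "S - X^2 * corner_form a' b' c' d' = (1 - X^2) * S + X^2 * (S - corner_form a' b' c' d')"
    by (simp add: algebra_simps)
  also have "X^3 * \<dots> \<le> X^3 * ((1 - X^2) * 2 + X^2 * (5/4))"
    using X S1 S2 by (intro mult_left_mono add_mono) (auto simp: power_le_one)
  also have "\<dots> = X^3 * (2 - 3/4 * X^2)" by (simp add: algebra_simps)
  finally show ?thesis .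
qed

text \<open>Clearing the denominator leaves twice the cubic \<open>p\<close>. In its expansion at
  \<open>t\<close> the tangent line and the remainder are both nonnegative on the unit
  interval.\<close>

lemma corner_sum_cubic_pos:
  fixes X :: real
  assumes "0 \<le> X" "X \<le> 1"
  shows "0.6948 * (1 + X) \<le> 1 + X / (2 * (2 - 3/4 * X^2))"
proof -
  define p where "p = (\<lambda>X::real. 0.6104 - 0.8896*X - 0.2289*X^2 + 0.5211*X^3)"
  define t :: real where "t = 0.915"  \<comment> \<open>near the minimum of \<open>p\<close>\<close>
  have "p X = p t + (1.5633*t^2 - 0.4578*t - 0.8896)*(X-t) + (X-t)^2*(0.5211*(X+2*t) - 0.2289)"
  proof -
    have "A + B*X + C*X^2 + D*X^3 = (A + B*t + C*t^2 + D*t^3) + (3*D*t^2 + 2*C*t + B)*(X-t)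
        + (X-t)^2*(D*(X+2*t) + C)" for A B C D :: real
      by (simp add: power2_eq_square power3_eq_cube algebra_simps)
    from this[of "0.6104" "-0.8896" "-0.2289" "0.5211"] show ?thesis
      unfolding p_def by simp
  qed
  moreover have "0 \<le> (X-t)^2*(0.5211*(X+2*t) - 0.2289)"
    using assms by (intro mult_nonneg_nonneg) (auto simp: t_def)
  moreover have "p t + (1.5633*t^2 - 0.4578*t - 0.8896)*(X-t) \<ge> 0"
    using assms unfolding p_def t_def by (simp add: power2_eq_square power3_eq_cube field_simps)
  ultimately have "p X \<ge> 0" by linarith
  moreover have "2 * (2 - 3/4 * X^2) + X - 0.6948 * (1 + X) * (2 * (2 - 3/4 * X^2)) = 2 * p X"
    unfolding p_def by (simp add: power2_eq_square power3_eq_cube field_simps)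
  ultimately have "0.6948 * (1 + X) * (2 * (2 - 3/4 * X^2)) \<le> 2 * (2 - 3/4 * X^2) + X"
    by linarith
  moreover have "0 < 2 * (2 - 3/4 * X^2)"
    using assms power_le_one[of X 2] by simp
  ultimately show ?thesis by (simp add: field_simps)
qed

text \<open>The variables stand for doubled cap areas in cyclic order and \<open>m1\<close>, ...,
  \<open>m4\<close> for the overlaps at the corners between neighbouring caps. The premise forcing
  \<open>Z = 0\<close> is needed because \<open>Z^2/(2*a)\<close> evaluates to 0 for
  \<open>a = 0\<close>.\<close>

lemma corner_sum_bound:
  fixes a b c d X m1 m2 m3 m4 :: real
  assumes pos: "0 \<le> a" "0 \<le> b" "0 \<le> c" "0 \<le> d" and X: "a + c = X" "b + d = X" "X \<le> 1"
    and m: "\<And>Z. 0 \<le> Z \<Longrightarrow> Z * min a b \<le> 1 \<Longrightarrow> (a = 0 \<or> b = 0 \<Longrightarrow> Z = 0) \<Longrightarrow> Z - Z^2/(2*a) - Z^2/(2*b) + min a b * Z^2/2 \<le> m1"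
      "\<And>Z. 0 \<le> Z \<Longrightarrow> Z * min b c \<le> 1 \<Longrightarrow> (b = 0 \<or> c = 0 \<Longrightarrow> Z = 0) \<Longrightarrow> Z - Z^2/(2*b) - Z^2/(2*c) + min b c * Z^2/2 \<le> m2"
      "\<And>Z. 0 \<le> Z \<Longrightarrow> Z * min c d \<le> 1 \<Longrightarrow> (c = 0 \<or> d = 0 \<Longrightarrow> Z = 0) \<Longrightarrow> Z - Z^2/(2*c) - Z^2/(2*d) + min c d * Z^2/2 \<le> m3"
      "\<And>Z. 0 \<le> Z \<Longrightarrow> Z * min d a \<le> 1 \<Longrightarrow> (d = 0 \<or> a = 0 \<Longrightarrow> Z = 0) \<Longrightarrow> Z - Z^2/(2*d) - Z^2/(2*a) + min d a * Z^2/2 \<le> m4"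
  shows "0.6948 * (1 + X) \<le> 1 + m1 + m2 + m3 + m4"
proof (cases "X = 0")
  case True
  have "0 \<le> m1" "0 \<le> m2" "0 \<le> m3" "0 \<le> m4" using m[of 0] by auto
  then show ?thesis using True by simp
next
  case False
  then have Xp: "0 < X" using pos X by linarith
  define e where "e = 2 - 3/4 * X^2"
  have X2: "X^2 \<le> 1" using Xp X by (simp add: power_le_one)
  then have e: "1 \<le> e" by (simp add: e_def)
  txt \<open>\<open>Z\<close> is taken proportional to the product of the two variables; \<open>l\<close> maximizes the resulting
    lower bound \<open>l * X^2 - l^2/2 * (X^3 * e)\<close> for the sum.\<close>
  define l where "l = 1/(X*e)"
  have l: "0 \<le> l" using e Xp by (simp add: l_def)
  have le: "p \<le> X" if "p \<in> {a,b,c,d}" for p using that pos X by auto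
  have step: "l*(p*q) - l^2/2*(p*q*(p+q) - min p q*(p*q)^2) \<le> m"
    if mm: "\<And>Z. 0 \<le> Z \<Longrightarrow> Z * min p q \<le> 1 \<Longrightarrow> (p = 0 \<or> q = 0 \<Longrightarrow> Z = 0) \<Longrightarrow> Z - Z^2/(2*p) - Z^2/(2*q) + min p q * Z^2/2 \<le> m"
      and pq: "0 \<le> p" "0 \<le> q" "p \<le> X" "q \<le> X" for p q m
  proof -
    define Z where "Z = l*(p*q)"
    have "p*q*min p q \<le> X*X*X"
      using pq Xp by (intro mult_mono) auto
    also have "X*X*X \<le> X*e" using X2 e Xp X by (auto simp: power2_eq_square intro: mult_mono order_trans)
    finally have Z1: "Z * min p q \<le> 1" unfolding Z_def l_def using Xp e
      by (simp add: field_simps)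
    have Z0: "0 \<le> Z" using l pq by (simp add: Z_def)
    have "Z = 0" if "p = 0 \<or> q = 0" using that by (auto simp: Z_def)
    from mm[OF Z0 Z1 this] have "Z - Z^2/(2*p) - Z^2/(2*q) + min p q * Z^2/2 \<le> m" .
    moreover have "Z^2/(2*p) = l^2/2*(p*q*q)" unfolding Z_def by (simp add: power2_eq_square)
    moreover have "Z^2/(2*q) = l^2/2*(p*q*p)" unfolding Z_def by (simp add: power2_eq_square)
    ultimately show ?thesis unfolding Z_def by (simp add: power2_eq_square algebra_simps)
  qed
  have "l*(a*b+b*c+c*d+d*a) - l^2/2*((a*b*(a+b)+b*c*(b+c)+c*d*(c+d)+d*a*(d+a)) - corner_form a b c d)
      \<le> m1 + m2 + m3 + m4"
  proof -
    let ?L = "\<lambda>p q. l*(p*q) - l^2/2*(p*q*(p+q) - min p q*(p*q)^2)"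
    have "?L a b \<le> m1" by (rule step[OF m(1)]) (use pos le in auto)
    moreover have "?L b c \<le> m2" by (rule step[OF m(2)]) (use pos le in auto)
    moreover have "?L c d \<le> m3" by (rule step[OF m(3)]) (use pos le in auto)
    moreover have "?L d a \<le> m4" by (rule step[OF m(4)]) (use pos le in auto)
    moreover have "l*(a*b+b*c+c*d+d*a) - l^2/2*((a*b*(a+b)+b*c*(b+c)+c*d*(c+d)+d*a*(d+a)) - corner_form a b c d)
      = ?L a b + ?L b c + ?L c d + ?L d a"
      unfolding corner_form_def by (simp add: algebra_simps)
    ultimately show ?thesis by linarith
  qed
  moreover have "a*b+b*c+c*d+d*a = X^2"
    using X(1,2) by (simp add: power2_eq_square flip: X(1)) (metis X(2) X(1) distrib_left distrib_right add.assoc add.commute mult.commute)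
  moreover have "a*b*(a+b)+b*c*(b+c)+c*d*(c+d)+d*a*(d+a) = X*(a^2+b^2+c^2+d^2)"
  proof -
    have "a*b*(a+b)+b*c*(b+c)+c*d*(c+d)+d*a*(d+a) = a^2*(b+d) + b^2*(a+c) + c^2*(b+d) + d^2*(a+c)"
      by (simp add: power2_eq_square algebra_simps)
    then show ?thesis by (simp add: X algebra_simps)
  qed
  moreover have "l^2/2*(X*(a^2+b^2+c^2+d^2) - corner_form a b c d) \<le> l^2/2*(X^3*e)"
    using corner_form_bound[OF pos X(1,2) Xp X(3)] unfolding e_def by (intro mult_left_mono) auto
  moreover have "l*X^2 - l^2/2*(X^3*e) = X/(2*e)"
    unfolding l_def using Xp e by (simp add: power2_eq_square power3_eq_cube field_simps)
  ultimately have "X/(2*e) \<le> m1 + m2 + m3 + m4" by simp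
  then show ?thesis using corner_sum_cubic_pos[of X] Xp X unfolding e_def by linarith
qed

text \<open>Supports at the corners of the square bound the heights of triangles inscribed over its sides.\<close>

lemma opposite_heights_product_le_1:
  fixes x1 x2 x3 x4 :: real
  assumes x: "0 < x1" "0 < x2" "0 < x3" "0 < x4" and p: "0 < p" "0 < q" "0 < r" "0 < t"
    and "x1 * (t + 1/p) \<le> 1" "x2 * (p + 1/q) \<le> 1" "x3 * (q + 1/r) \<le> 1" "x4 * (r + 1/t) \<le> 1"
  shows "(x1 + x3) * (x2 + x4) \<le> 1"
proof -
  \<comment> \<open>Both \<open>A*C\<close> and \<open>B*D\<close> equal the product
    \<open>p*q*r*t\<close>; after clearing denominators the defect in the inequality is exactly
    \<open>(1 - A*C)^2\<close>.\<close>
  define A B C D where "A = p*q" "B = q*r" "C = r*t" "D = t*p"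
  note defs = this
  have pos: "0 < A" "0 < B" "0 < C" "0 < D" using p by (auto simp: defs)
  have ACBD: "A*C = B*D" by (simp add: defs)
  have b: "x1 \<le> p/(1+D)" "x2 \<le> q/(1+A)" "x3 \<le> r/(1+B)" "x4 \<le> t/(1+C)"
  proof -
    have "x \<le> u/(1 + v * u)" if "x * (v + 1/u) \<le> 1" "0 < u" "0 < v" for x u v :: real
    proof -
      have "x * (1 + v * u) \<le> u" using that by (simp add: field_simps)
      then show ?thesis using that by (simp add: pos_le_divide_eq add_pos_pos)
    qed
    then show "x1 \<le> p/(1+D)" "x2 \<le> q/(1+A)" "x3 \<le> r/(1+B)" "x4 \<le> t/(1+C)"
      using assms by (auto simp: defs)
  qed
  have "(x1 + x3) * (x2 + x4) \<le> (p/(1+D) + r/(1+B)) * (q/(1+A) + t/(1+C))"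
    using b x p pos by (intro mult_mono add_mono) auto
  also have "\<dots> = A/((1+D)*(1+A)) + D/((1+D)*(1+C)) + B/((1+B)*(1+A)) + C/((1+B)*(1+C))"
    by (simp add: defs algebra_simps)
  also have "\<dots> = (A*(1+B)*(1+C) + D*(1+A)*(1+B) + B*(1+C)*(1+D) + C*(1+A)*(1+D)) / ((1+A)*(1+B)*(1+C)*(1+D))"
    using pos by (simp add: divide_simps) (simp add: algebra_simps)
  also have "\<dots> \<le> 1"
  proof -
    have "A*(1+B)*(1+C) + D*(1+A)*(1+B) + B*(1+C)*(1+D) + C*(1+A)*(1+D) + (1 - A*C)^2
       = (1+A)*(1+B)*(1+C)*(1+D) - (A*C - B*D) * (1 - A*C)"
      by (simp add: power2_eq_square algebra_simps)
    then have "A*(1+B)*(1+C) + D*(1+A)*(1+B) + B*(1+C)*(1+D) + C*(1+A)*(1+D) + (1 - A*C)^2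
       = (1+A)*(1+B)*(1+C)*(1+D)" unfolding ACBD by simp
    then have "A*(1+B)*(1+C) + D*(1+A)*(1+B) + B*(1+C)*(1+D) + C*(1+A)*(1+D) \<le> (1+A)*(1+B)*(1+C)*(1+D)"
      using zero_le_power2[of "1 - A*C"] by linarith
    then show ?thesis using pos by (simp add: divide_le_eq_1)
  qed
  finally show ?thesis .
qed

section \<open>Caps over the sides of an inscribed square\<close>

lemma has_bochner_integral_le:
  fixes f g :: "'a \<Rightarrow> real"
  assumes "has_bochner_integral M f x" "has_bochner_integral M g y" "\<And>z. f z \<le> g z"
  shows "x \<le> y"
  using assms integral_mono[of M f g] by (auto simp: has_bochner_integral_iff)

text \<open>Half-open intervals make adjacent pieces add up pointwise without overlap.\<close>

lemma has_bochner_integral_affine: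
  fixes a b c d :: real
  assumes "a \<le> b"
  shows "has_bochner_integral lborel (\<lambda>z. indicator {a<..b} z * (c + d * z)) (c * (b - a) + d * (b^2 - a^2)/2)"
proof -
  have "has_bochner_integral lborel (\<lambda>z. (c + d * z) * indicator {a..b} z)
      ((c*b + d*b^2/2) - (c*a + d*a^2/2))"
    using assms by (intro has_bochner_integral_FTC_Icc_real) (auto intro!: derivative_eq_intros continuous_intros)
  also have "(c*b + d*b^2/2) - (c*a + d*a^2/2) = c * (b - a) + d * (b^2 - a^2)/2"
    by (simp add: algebra_simps diff_divide_distrib)
  finally have *: "has_bochner_integral lborel (\<lambda>z. (c + d * z) * indicator {a..b} z) (c * (b - a) + d * (b^2 - a^2)/2)" .
  show ?thesis
  proof (rule has_bochner_integral_cong_AE[THEN iffD2, OF _ _ _ *])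
    show "AE x in lborel. indicator {a<..b} x * (c + d * x) = (c + d * x) * indicator {a..b} x"
      using AE_lborel_singleton[of a] by eventually_elim (auto simp: indicator_def)
  qed auto
qed

text \<open>The functions bounded below here are the widths of the slices of a convex region over a unit base.\<close>

lemma concave_initial_area:
  fixes \<phi> :: "real \<Rightarrow> real"
  assumes G: "has_bochner_integral lborel (\<lambda>z. indicator {0<..} z * \<phi> z) G" "0 < G"
    and nonneg: "\<And>z. 0 \<le> \<phi> z" and Z: "0 < Z"
    and conc: "\<And>z w. 0 < z \<Longrightarrow> z \<le> w \<Longrightarrow> 0 < \<phi> w \<Longrightarrow> (1 - z/w) + z/w * \<phi> w \<le> \<phi> z"
  obtains I where "has_bochner_integral lborel (\<lambda>z. indicator {0<..Z} z * \<phi> z) I" "Z - Z^2/(4*G) \<le> I"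
proof -
  define I where "I = (\<integral>z. indicator {0<..Z} z * \<phi> z \<partial>lborel)"
  have "integrable lborel (\<lambda>z. indicator {0<..Z} z *\<^sub>R (indicator {0<..} z * \<phi> z))"
    using G(1) by (intro integrable_mult_indicator) (auto simp: has_bochner_integral_iff)
  moreover have "(\<lambda>z. indicator {0<..Z} z *\<^sub>R (indicator {0<..} z * \<phi> z)) = (\<lambda>z. indicator {0<..Z} z * \<phi> z)"
    by (auto simp: indicator_def)
  ultimately have "integrable lborel (\<lambda>z. indicator {0<..Z} z * \<phi> z)" by simp
  then have I: "has_bochner_integral lborel (\<lambda>z. indicator {0<..Z} z * \<phi> z) I"
    by (simp add: has_bochner_integral_iff I_def)
  have "Z - Z^2/(4*G) \<le> I"
  proof (cases "0 < \<phi> Z")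
    case False
    have z0: "\<phi> z = 0" if "Z \<le> z" for z
    proof (rule ccontr)
      assume "\<phi> z \<noteq> 0"
      then have p: "0 < \<phi> z" using nonneg[of z] by simp
      have "(1 - Z/z) + Z/z * \<phi> z \<le> \<phi> Z" using conc[OF Z that p] .
      moreover have "0 \<le> 1 - Z/z" "0 < Z/z * \<phi> z" using that Z p by auto
      ultimately show False using False by linarith
    qed
    have "indicator {0<..} z * \<phi> z = indicator {0<..Z} z * \<phi> z" for z
      using z0[of z] by (auto simp: indicator_def)
    then have "(\<lambda>z. indicator {0<..} z * \<phi> z) = (\<lambda>z. indicator {0<..Z} z * \<phi> z)" by blast
    then have "G = I" using has_bochner_integral_eq[OF G(1)] I by simp
    moreover have "0 \<le> (2*G - Z)^2" by simp
    then have "Z - Z^2/(4*G) \<le> G" using G(2) by (simp add: field_simps power2_eq_square)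
    ultimately show ?thesis by simp
  next
    case True
    \<comment> \<open>\<open>1 - k*z\<close> is the chord line from height 1 at 0 to
      \<open>\<phi> Z\<close> at \<open>Z\<close>; \<open>\<phi>\<close> lies above it before
      \<open>Z\<close> and below it afterwards. The extremal profile is the triangle
      \<open>1 - z/(2*G)\<close> of area \<open>G\<close>, whose initial area is
      \<open>Z - Z^2/(4*G)\<close>.\<close>
    define k where "k = (1 - \<phi> Z)/Z"
    have low: "1 - k*z \<le> \<phi> z" if "0 < z" "z \<le> Z" for z
    proof -
      have "1 - k*z = (1 - z/Z) + z/Z * \<phi> Z" using Z unfolding k_def by (simp add: field_simps)
      then show ?thesis using conc[OF that True] by simp
    qed
    have "Z - k*Z^2/2 \<le> I"
    proof -
      have "has_bochner_integral lborel (\<lambda>z. indicator {0<..Z} z * (1 + (-k) * z)) (1 * (Z - 0) + (-k) * (Z^2 - 0^2)/2)"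
        using Z by (intro has_bochner_integral_affine) auto
      from has_bochner_integral_le[OF this I] low show ?thesis
        by (simp add: indicator_def)
    qed
    show ?thesis
    proof (cases "k \<le> 0")
      case True
      then have "k*Z^2/2 \<le> 0" by (simp add: mult_nonpos_nonneg)
      moreover have "0 \<le> Z^2/(4*G)" using G by simp
      ultimately show ?thesis using \<open>Z - k*Z^2/2 \<le> I\<close> by linarith
    next
      case False
      then have k: "0 < k" by simp
      have kZ: "k*Z < 1" using True Z by (simp add: k_def)
      then have Z1: "Z \<le> 1/k" using k by (simp add: field_simps)
      have up: "\<phi> z \<le> max 0 (1 - k*z)" if "Z \<le> z" for z
      proof (cases "0 < \<phi> z")
        case p: True
        have "(1 - Z/z) + Z/z * \<phi> z \<le> \<phi> Z" using conc[OF Z that p] .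
        then have "z/Z * ((1 - Z/z) + Z/z * \<phi> z) \<le> z/Z * \<phi> Z"
          using that Z by (intro mult_left_mono) auto
        moreover have "z/Z * ((1 - Z/z) + Z/z * \<phi> z) = z/Z - 1 + \<phi> z"
          using that Z by (simp add: field_simps)
        moreover have "z/Z * \<phi> Z = z/Z - k*z" using Z unfolding k_def by (simp add: field_simps)
        ultimately have "\<phi> z \<le> 1 - k*z" by linarith
        then show ?thesis by simp
      qed auto
      \<comment> \<open>The part of \<open>\<phi>\<close> beyond \<open>Z\<close> fits under the
        chord line, which reaches 0 at \<open>1/k\<close>.\<close>
      have A: "has_bochner_integral lborel (\<lambda>z. indicator {Z<..1/k} z * (1 + (-k) * z)) (1 * (1/k - Z) + (-k) * ((1/k)^2 - Z^2)/2)"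
        using Z1 by (intro has_bochner_integral_affine)
      have B: "1 * (1/k - Z) + (-k) * ((1/k)^2 - Z^2)/2 = 1/(2*k) - Z + k*Z^2/2"
        using k by (simp add: field_simps power2_eq_square)
      note J = has_bochner_integral_add[OF I A[unfolded B]]
      have "G \<le> I + (1/(2*k) - Z + k*Z^2/2)"
      proof (rule has_bochner_integral_le[OF G(1) J])
        fix z
        have "\<phi> z \<le> 0" if "1/k < z"
        proof -
          have "1 \<le> k*z" using that k by (simp add: field_simps)
          moreover have "Z \<le> z" using that Z1 by linarith
          ultimately show ?thesis using up[of z] by simp
        qed
        moreover have "\<phi> z \<le> 1 - k*z" if "Z \<le> z" "z \<le> 1/k"
          using up[OF that(1)] that k by (simp add: field_simps)
        ultimately show "indicator {0<..} z * \<phi> z \<le> indicator {0<..Z} z * \<phi> z + indicator {Z<..1/k} z * (1 + (-k) * z)"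
          using Z by (auto simp: indicator_def)
      qed
      \<comment> \<open>The excess of the initial area over the area under the chord. If the chord
        is so steep that \<open>1/(2*k) < G\<close>, the total area \<open>G\<close> forces this
        excess to compensate.\<close>
      define e where "e = I - (Z - k*Z^2/2)"
      have e: "0 \<le> e" "G \<le> e + 1/(2*k)"
        using \<open>Z - k*Z^2/2 \<le> I\<close> \<open>G \<le> I + _\<close> by (auto simp: e_def)
      have "k*Z^2/2 - e \<le> Z^2/(4*G)"
      proof (cases "k*Z^2/2 - e \<le> 0")
        case True
        moreover have "0 \<le> Z^2/(4*G)" using G by simp
        ultimately show ?thesis by linarith
      next
        case False
        then have "4*G*(k*Z^2/2 - e) \<le> 4*(e + 1/(2*k))*(k*Z^2/2 - e)"
          using e by (intro mult_right_mono) auto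
        also have "\<dots> = Z^2 + 2*(e/k)*((k*Z)^2 - 1) - 4*e^2"
          using k by (simp add: field_simps power2_eq_square)
        also have "\<dots> \<le> Z^2"
        proof -
          have "(k*Z)^2 \<le> 1" using kZ k Z by (simp add: power_le_one)
          then have "2*(e/k)*((k*Z)^2 - 1) \<le> 0" using e k by (intro mult_nonneg_nonpos) auto
          then show ?thesis using zero_le_power2[of e] by linarith
        qed
        finally show ?thesis using G(2) by (simp add: field_simps)
      qed
      then show ?thesis by (simp add: e_def)
    qed
  qed
  with I that show ?thesis by blast
qed

text \<open>Comparison with a triangle of height \<open>1/k\<close> over a unit base; the product
  form also covers \<open>k = 0\<close>.\<close>

lemma tent_area_bound:
  fixes \<phi> :: "real \<Rightarrow> real"
  assumes G: "has_bochner_integral lborel (\<lambda>z. indicator {0<..} z * \<phi> z) G"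
    and up: "\<And>z. 0 < z \<Longrightarrow> \<phi> z \<le> max 0 (1 - k*z)" and k: "0 \<le> k"
  shows "2 * G * k \<le> 1"
proof (cases "k = 0")
  case False
  with k have k: "0 < k" by simp
  have *: "has_bochner_integral lborel (\<lambda>z. indicator {0<..1/k} z * (1 + (-k) * z)) (1 * (1/k - 0) + (-k) * ((1/k)^2 - 0^2)/2)"
    using k by (intro has_bochner_integral_affine) auto
  have "G \<le> 1 * (1/k - 0) + (-k) * ((1/k)^2 - 0^2)/2"
  proof (rule has_bochner_integral_le[OF G *])
    fix z
    show "indicator {0<..} z * \<phi> z \<le> indicator {0<..1/k} z * (1 + (-k) * z)"
    proof (cases "0 < z")
      case True
      then show ?thesis using up[of z] k by (auto simp: indicator_def field_simps)
    qed auto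
  qed
  then have "G \<le> 1/(2*k)" using k by (simp add: field_simps power2_eq_square)
  then show ?thesis using k by (simp add: field_simps)
qed auto

section \<open>Quarter turns about \<open>(1/2, 1/2)\<close>, which bring each side of the square to
  the top\<close>

definition rot :: "(real \<times> real) set \<Rightarrow> (real \<times> real) set" where
  "rot S = {z. (snd z, 1 - fst z) \<in> S}"

lemma mem_rot [simp]: "(x, y) \<in> rot S \<longleftrightarrow> (y, 1 - x) \<in> S"
  by (simp add: rot_def)

lemma rot4 [simp]: "rot (rot (rot (rot S))) = S"
  by auto

lemma rot_vimage: "rot S = (\<lambda>z. (snd z, 1 - fst z)) -` S"
  by (auto simp: rot_def)

lemma rot_image: "rot S = (\<lambda>z. (1 - snd z, fst z)) ` S"
proof (rule set_eqI)
  fix z :: "real \<times> real"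
  show "z \<in> rot S \<longleftrightarrow> z \<in> (\<lambda>z. (1 - snd z, fst z)) ` S"
    by (cases z) (force simp: image_iff)
qed

lemma borel_rot:
  assumes "S \<in> sets borel"
  shows "rot S \<in> sets borel"
proof -
  have "(\<lambda>z::real\<times>real. (snd z, 1 - fst z)) \<in> measurable borel borel"
    by (intro borel_measurable_continuous_onI continuous_intros)
  from measurable_sets[OF this assms] show ?thesis by (simp add: rot_vimage)
qed

lemma compact_rot:
  assumes "compact S"
  shows "compact (rot S)"
  unfolding rot_image by (intro compact_continuous_image continuous_intros assms)

lemma bounded_rot:
  assumes "bounded S"
  shows "bounded (rot S)"
proof -
  have "bounded (rot (closure S))"
    using assms by (intro compact_imp_bounded compact_rot) (simp add: compact_closure)
  moreover have "rot S \<subseteq> rot (closure S)"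
    unfolding rot_def using closure_subset by auto
  ultimately show ?thesis using bounded_subset by blast
qed

lemma convex_rot:
  assumes "convex S"
  shows "convex (rot S)"
proof (rule convexI)
  fix x y :: "real \<times> real" and u v :: real
  assume *: "x \<in> rot S" "y \<in> rot S" "0 \<le> u" "0 \<le> v" "u + v = 1"
  have "u *\<^sub>R (snd x, 1 - fst x) + v *\<^sub>R (snd y, 1 - fst y) \<in> S"
    using * assms by (intro convexD) (auto simp: rot_def)
  also have "u *\<^sub>R (snd x, 1 - fst x) + v *\<^sub>R (snd y, 1 - fst y)
      = (u * snd x + v * snd y, 1 - (u * fst x + v * fst y))"
    using *(5) by (simp add: algebra_simps)
  finally show "u *\<^sub>R x + v *\<^sub>R y \<in> rot S" by (simp add: rot_def)
qed

lemma measure_reflect_real: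
  fixes A :: "real set"
  assumes "A \<in> sets borel"
  shows "measure lborel {x. c - x \<in> A} = measure lborel A"
proof -
  have "lborel = distr lborel borel (\<lambda>x. c + (-1) * x)"
    using lborel_real_affine[of "-1" c] by (simp add: density_1)
  then have "measure lborel A = measure (distr lborel borel (\<lambda>x. c + (-1) * x)) A"
    by metis
  also have "\<dots> = measure lborel ((\<lambda>x. c + (-1) * x) -` A)"
    using assms by (subst measure_distr) auto
  finally show ?thesis by (simp add: vimage_def)
qed

text \<open>Horizontal slices of \<open>rot S\<close> are vertical slices of \<open>S\<close> in
  reversed orientation.\<close>

lemma measure_rot:
  assumes "S \<in> sets borel" "bounded S"
  shows "measure lborel (rot S) = measure lborel S"
proof -
  have "measure lborel {x. (x, y) \<in> rot S} = measure lborel {x. (y, x) \<in> S}" for y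
    using measure_reflect_real[OF borel_slice(2)[OF assms(1)], of 1 y] by simp
  then show ?thesis
    using slices_snd[OF borel_rot[OF assms(1)] bounded_rot[OF assms(2)]] slices_fst[OF assms]
      has_bochner_integral_eq by simp
qed

lemma measure_swap:
  fixes S :: "(real \<times> real) set"
  assumes "S \<in> sets borel" "bounded S"
  shows "{w. (snd w, fst w) \<in> S} \<in> sets borel" "bounded {w. (snd w, fst w) \<in> S}"
    and "measure lborel {w. (snd w, fst w) \<in> S} = measure lborel S"
proof -
  have "(\<lambda>z::real\<times>real. (snd z, fst z)) \<in> measurable borel borel"
    by (intro borel_measurable_continuous_onI continuous_intros)
  from measurable_sets[OF this assms(1)] show b: "{w. (snd w, fst w) \<in> S} \<in> sets borel"
    by (simp add: vimage_def)
  have "{w. (snd w, fst w) \<in> S} = prod.swap ` S" by force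
  moreover have "bounded (prod.swap ` S)"
  proof -
    have "bounded (snd ` S \<times> fst ` S)" using assms by (simp add: bounded_Times bounded_fst bounded_snd)
    then show ?thesis by (rule bounded_subset) force
  qed
  ultimately show c: "bounded {w. (snd w, fst w) \<in> S}" by simp
  show "measure lborel {w. (snd w, fst w) \<in> S} = measure lborel S"
    using slices_snd[OF b c] slices_fst[OF assms] has_bochner_integral_eq by simp
qed

definition width :: "(real \<times> real) set \<Rightarrow> real \<Rightarrow> real" where
  "width S z = measure lborel {x. (x, 1 + z) \<in> S}"

definition cap_area :: "(real \<times> real) set \<Rightarrow> real" where
  "cap_area S = measure lborel (S \<inter> {w. 1 < snd w})"

lemma borel_halfplanes [measurable, simp]:
  "{w::real\<times>real. a < snd w} \<in> sets borel" "{w::real\<times>real. snd w < a} \<in> sets borel"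
  "{w::real\<times>real. a < fst w} \<in> sets borel" "{w::real\<times>real. fst w < a} \<in> sets borel"
  by (intro borel_open open_Collect_less continuous_intros)+

lemma cap_area_integral:
  assumes "S \<in> sets borel" "bounded S"
  shows "has_bochner_integral lborel (\<lambda>z. indicator {0<..} z * width S z) (cap_area S)"
proof -
  let ?T = "S \<inter> {w. 1 < snd w}"
  have T: "?T \<in> sets borel" "bounded ?T"
    using assms by (auto intro: bounded_subset)
  have "has_bochner_integral lborel (\<lambda>z. measure lborel {x. (x, 1 + 1 * z) \<in> ?T}) (inverse \<bar>1\<bar> *\<^sub>R cap_area S)"
    unfolding cap_area_def
    using lborel_has_bochner_integral_real_affine_iff[of 1 "\<lambda>y. measure lborel {x. (x, y) \<in> ?T}" _ 1]
      slices_snd[OF T] by simp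
  moreover have "measure lborel {x. (x, 1 + z) \<in> ?T} = indicator {0<..} z * width S z" for z
    by (auto simp: indicator_def width_def)
  ultimately show ?thesis by simp
qed

text \<open>A line of support at the corner \<open>(1, 1)\<close> with outer normal
  \<open>(c, s)\<close>; the signs are those forced by containing the unit square. The other corners
  are reached through \<open>rot\<close>.\<close>

definition supports :: "(real \<times> real) set \<Rightarrow> real \<Rightarrow> real \<Rightarrow> bool" where
  "supports S c s \<longleftrightarrow> 0 \<le> c \<and> 0 \<le> s \<and> 0 < c + s \<and> (\<forall>x y. (x, y) \<in> S \<longrightarrow> c * (x - 1) + s * (y - 1) \<le> 0)"

text \<open>The unit square is inscribed in \<open>S\<close> with a line of support of \<open>S\<close> at each of its corners.\<close>

definition squared :: "(real \<times> real) set \<Rightarrow> bool" where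
  "squared S \<longleftrightarrow> compact S \<and> convex S \<and> {0..1} \<times> {0..1} \<subseteq> S \<and>
    (\<exists>c s. supports S c s) \<and> (\<exists>c s. supports (rot S) c s) \<and>
    (\<exists>c s. supports (rot (rot S)) c s) \<and> (\<exists>c s. supports (rot (rot (rot S))) c s)"

lemma squared_rot: "squared S \<Longrightarrow> squared (rot S)"
proof -
  assume S: "squared S"
  then have "(b, 1 - a) \<in> S" if "0 \<le> a" "a \<le> 1" "0 \<le> b" "b \<le> 1" for a b
    unfolding squared_def using that by (auto dest!: subsetD[of _ _ "(b, 1 - a)"])
  then show ?thesis using S unfolding squared_def by (auto simp: compact_rot convex_rot)
qed

lemma squared_borel: "squared S \<Longrightarrow> S \<in> sets borel" "squared S \<Longrightarrow> bounded S"
  unfolding squared_def by (auto intro: borel_compact compact_imp_bounded)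

text \<open>The supports at the two ends \<open>(1, 1)\<close> and \<open>(0, 1)\<close> of the top
  side; three quarter turns carry the second end to \<open>(1, 1)\<close>.\<close>

lemma cap_slopes:
  assumes "supports S c s" "supports (rot (rot (rot S))) c' s'" "(x, 1 + z) \<in> S"
  shows "s * z \<le> c * (1 - x)" "c' * z \<le> s' * x"
proof -
  have "c * (x - 1) + s * (1 + z - 1) \<le> 0"
    using assms unfolding supports_def by blast
  then show "s * z \<le> c * (1 - x)" by (simp add: algebra_simps)
  have "(1 + z, 1 - x) \<in> rot (rot (rot S))" using assms by simp
  then have "c' * (1 + z - 1) + s' * (1 - x - 1) \<le> 0"
    using assms unfolding supports_def by blast
  then show "c' * z \<le> s' * x" by (simp add: algebra_simps)
qed

text \<open>If \<open>c = 0\<close> or \<open>s' = 0\<close>, a support is horizontal and no point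
  of \<open>S\<close> lies above the side. Otherwise the two supports confine the cap to the strip
  over the side.\<close>

lemma cap_range:
  assumes S: "squared S" and z: "(x, 1 + z) \<in> S" "0 < z"
  shows "0 \<le> x" "x \<le> 1"
proof -
  obtain c s c' s' where cs: "supports S c s" "supports (rot (rot (rot S))) c' s'"
    using S unfolding squared_def by blast
  note * = cap_slopes[OF cs z(1)]
  have "c \<noteq> 0" "s' \<noteq> 0" using * cs z(2) unfolding supports_def by (auto simp: mult_le_0_iff)
  then have c: "0 < c" "0 < s'" using cs unfolding supports_def by auto
  have "0 \<le> c * (1 - x)" "0 \<le> s' * x"
    using * cs z(2) unfolding supports_def by (meson mult_nonneg_nonneg less_imp_le order_trans)+
  then show "0 \<le> x" "x \<le> 1" using c by (auto simp: zero_le_mult_iff)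
qed

text \<open>The slice at height \<open>z\<close> over the side fits into an interval of length
  \<open>1 - (k + l) * z\<close>, so \<open>tent_area_bound\<close> applies.\<close>

lemma cap_area_slopes:
  assumes S: "S \<in> sets borel" "bounded S" and k: "0 \<le> k" "0 \<le> l"
    and sl: "\<And>x z. 0 < z \<Longrightarrow> (x, 1 + z) \<in> S \<Longrightarrow> k * z \<le> x \<and> l * z \<le> 1 - x"
  shows "2 * cap_area S * (k + l) \<le> 1"
proof (rule tent_area_bound[OF cap_area_integral[OF S]])
  fix z :: real assume z: "0 < z"
  have sub: "{x. (x, 1 + z) \<in> S} \<subseteq> {k*z..1 - l*z}"
    using sl[OF z] by (force simp: algebra_simps)
  have "measure lborel {x. (x, 1 + z) \<in> S} \<le> measure lborel {k*z..1 - l*z}"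
    by (rule measure_mono_bounded[OF sub]) (use borel_slice S in auto)
  then show "width S z \<le> max 0 (1 - (k + l) * z)"
    by (cases "k*z \<le> 1 - l*z") (auto simp: width_def algebra_simps)
qed (use k in auto)

lemma cap_area_nonneg: "0 \<le> cap_area S"
  by (simp add: cap_area_def)

lemma cap_area_pos_point:
  assumes "0 < cap_area S"
  obtains x z where "0 < z" "(x, 1 + z) \<in> S"
proof -
  have "S \<inter> {w. 1 < snd w} \<noteq> {}" using assms unfolding cap_area_def by (metis less_irrefl measure_empty)
  then obtain x y where "(x, y) \<in> S" "1 < y" by auto
  then show ?thesis using that[of "y - 1" x] by simp
qed

text \<open>\<open>2 * cap_area S\<close> is the height of the triangle of equal area over the unit
  side; the supports limit it. The first two claims avoid division and therefore hold for a null cap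
  too.\<close>

lemma cap_area_support:
  assumes S: "squared S" and cs: "supports S c s" "supports (rot (rot (rot S))) c' s'"
  shows "2 * cap_area S * s \<le> c" "2 * cap_area S * c' \<le> s'"
    and "0 < cap_area S \<Longrightarrow> 0 < c \<and> 0 < s' \<and> 2 * cap_area S * (c'/s' + s/c) \<le> 1"
proof -
  have pos: "0 < c \<and> 0 < s' \<and> 2 * cap_area S * (c'/s' + s/c) \<le> 1" if p: "0 < cap_area S"
  proof -
    obtain x z where xz: "0 < z" "(x, 1 + z) \<in> S" using cap_area_pos_point[OF p] .
    have "c \<noteq> 0" "s' \<noteq> 0"
      using cap_slopes[OF cs xz(2)] cs xz(1) unfolding supports_def by (auto simp: mult_le_0_iff)
    then have c: "0 < c" "0 < s'" using cs unfolding supports_def by auto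
    have "2 * cap_area S * (c'/s' + s/c) \<le> 1"
    proof (rule cap_area_slopes[OF squared_borel[OF S]])
      show "0 \<le> c'/s'" "0 \<le> s/c" using c cs unfolding supports_def by auto
      fix x z assume "(x, 1 + z) \<in> S"
      from cap_slopes[OF cs this] show "c'/s' * z \<le> x \<and> s/c * z \<le> 1 - x"
        using c by (simp add: field_simps)
    qed
    with c show ?thesis by blast
  qed
  then show "0 < cap_area S \<Longrightarrow> 0 < c \<and> 0 < s' \<and> 2 * cap_area S * (c'/s' + s/c) \<le> 1" .
  have c0: "0 \<le> c" "0 \<le> s" "0 \<le> c'" "0 \<le> s'" using cs unfolding supports_def by auto
  show "2 * cap_area S * s \<le> c" "2 * cap_area S * c' \<le> s'"
  proof -
    consider "cap_area S = 0" | "0 < cap_area S" using cap_area_nonneg[of S] by linarith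
    then have "2 * cap_area S * s \<le> c \<and> 2 * cap_area S * c' \<le> s'"
    proof cases
      case 2
      note p = pos[OF 2]
      have "0 \<le> 2 * cap_area S * (c'/s')" "0 \<le> 2 * cap_area S * (s/c)"
        using c0 2 by auto
      moreover have "2 * cap_area S * (c'/s') + 2 * cap_area S * (s/c) \<le> 1"
        using p by (simp add: algebra_simps)
      ultimately have "2 * cap_area S * (c'/s') \<le> 1" "2 * cap_area S * (s/c) \<le> 1" by linarith+
      then show ?thesis using p by (simp add: field_simps)
    qed (use c0 in auto)
    then show "2 * cap_area S * s \<le> c" "2 * cap_area S * c' \<le> s'" by auto
  qed
qed

text \<open>The swap of coordinates carries the right cap to the top, so this is the overlap of the
  top cap with the mirrored right cap, next to the corner \<open>(1, 1)\<close>.\<close>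

definition corner_overlap :: "(real \<times> real) set \<Rightarrow> real" where
  "corner_overlap S = measure lborel (S \<inter> {w. 1 < snd w} \<inter> {w. (snd w, fst w) \<in> S})"

lemma real_compact_convex_interval:
  fixes A :: "real set"
  assumes "compact A" "convex A" "A \<noteq> {}"
  obtains l r where "l \<le> r" "A = {l..r}"
proof -
  obtain l r where A: "A = {l..r}"
    using connected_compact_interval_1[of A] assms convex_connected by blast
  moreover have "l \<le> r" using assms(3) A by auto
  ultimately show ?thesis using that by blast
qed

lemma slice_interval:
  fixes y :: real
  assumes "compact S" "convex S" "{x. (x, y) \<in> S} \<noteq> {}"
  obtains l r where "l \<le> r" "{x. (x, y) \<in> S} = {l..r :: real}"
proof (rule real_compact_convex_interval[OF _ _ assms(3)])
  have e: "{x. (x, y) \<in> S} = fst ` (S \<inter> UNIV \<times> {y})" by force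
  show "compact {x. (x, y) \<in> S}"
    unfolding e using assms by (intro compact_continuous_image continuous_intros compact_Int_closed closed_Times) auto
  show "convex {x. (x, y) \<in> S}"
    unfolding e using assms by (intro convex_linear_image linear_fst convex_Int convex_Times) auto
qed

lemma width_nonneg: "0 \<le> width S z"
  by (simp add: width_def)

text \<open>The hull of the top side and the slice at height \<open>w\<close> above it is a
  trapezoid contained in \<open>S\<close>; its width at \<open>z\<close> is the interpolated
  one.\<close>

lemma width_concave:
  assumes S: "squared S" and zw: "0 < z" "z \<le> w" "0 < width S w"
  shows "(1 - z/w) + z/w * width S w \<le> width S z"
proof -
  have SS: "compact S" "convex S" "{0..1} \<times> {0..1} \<subseteq> S" using S unfolding squared_def by auto
  have "{x. (x, 1 + w) \<in> S} \<noteq> {}" using zw(3) unfolding width_def by (metis less_irrefl measure_empty)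
  then obtain l r where lr: "l \<le> r" "{x. (x, 1 + w) \<in> S} = {l..r}"
    using slice_interval[OF SS(1,2)] by blast
  define t where "t = z/w"
  have t: "0 < t" "t \<le> 1" "t * w = z" using zw by (auto simp: t_def)
  have b: "(0, 1) \<in> S" "(1, 1) \<in> S" using SS(3) by auto
  have lr': "(l, 1 + w) \<in> S" "(r, 1 + w) \<in> S" using lr by auto
  have A: "(1 - t) *\<^sub>R (0, 1) + t *\<^sub>R (l, 1 + w) \<in> S"
    by (rule convexD[OF SS(2) b(1) lr'(1)]) (use t in auto)
  have A': "(1 - t) *\<^sub>R (0, 1) + t *\<^sub>R (l, 1 + w) = (t*l, 1 + z)"
    using t(3) by (simp add: algebra_simps)
  have B: "(1 - t) *\<^sub>R (1, 1) + t *\<^sub>R (r, 1 + w) \<in> S"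
    by (rule convexD[OF SS(2) b(2) lr'(2)]) (use t in auto)
  have B': "(1 - t) *\<^sub>R (1, 1) + t *\<^sub>R (r, 1 + w) = (1 - t + t*r, 1 + z)"
    using t(3) by (simp add: algebra_simps)
  have e: "(t*l, 1 + z) \<in> S" "(1 - t + t*r, 1 + z) \<in> S" using A B unfolding A' B' by auto
  have le: "t*l \<le> 1 - t + t*r" using t lr(1) mult_left_mono[OF lr(1), of t] by linarith
  have ne: "{x. (x, 1 + z) \<in> S} \<noteq> {}" using e by auto
  obtain l' r' where lr2: "l' \<le> r'" "{x. (x, 1 + z) \<in> S} = {l'..r'}"
    using slice_interval[OF SS(1,2) ne] by blast
  have "l' \<le> t*l" "1 - t + t*r \<le> r'" using e lr2 by (metis atLeastAtMost_iff mem_Collect_eq)+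
  then show ?thesis
    using lr lr2 unfolding width_def by (simp add: algebra_simps flip: t_def)
qed

lemma width_rot:
  assumes "S \<in> sets borel"
  shows "width (rot S) z = measure lborel {y. (1 + z, y) \<in> S}"
  unfolding width_def using measure_reflect_real[OF borel_slice(2)[OF assms], of 1 "1 + z"] by simp

text \<open>Both slices at distance \<open>z\<close> from their sides lie in an interval of length \<open>1 - m * z\<close>, so they
  meet in length at least the sum of their lengths minus \<open>1 - m * z\<close>.\<close>

lemma corner_overlap_bound:
  assumes S: "squared S" and Z: "0 \<le> Z"
    and m: "m = min (2 * cap_area S) (2 * cap_area (rot S))" "Z * m \<le> 1"
    and zero: "cap_area S = 0 \<or> cap_area (rot S) = 0 \<Longrightarrow> Z = 0"
  shows "Z - Z^2/(4 * cap_area S) - Z^2/(4 * cap_area (rot S)) + m * Z^2/2 \<le> corner_overlap S"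
proof (cases "Z = 0")
  case True
  then show ?thesis by (simp add: corner_overlap_def)
next
  case False
  then have Zp: "0 < Z" using Z by simp
  have G: "0 < cap_area S" "0 < cap_area (rot S)"
    using zero False cap_area_nonneg[of S] cap_area_nonneg[of "rot S"] by fastforce+
  have Sb: "S \<in> sets borel" "bounded S" using S squared_borel by auto
  have rS: "squared (rot S)" using S squared_rot by simp
  have rSb: "rot S \<in> sets borel" "bounded (rot S)" using rS squared_borel by auto
  obtain I where I: "has_bochner_integral lborel (\<lambda>z. indicator {0<..Z} z * width S z) I"
      "Z - Z^2/(4 * cap_area S) \<le> I"
    by (rule concave_initial_area[OF cap_area_integral[OF Sb] G(1) width_nonneg Zp]) (use width_concave[OF S] in auto)
  obtain J where J: "has_bochner_integral lborel (\<lambda>z. indicator {0<..Z} z * width (rot S) z) J"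
      "Z - Z^2/(4 * cap_area (rot S)) \<le> J"
    by (rule concave_initial_area[OF cap_area_integral[OF rSb] G(2) width_nonneg Zp]) (use width_concave[OF rS] in auto)
  let ?T = "S \<inter> {w. 1 < snd w} \<inter> {w. (snd w, fst w) \<in> S}"
  have T: "?T \<in> sets borel" "bounded ?T"
    using Sb measure_swap(1)[OF Sb] by (auto intro: bounded_subset)
  have Th: "has_bochner_integral lborel (\<lambda>z. measure lborel {x. (x, 1 + z) \<in> ?T}) (corner_overlap S)"
    unfolding corner_overlap_def
    using lborel_has_bochner_integral_real_affine_iff[of 1 "\<lambda>y. measure lborel {x. (x, y) \<in> ?T}" _ 1]
      slices_snd[OF T] by simp
  have aff: "has_bochner_integral lborel (\<lambda>z. indicator {0<..Z} z * (1 + (-m) * z)) (1 * (Z - 0) + (-m) * (Z^2 - 0^2)/2)"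
    using Z by (intro has_bochner_integral_affine)
  note lhs = has_bochner_integral_diff[OF has_bochner_integral_add[OF I(1) J(1)] aff]
  obtain c s c' s' where cs: "supports S c s" "supports (rot (rot (rot S))) c' s'"
    using S unfolding squared_def by blast
  obtain c'' s'' where cs2: "supports (rot S) c'' s''"
    using S unfolding squared_def by blast
  have cs3: "supports (rot (rot (rot (rot S)))) c s" using cs by simp
  have c0: "0 < c" "0 < s"
    using cap_area_support(3)[OF S cs G(1)] cap_area_support(3)[OF rS cs2 cs3 G(2)] by auto
  \<comment> \<open>Both caps share the support at \<open>(1, 1)\<close>. A large top cap forces
    this line to be steep, which shortens the slices of the right cap, and conversely.\<close>
  have b1: "2 * cap_area S * s \<le> c" using cap_area_support(1)[OF S cs] .
  have b2: "2 * cap_area (rot S) * c \<le> s" using cap_area_support(2)[OF rS cs2 cs3] .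
  have pt: "indicator {0<..Z} z * width S z + indicator {0<..Z} z * width (rot S) z - indicator {0<..Z} z * (1 + (-m) * z)
      \<le> measure lborel {x. (x, 1 + z) \<in> ?T}" for z
  proof (cases "0 < z \<and> z \<le> Z")
    case True
    let ?A = "{x. (x, 1 + z) \<in> S}" and ?B = "{y. (1 + z, y) \<in> S}"
    have AB: "?A \<in> sets borel" "?B \<in> sets borel" "bounded ?A" "bounded ?B"
      using borel_slice[OF Sb(1)] bounded_slice[OF Sb(2)] by auto
    have "?A \<subseteq> {0..1 - m*z}"
    proof
      fix x assume x: "x \<in> ?A"
      have "z * (2 * cap_area (rot S)) * c \<le> z * s" using b2 True by (simp add: mult_left_mono algebra_simps)
      also have "\<dots> \<le> (1 - x) * c"
      proof -
        have "(x, 1 + z) \<in> S" using x by simp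
        from cap_slopes(1)[OF cs this] show ?thesis by (simp add: algebra_simps)
      qed
      finally have "z * (2 * cap_area (rot S)) \<le> 1 - x" using c0 by simp
      moreover have "m*z \<le> z * (2 * cap_area (rot S))" using True by (simp add: m(1) min_le_iff_disj mult.commute)
      ultimately have "x \<le> 1 - m*z" by linarith
      then show "x \<in> {0..1 - m*z}" using cap_range[OF S] x True by auto
    qed
    moreover have "?B \<subseteq> {0..1 - m*z}"
    proof
      fix y assume y: "y \<in> ?B"
      have "c * (1 + z - 1) + s * (y - 1) \<le> 0" using cs(1) y unfolding supports_def by blast
      then have y1: "c * z \<le> s * (1 - y)" by (simp add: algebra_simps)
      have "z * (2 * cap_area S) * s \<le> z * c" using b1 True by (simp add: mult_left_mono algebra_simps)
      also have "\<dots> \<le> (1 - y) * s" using y1 by (simp add: algebra_simps)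
      finally have "z * (2 * cap_area S) \<le> 1 - y" using c0 by simp
      moreover have "m*z \<le> z * (2 * cap_area S)" using True by (simp add: m(1) min_le_iff_disj mult.commute)
      ultimately have "y \<le> 1 - m*z" by linarith
      moreover have "(1 - y, 1 + z) \<in> rot S" using y by simp
      from cap_range[OF rS this] have "0 \<le> y" using True by simp
      ultimately show "y \<in> {0..1 - m*z}" by auto
    qed
    ultimately have sub: "?A \<union> ?B \<subseteq> {0..1 - m*z}" by blast
    have "m * z \<le> m * Z" using True G by (intro mult_left_mono) (auto simp: m(1))
    then have mz: "m*z \<le> 1" using m(2) by (simp add: mult.commute)
    have "measure lborel (?A \<union> ?B) = measure lborel ?A + measure lborel ?B - measure lborel (?A \<inter> ?B)"
      using AB emeasure_bounded_finite by (intro measure_Un3) (auto simp: fmeasurable_def less_top)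
    moreover have "measure lborel (?A \<union> ?B) \<le> measure lborel {0..1 - m*z}"
      using AB by (intro measure_mono_bounded[OF sub]) auto
    moreover have "{x. (x, 1 + z) \<in> ?T} = ?A \<inter> ?B" using True by auto
    ultimately show ?thesis using True mz
      by (simp add: width_rot[OF Sb(1)] width_def[of S])
  next
    case False
    then show ?thesis by (auto simp: indicator_def)
  qed
  from has_bochner_integral_le[OF lhs Th pt] have "I + J - (Z - m * Z^2/2) \<le> corner_overlap S" by simp
  then show ?thesis using I(2) J(2) by linarith
qed

lemma measure_Un_disjoint_bounded:
  fixes A B :: "'a::euclidean_space set"
  assumes "A \<in> sets borel" "B \<in> sets borel" "bounded A" "bounded B" "A \<inter> B = {}"
  shows "measure lborel (A \<union> B) = measure lborel A + measure lborel B"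
  using assms emeasure_bounded_finite
  by (subst measure_Un3) (auto simp: fmeasurable_def less_top)

lemma caps_disjoint:
  assumes S: "squared S" and "(x, y) \<in> S"
  shows "1 < y \<Longrightarrow> 0 \<le> x \<and> x \<le> 1" "1 < x \<Longrightarrow> 0 \<le> y \<and> y \<le> 1"
    "y < 0 \<Longrightarrow> 0 \<le> x \<and> x \<le> 1" "x < 0 \<Longrightarrow> 0 \<le> y \<and> y \<le> 1"
proof -
  have S1: "squared (rot S)" "squared (rot (rot S))" "squared (rot (rot (rot S)))"
    using S squared_rot by blast+
  show "1 < y \<Longrightarrow> 0 \<le> x \<and> x \<le> 1" using cap_range[OF S, of x "y - 1"] assms by simp
  show "1 < x \<Longrightarrow> 0 \<le> y \<and> y \<le> 1" using cap_range[OF S1(1), of "1 - y" "x - 1"] assms by simp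
  show "y < 0 \<Longrightarrow> 0 \<le> x \<and> x \<le> 1" using cap_range[OF S1(2), of "1 - x" "- y"] assms by simp
  show "x < 0 \<Longrightarrow> 0 \<le> y \<and> y \<le> 1" using cap_range[OF S1(3), of y "- x"] assms by simp
qed

lemma unit_square_measure:
  "measure lborel ({0..1} \<times> {0..1} :: (real \<times> real) set) = 1"
  "{0..1} \<times> {0..1} \<in> sets (borel :: (real \<times> real) measure)"
  "bounded ({0..1} \<times> {0..1} :: (real \<times> real) set)"
proof -
  have e: "{0..1} \<times> {0..1} = cbox (0::real, 0::real) (1, 1)" by (metis cbox_Pair_eq cbox_interval)
  show "measure lborel ({0..1} \<times> {0..1} :: (real \<times> real) set) = 1"
    unfolding e content_Pair by simp
  show "{0..1} \<times> {0..1} \<in> sets (borel :: (real \<times> real) measure)"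
    unfolding e by (rule borel_closed) (rule closed_cbox)
qed (simp add: bounded_Times)

lemma cap_area_rotated:
  assumes S: "S \<in> sets borel" "bounded S"
  shows "cap_area (rot S) = measure lborel (S \<inter> {w. 1 < fst w})"
    "cap_area (rot (rot S)) = measure lborel (S \<inter> {w. snd w < 0})"
    "cap_area (rot (rot (rot S))) = measure lborel (S \<inter> {w. fst w < 0})"
proof -
  have 1: "S \<inter> {w. 1 < fst w} \<in> sets borel" "bounded (S \<inter> {w. 1 < fst w})"
    and 2: "S \<inter> {w. snd w < 0} \<in> sets borel" "bounded (S \<inter> {w. snd w < 0})"
    and 3: "S \<inter> {w. fst w < 0} \<in> sets borel" "bounded (S \<inter> {w. fst w < 0})"
    using S by (auto intro: bounded_subset)
  have "rot (S \<inter> {w. 1 < fst w}) = rot S \<inter> {w. 1 < snd w}" by auto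
  then show "cap_area (rot S) = measure lborel (S \<inter> {w. 1 < fst w})"
    using measure_rot[OF 1] by (simp add: cap_area_def)
  have "rot (rot (S \<inter> {w. snd w < 0})) = rot (rot S) \<inter> {w. 1 < snd w}" by auto
  then show "cap_area (rot (rot S)) = measure lborel (S \<inter> {w. snd w < 0})"
    using measure_rot[OF borel_rot bounded_rot] measure_rot 2 by (metis cap_area_def)
  have "rot (rot (rot (S \<inter> {w. fst w < 0}))) = rot (rot (rot S)) \<inter> {w. 1 < snd w}" by auto
  then show "cap_area (rot (rot (rot S))) = measure lborel (S \<inter> {w. fst w < 0})"
    using measure_rot[OF borel_rot bounded_rot] measure_rot borel_rot bounded_rot 3 by (metis cap_area_def)
qed

lemma squared_measure:
  assumes S: "squared S"
  shows "measure lborel S = 1 + cap_area S + cap_area (rot S) + cap_area (rot (rot S)) + cap_area (rot (rot (rot S)))"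
proof -
  have Sb: "S \<in> sets borel" "bounded S" using S squared_borel by auto
  let ?R = "{0..1} \<times> {0..1} :: (real \<times> real) set"
  let ?T0 = "S \<inter> {w. 1 < snd w}" and ?T1 = "S \<inter> {w. 1 < fst w}"
  let ?T2 = "S \<inter> {w. snd w < 0}" and ?T3 = "S \<inter> {w. fst w < 0}"
  have b: "?T0 \<in> sets borel" "?T1 \<in> sets borel" "?T2 \<in> sets borel" "?T3 \<in> sets borel"
    "bounded ?T0" "bounded ?T1" "bounded ?T2" "bounded ?T3"
    using Sb by (auto intro: bounded_subset)
  note R = unit_square_measure
  have sub: "?R \<subseteq> S" using S unfolding squared_def by blast
  have "S = ?R \<union> ?T0 \<union> ?T1 \<union> ?T2 \<union> ?T3"
  proof
    show "S \<subseteq> ?R \<union> ?T0 \<union> ?T1 \<union> ?T2 \<union> ?T3" by (auto simp: not_less)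
  qed (use sub in auto)
  also have "measure lborel \<dots> = measure lborel (?R \<union> ?T0 \<union> ?T1 \<union> ?T2) + measure lborel ?T3"
    using b R caps_disjoint[OF S] by (intro measure_Un_disjoint_bounded) fastforce+
  also have "measure lborel (?R \<union> ?T0 \<union> ?T1 \<union> ?T2) = measure lborel (?R \<union> ?T0 \<union> ?T1) + measure lborel ?T2"
    using b R caps_disjoint[OF S] by (intro measure_Un_disjoint_bounded) fastforce+
  also have "measure lborel (?R \<union> ?T0 \<union> ?T1) = measure lborel (?R \<union> ?T0) + measure lborel ?T1"
    using b R caps_disjoint[OF S] by (intro measure_Un_disjoint_bounded) fastforce+
  also have "measure lborel (?R \<union> ?T0) = measure lborel ?R + measure lborel ?T0"
    using b R by (intro measure_Un_disjoint_bounded) auto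
  finally show ?thesis
    unfolding cap_area_rotated[OF Sb] by (simp add: cap_area_def R)
qed

text \<open>The overlap contains the square, the corner pieces at \<open>(1, 1)\<close> and at
  \<open>(0, 0)\<close>, and the mirror images of these two pieces; the five sets are
  disjoint.\<close>

lemma diagonal_overlap:
  assumes S: "squared S"
  shows "1 + 2 * corner_overlap S + 2 * corner_overlap (rot (rot S)) \<le> measure lborel (S \<inter> {w. (snd w, fst w) \<in> S})"
proof -
  have Sb: "S \<in> sets borel" "bounded S" using S squared_borel by auto
  have sw: "{w. (snd w, fst w) \<in> S} \<in> sets borel" using measure_swap(1)[OF Sb] .
  let ?R = "{0..1} \<times> {0..1} :: (real \<times> real) set"
  let ?P = "S \<inter> {w. 1 < snd w} \<inter> {w. (snd w, fst w) \<in> S}" and ?Q = "S \<inter> {w. snd w < 0} \<inter> {w. (snd w, fst w) \<in> S}"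
  let ?P' = "{w. (snd w, fst w) \<in> ?P}" and ?Q' = "{w. (snd w, fst w) \<in> ?Q}"
  have P: "?P \<in> sets borel" "bounded ?P" and Q: "?Q \<in> sets borel" "bounded ?Q"
    using Sb sw by (auto intro: bounded_subset)
  note P' = measure_swap[OF P] and Q' = measure_swap[OF Q]
  note R = unit_square_measure
  have sub: "?R \<subseteq> S" using S unfolding squared_def by blast
  note D = caps_disjoint[OF S]
  have p: "w \<in> ?P \<Longrightarrow> 1 < snd w \<and> 0 \<le> fst w \<and> fst w \<le> 1" for w using D[of "fst w" "snd w"] by simp
  have q: "w \<in> ?Q \<Longrightarrow> snd w < 0 \<and> 0 \<le> fst w \<and> fst w \<le> 1" for w using D[of "fst w" "snd w"] by simp
  have p': "w \<in> ?P' \<Longrightarrow> 1 < fst w \<and> 0 \<le> snd w \<and> snd w \<le> 1" for w using p[of "(snd w, fst w)"] by simp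
  have q': "w \<in> ?Q' \<Longrightarrow> fst w < 0 \<and> 0 \<le> snd w \<and> snd w \<le> 1" for w using q[of "(snd w, fst w)"] by simp
  have r: "w \<in> ?R \<Longrightarrow> 0 \<le> fst w \<and> fst w \<le> 1 \<and> 0 \<le> snd w \<and> snd w \<le> 1" for w by auto
  have "measure lborel (?R \<union> ?P \<union> ?P' \<union> ?Q \<union> ?Q') = measure lborel (?R \<union> ?P \<union> ?P' \<union> ?Q) + measure lborel ?Q'"
  proof (rule measure_Un_disjoint_bounded)
    show "(?R \<union> ?P \<union> ?P' \<union> ?Q) \<inter> ?Q' = {}" using p p' q q' r by (smt (verit) IntE UnE equals0I)
  qed (use P Q P' Q' R in auto)
  also have "measure lborel (?R \<union> ?P \<union> ?P' \<union> ?Q) = measure lborel (?R \<union> ?P \<union> ?P') + measure lborel ?Q"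
  proof (rule measure_Un_disjoint_bounded)
    show "(?R \<union> ?P \<union> ?P') \<inter> ?Q = {}" using p p' q r by (smt (verit) IntE UnE equals0I)
  qed (use P Q P' Q' R in auto)
  also have "measure lborel (?R \<union> ?P \<union> ?P') = measure lborel (?R \<union> ?P) + measure lborel ?P'"
  proof (rule measure_Un_disjoint_bounded)
    show "(?R \<union> ?P) \<inter> ?P' = {}" using p p' r by (smt (verit) IntE UnE equals0I)
  qed (use P Q P' Q' R in auto)
  also have "measure lborel (?R \<union> ?P) = measure lborel ?R + measure lborel ?P"
  proof (rule measure_Un_disjoint_bounded)
    show "?R \<inter> ?P = {}" using p r by (smt (verit) IntE UnE equals0I)
  qed (use P Q P' Q' R in auto)
  finally have "measure lborel (?R \<union> ?P \<union> ?P' \<union> ?Q \<union> ?Q') = 1 + 2 * measure lborel ?P + 2 * measure lborel ?Q"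
    using P'(3) Q'(3) R(1) by simp
  moreover have "measure lborel ?P = corner_overlap S" by (simp add: corner_overlap_def)
  moreover have "measure lborel ?Q = corner_overlap (rot (rot S))"
  proof -
    have e: "rot (rot ?Q) = rot (rot S) \<inter> {w. 1 < snd w} \<inter> {w. (snd w, fst w) \<in> rot (rot S)}" by auto
    have "measure lborel (rot (rot ?Q)) = measure lborel ?Q"
      using measure_rot[OF borel_rot[OF Q(1)] bounded_rot[OF Q(2)]] measure_rot[OF Q] by simp
    then show ?thesis unfolding e corner_overlap_def by simp
  qed
  moreover have "measure lborel (?R \<union> ?P \<union> ?P' \<union> ?Q \<union> ?Q') \<le> measure lborel (S \<inter> {w. (snd w, fst w) \<in> S})"
  proof (rule measure_mono_bounded)
    show "?R \<union> ?P \<union> ?P' \<union> ?Q \<union> ?Q' \<subseteq> S \<inter> {w. (snd w, fst w) \<in> S}" using sub by auto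
    show "bounded (S \<inter> {w. (snd w, fst w) \<in> S})" by (rule bounded_subset[OF Sb(2)]) auto
  qed (use P Q P' Q' R Sb sw in auto)
  ultimately show ?thesis by simp
qed

text \<open>With all caps positive, the ratios of the support coefficients are positive and
  \<open>opposite_heights_product_le_1\<close> applies. If one cap vanishes, the supports at the
  ends of the opposite side already bound the two remaining caps.\<close>

lemma opposite_caps_small:
  assumes S: "squared S"
  shows "(2 * cap_area S + 2 * cap_area (rot (rot S))) * (2 * cap_area (rot S) + 2 * cap_area (rot (rot (rot S)))) \<le> 1"
proof -
  let ?x = "\<lambda>S. 2 * cap_area S"
  have degenerate: "(?x S + ?x (rot (rot S))) * (?x (rot S) + ?x (rot (rot (rot S)))) \<le> 1"
    if S: "squared S" and 0: "cap_area (rot S) = 0" for S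
  proof (cases "cap_area (rot (rot (rot S))) = 0")
    case False
    then have p: "0 < cap_area (rot (rot (rot S)))" using cap_area_nonneg[of "rot (rot (rot S))"] by linarith
    obtain c3 s3 c4 s4 c s where cs: "supports (rot (rot S)) c3 s3" "supports (rot (rot (rot S))) c4 s4" "supports S c s"
      using S unfolding squared_def by blast
    obtain c2 s2 where cs2: "supports (rot S) c2 s2" using S unfolding squared_def by blast
    have S': "squared (rot (rot (rot S)))" "squared (rot (rot S))" using S squared_rot by blast+
    have pos: "0 < c4" "0 < s3" and 1: "?x (rot (rot (rot S))) * (c3/s3 + s4/c4) \<le> 1"
      using cap_area_support(3)[OF S'(1) cs(2), of c3 s3] p cs by auto
    have "?x S * c4 \<le> s4" using cap_area_support(2)[OF S cs(3) cs(2)] .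
    then have a: "?x S \<le> s4/c4" using pos by (simp add: field_simps)
    have "?x (rot (rot S)) * s3 \<le> c3" using cap_area_support(1)[OF S'(2) cs(1), of c2 s2] cs2 by simp
    then have b: "?x (rot (rot S)) \<le> c3/s3" using pos by (simp add: field_simps)
    have "0 \<le> s4/c4 + c3/s3" using a b cap_area_nonneg[of S] cap_area_nonneg[of "rot (rot S)"] by linarith
    then have "(?x S + ?x (rot (rot S))) * (?x (rot S) + ?x (rot (rot (rot S)))) \<le> (s4/c4 + c3/s3) * ?x (rot (rot (rot S)))"
      unfolding 0 using a b p by (intro mult_mono) (auto simp: cap_area_nonneg)
    also have "\<dots> \<le> 1" using 1 by (simp add: algebra_simps)
    finally show ?thesis .
  qed (simp add: 0)
  have S': "squared (rot S)" "squared (rot (rot S))" "squared (rot (rot (rot S)))" using S squared_rot by blast+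
  consider "cap_area (rot S) = 0" | "cap_area (rot (rot S)) = 0" | "cap_area (rot (rot (rot S))) = 0" | "cap_area S = 0"
    | "0 < cap_area S" "0 < cap_area (rot S)" "0 < cap_area (rot (rot S))" "0 < cap_area (rot (rot (rot S)))"
    using cap_area_nonneg[of S] cap_area_nonneg[of "rot S"] cap_area_nonneg[of "rot (rot S)"]
      cap_area_nonneg[of "rot (rot (rot S))"] by linarith
  then show ?thesis
  proof cases
    case 1 then show ?thesis using degenerate[OF S] by simp
  next
    case 2 then show ?thesis using degenerate[OF S'(1)] by (simp add: algebra_simps)
  next
    case 3 then show ?thesis using degenerate[OF S'(2)] by (simp add: algebra_simps)
  next
    case 4 then show ?thesis using degenerate[OF S'(3)] by (simp add: algebra_simps)
  next
    case 5
    obtain c1 s1 c2 s2 c3 s3 c4 s4 where cs: "supports S c1 s1" "supports (rot S) c2 s2"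
      "supports (rot (rot S)) c3 s3" "supports (rot (rot (rot S))) c4 s4"
      using S unfolding squared_def by blast
    have 1: "0 < c1 \<and> 0 < s4 \<and> ?x S * (c4/s4 + s1/c1) \<le> 1"
      using cap_area_support(3)[OF S cs(1) cs(4) 5(1)] .
    have 2: "0 < c2 \<and> 0 < s1 \<and> ?x (rot S) * (c1/s1 + s2/c2) \<le> 1"
      using cap_area_support(3)[OF S'(1) cs(2) _ 5(2), of c1 s1] cs by simp
    have 3: "0 < c3 \<and> 0 < s2 \<and> ?x (rot (rot S)) * (c2/s2 + s3/c3) \<le> 1"
      using cap_area_support(3)[OF S'(2) cs(3) _ 5(3), of c2 s2] cs by simp
    have 4: "0 < c4 \<and> 0 < s3 \<and> ?x (rot (rot (rot S))) * (c3/s3 + s4/c4) \<le> 1"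
      using cap_area_support(3)[OF S'(3) cs(4) _ 5(4), of c3 s3] cs by simp
    show ?thesis
      by (rule opposite_heights_product_le_1[of _ _ _ _ "c1/s1" "c2/s2" "c3/s3" "c4/s4"])
        (use 1 2 3 4 5 in auto)
  qed
qed

text \<open>By balance each pair of opposite caps has area \<open>X/2\<close>, so \<open>S\<close>
  has area \<open>1 + X\<close>. The two diagonals together collect the square twice and each corner
  overlap twice.\<close>

theorem squared_overlap:
  assumes S: "squared S"
    and bal: "cap_area S + cap_area (rot (rot S)) = cap_area (rot S) + cap_area (rot (rot (rot S)))"
  shows "2 * 0.6948 * measure lborel S
    \<le> measure lborel (S \<inter> {w. (snd w, fst w) \<in> S}) + measure lborel (S \<inter> {w. (1 - snd w, 1 - fst w) \<in> S})"
proof -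
  let ?S1 = "rot S" and ?S2 = "rot (rot S)" and ?S3 = "rot (rot (rot S))"
  have S': "squared ?S1" "squared ?S2" "squared ?S3" using S squared_rot by blast+
  have Sb: "S \<in> sets borel" "bounded S" using S squared_borel by auto
  define X where "X = 2 * cap_area S + 2 * cap_area ?S2"
  have X: "2 * cap_area ?S1 + 2 * cap_area ?S3 = X" using bal by (simp add: X_def)
  have "X * X \<le> 1" using opposite_caps_small[OF S] X X_def by metis
  then have X1: "X \<le> 1" by (metis abs_le_square_iff abs_one power2_eq_square one_power2 abs_ge_self order_trans)
  have "0.6948 * (1 + X) \<le> 1 + corner_overlap S + corner_overlap ?S1 + corner_overlap ?S2 + corner_overlap ?S3"
  proof (rule corner_sum_bound[of "2 * cap_area S" "2 * cap_area ?S1" "2 * cap_area ?S2" "2 * cap_area ?S3"])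
    show "Z - Z^2/(2*(2 * cap_area S)) - Z^2/(2*(2 * cap_area ?S1)) + min (2 * cap_area S) (2 * cap_area ?S1) * Z^2/2 \<le> corner_overlap S"
      if "0 \<le> Z" "Z * min (2 * cap_area S) (2 * cap_area ?S1) \<le> 1" "2 * cap_area S = 0 \<or> 2 * cap_area ?S1 = 0 \<Longrightarrow> Z = 0" for Z
      using corner_overlap_bound[OF S that(1) refl that(2)] that(3) by simp
    show "Z - Z^2/(2*(2 * cap_area ?S1)) - Z^2/(2*(2 * cap_area ?S2)) + min (2 * cap_area ?S1) (2 * cap_area ?S2) * Z^2/2 \<le> corner_overlap ?S1"
      if "0 \<le> Z" "Z * min (2 * cap_area ?S1) (2 * cap_area ?S2) \<le> 1" "2 * cap_area ?S1 = 0 \<or> 2 * cap_area ?S2 = 0 \<Longrightarrow> Z = 0" for Z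
      using corner_overlap_bound[OF S'(1) that(1) refl that(2)] that(3) by simp
    show "Z - Z^2/(2*(2 * cap_area ?S2)) - Z^2/(2*(2 * cap_area ?S3)) + min (2 * cap_area ?S2) (2 * cap_area ?S3) * Z^2/2 \<le> corner_overlap ?S2"
      if "0 \<le> Z" "Z * min (2 * cap_area ?S2) (2 * cap_area ?S3) \<le> 1" "2 * cap_area ?S2 = 0 \<or> 2 * cap_area ?S3 = 0 \<Longrightarrow> Z = 0" for Z
      using corner_overlap_bound[OF S'(2) that(1) refl that(2)] that(3) by simp
    show "Z - Z^2/(2*(2 * cap_area ?S3)) - Z^2/(2*(2 * cap_area S)) + min (2 * cap_area ?S3) (2 * cap_area S) * Z^2/2 \<le> corner_overlap ?S3"
      if "0 \<le> Z" "Z * min (2 * cap_area ?S3) (2 * cap_area S) \<le> 1" "2 * cap_area ?S3 = 0 \<or> 2 * cap_area S = 0 \<Longrightarrow> Z = 0" for Z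
      using corner_overlap_bound[OF S'(3) that(1), of "min (2 * cap_area ?S3) (2 * cap_area S)"] that(2,3) by simp
  qed (use X X_def X1 in \<open>auto simp: cap_area_nonneg\<close>)
  moreover have "measure lborel S = 1 + X"
    using squared_measure[OF S] X X_def by simp
  \<comment> \<open>A quarter turn conjugates the reflection in the other diagonal into the
    coordinate swap.\<close>
  moreover have "measure lborel (S \<inter> {w. (1 - snd w, 1 - fst w) \<in> S}) = measure lborel (rot S \<inter> {w. (snd w, fst w) \<in> rot S})"
  proof -
    have "(\<lambda>z::real\<times>real. (1 - snd z, 1 - fst z)) \<in> measurable borel borel"
      by (intro borel_measurable_continuous_onI continuous_intros)
    from measurable_sets[OF this Sb(1)] have "S \<inter> {w. (1 - snd w, 1 - fst w) \<in> S} \<in> sets borel"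
      using Sb by (simp add: vimage_def)
    moreover have "bounded (S \<inter> {w. (1 - snd w, 1 - fst w) \<in> S})" using Sb by (auto intro: bounded_subset)
    moreover have "rot (S \<inter> {w. (1 - snd w, 1 - fst w) \<in> S}) = rot S \<inter> {w. (snd w, fst w) \<in> rot S}" by auto
    ultimately show ?thesis using measure_rot by metis
  qed
  ultimately show ?thesis using diagonal_overlap[OF S] diagonal_overlap[OF S'(1)] by simp
qed

section \<open>Inscribed rhombi of strictly convex bodies\<close>

lemma cross2_simps [simp]:
  "cross2 u (x + y) = cross2 u x + cross2 u y" "cross2 u (x - y) = cross2 u x - cross2 u y"
  "cross2 u (c *\<^sub>R x) = c * cross2 u x" "cross2 u (- x) = - cross2 u x"
  "cross2 (u + v) x = cross2 u x + cross2 v x" "cross2 (c *\<^sub>R u) x = c * cross2 u x" "cross2 (- u) x = - cross2 u x"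
  "cross2 u u = 0"
  by (simp_all add: cross2_def algebra_simps)

lemma cross2_commute: "cross2 v u = - cross2 u v"
  by (simp add: cross2_def)

lemma inner_2: "(u::real^2) \<bullet> v = u$1 * v$1 + u$2 * v$2"
  by (simp add: inner_vec_def sum_2)

lemma norm1_2: "norm (u::real^2) = 1 \<Longrightarrow> u$1 * u$1 + u$2 * u$2 = 1"
  by (metis inner_2 norm_eq_1)

lemma inner_cross_square: "norm u = 1 \<Longrightarrow> norm v = 1 \<Longrightarrow> (u \<bullet> v)^2 + (cross2 u v)^2 = 1"
  using norm1_2[of u] norm1_2[of v] unfolding inner_2 cross2_def power2_eq_square by algebra

text \<open>For a unit vector \<open>u\<close>, the numbers \<open>u \<bullet> x\<close> and
  \<open>cross2 u x\<close> serve as position along \<open>u\<close> and height across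
  \<open>u\<close>.\<close>

lemma planar_eqI:
  assumes "norm u = 1" "u \<bullet> x = u \<bullet> y" "cross2 u x = cross2 u y"
  shows "x = y"
proof -
  have "x$1 = y$1" "x$2 = y$2"
    using norm1_2[OF assms(1)] assms(2,3) unfolding inner_2 cross2_def by algebra+
  then show ?thesis by (simp add: vec_eq_iff forall_2)
qed

lemma same_height_eq:
  assumes "norm u = 1" "cross2 u x = cross2 u y"
  shows "y = x + (u \<bullet> y - u \<bullet> x) *\<^sub>R u"
  by (rule planar_eqI[OF assms(1)]) (use assms in \<open>simp_all add: inner_add_right norm_eq_1\<close>)

section \<open>Parallel chords of a strictly convex body\<close>

definition strictly_convex :: "'a::euclidean_space set \<Rightarrow> bool" where
  "strictly_convex K \<longleftrightarrow>
    (\<forall>x\<in>K. \<forall>y\<in>K. x \<noteq> y \<longrightarrow> (\<forall>t. 0 < t \<and> t < 1 \<longrightarrow> (1 - t) *\<^sub>R x + t *\<^sub>R y \<in> interior K))"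

lemma strictly_convexD:
  assumes "strictly_convex K" "x \<in> K" "y \<in> K" "x \<noteq> y" "0 < t" "t < 1"
  shows "(1 - t) *\<^sub>R x + t *\<^sub>R y \<in> interior K"
  using assms unfolding strictly_convex_def by blast

lemma strictly_convex_imp_convex: "strictly_convex K \<Longrightarrow> convex K"
proof (rule convexI)
  fix x y :: 'a and a b :: real
  assume K: "strictly_convex K" and xy: "x \<in> K" "y \<in> K" and ab: "0 \<le> a" "0 \<le> b" "a + b = 1"
  then have a: "a = 1 - b" by simp
  consider "x = y" | "b = 0" | "b = 1" | "x \<noteq> y" "0 < b" "b < 1" using ab by fastforce
  then show "a *\<^sub>R x + b *\<^sub>R y \<in> K"
  proof cases
    case 4
    then show ?thesis using strictly_convexD[OF K xy 4] interior_subset unfolding a by blast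
  qed (use xy in \<open>auto simp: a algebra_simps\<close>)
qed

lemma line_point_interior:
  assumes K: "strictly_convex K" and x: "x \<in> K" "x + b *\<^sub>R u \<in> K" and u: "norm u = 1" and ab: "0 < a" "a < b"
  shows "x + a *\<^sub>R u \<in> interior K"
proof -
  have "(1 - a/b) *\<^sub>R x + (a/b) *\<^sub>R (x + b *\<^sub>R u) \<in> interior K"
    using ab u x by (intro strictly_convexD[OF K]) auto
  moreover have "(1 - a/b) *\<^sub>R x + (a/b) *\<^sub>R (x + b *\<^sub>R u) = x + a *\<^sub>R u"
    using ab by (simp add: algebra_simps)
  ultimately show ?thesis by simp
qed

lemma frontier_closed_iff: "closed K \<Longrightarrow> x \<in> frontier K \<longleftrightarrow> x \<in> K \<and> x \<notin> interior K"
  by (simp add: frontier_def)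

locale strict_body =
  fixes K :: "(real^2) set"
  assumes compact_K: "compact K" and strict_K: "strictly_convex K" and interior_K: "interior K \<noteq> {}"
begin

lemma frontier_iff: "x \<in> frontier K \<longleftrightarrow> x \<in> K \<and> x \<notin> interior K"
  by (simp add: frontier_closed_iff compact_K compact_imp_closed)

lemma convex_K: "convex K"
  by (rule strictly_convex_imp_convex[OF strict_K])

text \<open>If the interior point lay at or beyond an end of the chord, that end would itself be
  interior.\<close>

lemma point_outside_chord:
  assumes u: "norm u = 1" and x: "x \<in> frontier K" "x + l *\<^sub>R u \<in> frontier K" "0 < l"
    and z: "x + \<zeta> *\<^sub>R u \<in> interior K"
  shows "0 < \<zeta>" "\<zeta> < l"
proof -
  have zK: "x + \<zeta> *\<^sub>R u \<in> K" using z interior_subset by blast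
  show "0 < \<zeta>"
  proof (rule ccontr)
    assume "\<not> 0 < \<zeta>"
    then consider "\<zeta> = 0" | "\<zeta> < 0" by linarith
    then show False
    proof cases
      case 1 then show ?thesis using x z frontier_iff by simp
    next
      case 2
      have "(x + \<zeta> *\<^sub>R u) + (- \<zeta>) *\<^sub>R u \<in> interior K"
        using 2 x zK frontier_iff
        by (intro line_point_interior[OF strict_K _ _ u, of _ "l - \<zeta>"]) (auto simp: algebra_simps)
      then show ?thesis using x frontier_iff by simp
    qed
  qed
  show "\<zeta> < l"
  proof (rule ccontr)
    assume "\<not> \<zeta> < l"
    then consider "\<zeta> = l" | "l < \<zeta>" by linarith
    then show False
    proof cases
      case 1 then show ?thesis using x z frontier_iff by simp
    next
      case 2
      have "x + l *\<^sub>R u \<in> interior K"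
        using 2 x zK frontier_iff by (intro line_point_interior[OF strict_K _ _ u, of _ \<zeta>]) auto
      then show ?thesis using x frontier_iff by simp
    qed
  qed
qed

text \<open>Interpolating the outer chords at the height of the middle one produces interior points,
  which fall strictly inside the middle chord. Everything is multiplied by \<open>p + q\<close> to
  avoid fractions.\<close>

lemma chord_between:
  assumes u: "norm u = 1"
    and x2: "x2 \<in> frontier K" "x2 + l2 *\<^sub>R u \<in> frontier K" "0 < l2"
    and x1: "x1 \<in> K" "x1 + l1 *\<^sub>R u \<in> K" and x3: "x3 \<in> K" "x3 + l3 *\<^sub>R u \<in> K"
    and h: "cross2 u x1 < cross2 u x2" "cross2 u x2 < cross2 u x3"
  defines "p \<equiv> cross2 u x2 - cross2 u x1" and "q \<equiv> cross2 u x3 - cross2 u x2"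
  shows "(p + q) * (u \<bullet> x2) < q * (u \<bullet> x1) + p * (u \<bullet> x3)"
    "q * (u \<bullet> x1 + l1) + p * (u \<bullet> x3 + l3) < (p + q) * (u \<bullet> x2 + l2)"
proof -
  have pq: "0 < p" "0 < q" using h by (auto simp: p_def q_def)
  define t where "t = p/(p+q)"
  have t: "0 < t" "t < 1" "1 - t = q/(p+q)" using pq by (auto simp: t_def field_simps)
  have uu: "u \<bullet> u = 1" using u norm_eq_1 by blast
  have ne: "x1 \<noteq> x3" "x1 + l1 *\<^sub>R u \<noteq> x3 + l3 *\<^sub>R u"
    using h by (auto dest!: arg_cong[of _ _ "cross2 u"])
  define z where "z = (1 - t) *\<^sub>R x1 + t *\<^sub>R x3"
  define z' where "z' = (1 - t) *\<^sub>R (x1 + l1 *\<^sub>R u) + t *\<^sub>R (x3 + l3 *\<^sub>R u)"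
  have zi: "z \<in> interior K" "z' \<in> interior K"
    unfolding z_def z'_def using strictly_convexD[OF strict_K _ _ _ t(1,2)] x1 x3 ne by blast+
  have "(p + q) * t = p" "(p + q) * (1 - t) = q" using pq unfolding t(3) by (simp_all add: t_def)
  then have T: "(p + q) * ((1 - t) * a + t * b) = q * a + p * b" for a b
    by (simp only: distrib_left mult.assoc[symmetric])
  have "(p + q) * cross2 u x2 = (p + q) * ((1 - t) * cross2 u x1 + t * cross2 u x3)"
    unfolding T by (simp add: p_def q_def algebra_simps)
  then have "cross2 u x2 = (1 - t) * cross2 u x1 + t * cross2 u x3" using pq by simp
  then have hz: "cross2 u x2 = cross2 u z" "cross2 u x2 = cross2 u z'"
    by (simp_all add: z_def z'_def)
  note z = same_height_eq[OF u hz(1)] and z' = same_height_eq[OF u hz(2)]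
  have "0 < u \<bullet> z - u \<bullet> x2" "u \<bullet> z' - u \<bullet> x2 < l2"
    using point_outside_chord[OF u x2] zi z z' by metis+
  moreover have "(p + q) * (u \<bullet> z) = q * (u \<bullet> x1) + p * (u \<bullet> x3)"
    unfolding T[symmetric] z_def by (simp add: inner_add_right)
  moreover have "(p + q) * (u \<bullet> z') = q * (u \<bullet> x1 + l1) + p * (u \<bullet> x3 + l3)"
    unfolding T[symmetric] z'_def using uu by (simp add: inner_add_right)
  ultimately show "(p + q) * (u \<bullet> x2) < q * (u \<bullet> x1) + p * (u \<bullet> x3)"
    "q * (u \<bullet> x1 + l1) + p * (u \<bullet> x3 + l3) < (p + q) * (u \<bullet> x2 + l2)"
    using pq mult_strict_left_mono[of "u \<bullet> x2" "u \<bullet> z" "p + q"]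
      mult_strict_left_mono[of "u \<bullet> z'" "u \<bullet> x2 + l2" "p + q"] by auto
qed

text \<open>Excludes three parallel frontier chords of equal length at different heights.\<close>

lemma chord_between_length:
  assumes "norm u = 1"
    and "x2 \<in> frontier K" "x2 + l2 *\<^sub>R u \<in> frontier K" "0 < l2"
    and "x1 \<in> K" "x1 + l1 *\<^sub>R u \<in> K" and "x3 \<in> K" "x3 + l3 *\<^sub>R u \<in> K"
    and h: "cross2 u x1 < cross2 u x2" "cross2 u x2 < cross2 u x3"
  shows "min l1 l3 < l2"
proof -
  define p q where "p = cross2 u x2 - cross2 u x1" and "q = cross2 u x3 - cross2 u x2"
  have pq: "0 < p" "0 < q" using h by (auto simp: p_def q_def)
  have "q * l1 + p * l3 < (p + q) * l2"
    using chord_between[OF assms] unfolding p_def[symmetric] q_def[symmetric] by (simp add: algebra_simps)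
  moreover have "q * min l1 l3 + p * min l1 l3 \<le> q * l1 + p * l3"
    using pq by (intro add_mono mult_left_mono) auto
  ultimately have "(p + q) * min l1 l3 < (p + q) * l2" by (simp add: algebra_simps)
  then show ?thesis using pq by simp
qed

lemma chord_unique_on_line:
  assumes u: "norm u = 1" and h: "cross2 u x = cross2 u y"
    and x: "x \<in> frontier K" "x + l *\<^sub>R u \<in> frontier K" "0 < l"
    and y: "y \<in> frontier K" "y + m *\<^sub>R u \<in> frontier K" "0 < m"
  shows "x = y" "l = m"
proof -
  define d where "d = u \<bullet> y - u \<bullet> x"
  have yx: "y = x + d *\<^sub>R u" using same_height_eq[OF u h] by (simp add: d_def)
  have in_K: "x \<in> K" "x + l *\<^sub>R u \<in> K" "y \<in> K" "y + m *\<^sub>R u \<in> K" using x y frontier_iff by auto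
  have "d = 0"
  proof (rule ccontr)
    assume "d \<noteq> 0"
    then consider "0 < d" | "d < 0" by linarith
    then show False
    proof cases
      case 1
      have "x + d *\<^sub>R u \<in> interior K"
        using in_K 1 y(3) by (intro line_point_interior[OF strict_K _ _ u, of _ "d + m"]) (auto simp: yx algebra_simps)
      then show ?thesis using y yx frontier_iff by simp
    next
      case 2
      have "y + (- d) *\<^sub>R u \<in> interior K"
        using in_K 2 x(3) by (intro line_point_interior[OF strict_K _ _ u, of _ "l - d"]) (auto simp: yx algebra_simps)
      then show ?thesis using x yx frontier_iff by simp
    qed
  qed
  then show xy: "x = y" using yx by simp
  show "l = m"
  proof (rule ccontr)
    assume "l \<noteq> m"
    then consider "l < m" | "m < l" by linarith
    then show False
    proof cases
      case 1
      have "x + l *\<^sub>R u \<in> interior K"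
        using in_K 1 x(3) xy by (intro line_point_interior[OF strict_K _ _ u, of _ m]) auto
      then show ?thesis using x frontier_iff by simp
    next
      case 2
      have "y + m *\<^sub>R u \<in> interior K"
        using in_K 2 y(3) xy by (intro line_point_interior[OF strict_K _ _ u, of _ l]) auto
      then show ?thesis using y frontier_iff by simp
    qed
  qed
qed

text \<open>A rhombus with unit side directions \<open>u\<close>, \<open>v\<close>, corner
  \<open>x\<close> and side \<open>s\<close>. Its orientation is only weakly positive, which keeps
  the set of rhombi closed; \<open>inscribed_cross_pos\<close> recovers strictness for
  \<open>0 < s\<close>.\<close>

definition inscribed :: "real^2 \<Rightarrow> real^2 \<Rightarrow> real^2 \<Rightarrow> real \<Rightarrow> bool" where
  "inscribed u v x s \<longleftrightarrow> norm u = 1 \<and> norm v = 1 \<and> 0 \<le> cross2 u v \<and>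
    x \<in> frontier K \<and> x + s *\<^sub>R u \<in> frontier K \<and> x + s *\<^sub>R v \<in> frontier K \<and> x + s *\<^sub>R u + s *\<^sub>R v \<in> frontier K"

text \<open>The same rhombus read from a neighbouring corner.\<close>

lemma inscribed_turn:
  assumes "inscribed u v x s"
  shows "inscribed v (- u) (x + s *\<^sub>R u) s" "inscribed (- v) u (x + s *\<^sub>R v) s"
  using assms unfolding inscribed_def by (auto simp: algebra_simps cross2_commute[of u v])

text \<open>For \<open>v = u\<close> or \<open>v = - u\<close> three corners would be equally spaced
  on a line, and the middle one would be interior.\<close>

lemma inscribed_cross_pos:
  assumes I: "inscribed u v x s" and s: "0 < s"
  shows "0 < cross2 u v"
proof (rule ccontr)
  assume "\<not> 0 < cross2 u v"
  then have c0: "cross2 u v = 0" using I unfolding inscribed_def by simp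
  have n: "norm u = 1" "norm v = 1" using I unfolding inscribed_def by auto
  have "(u \<bullet> v)^2 = 1" using inner_cross_square[OF n] c0 by simp
  then have uv: "u \<bullet> v = 1 \<or> u \<bullet> v = -1" by (simp add: power2_eq_1_iff)
  have "cross2 u (0::real^2) = cross2 u v" using c0 by (simp add: cross2_def)
  from same_height_eq[OF n(1) this] have v: "v = (u \<bullet> v) *\<^sub>R u" by simp
  have F: "x \<in> frontier K" "x + s *\<^sub>R u \<in> frontier K" "x + s *\<^sub>R v \<in> frontier K" "x + s *\<^sub>R u + s *\<^sub>R v \<in> frontier K"
    using I unfolding inscribed_def by auto
  then have inK: "x \<in> K" "x + s *\<^sub>R u \<in> K" "x + s *\<^sub>R v \<in> K" "x + s *\<^sub>R u + s *\<^sub>R v \<in> K"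
    using frontier_iff by auto
  have e: "(2 * s) *\<^sub>R u = s *\<^sub>R u + s *\<^sub>R u" by (simp flip: scaleR_left_distrib)
  from uv show False
  proof
    assume "u \<bullet> v = 1"
    with v have v: "v = u" by simp
    have "x + s *\<^sub>R u \<in> interior K"
      by (rule line_point_interior[OF strict_K _ _ n(1), of _ "2 * s"]) (use inK s v e in \<open>auto simp: algebra_simps\<close>)
    then show False using F frontier_iff by simp
  next
    assume "u \<bullet> v = -1"
    with v have v: "v = - u" by simp
    have eq: "(x + s *\<^sub>R v) + (2 * s) *\<^sub>R u = x + s *\<^sub>R u" unfolding v e by simp
    have "(x + s *\<^sub>R v) + (2 * s) *\<^sub>R u \<in> K" unfolding eq by (rule inK(2))
    from line_point_interior[OF strict_K inK(3) this n(1) s] have "(x + s *\<^sub>R v) + s *\<^sub>R u \<in> interior K"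
      using s by simp
    then show False using F frontier_iff v by simp
  qed
qed

text \<open>A longer rhombus would have its two chords strictly between those of the shorter one.  Convexity of the
  left and concavity of the right boundary then force its sides to be too steep for its height.\<close>

lemma inscribed_unique_aux:
  assumes I: "inscribed u v x s" and I': "inscribed u v' x' s'" and s: "0 < s" "s < s'"
  shows False
proof -
  have n: "norm u = 1" "norm v = 1" "norm v' = 1" using I I' unfolding inscribed_def by auto
  have uu: "u \<bullet> u = 1" using n(1) norm_eq_1 by blast
  have F: "x \<in> frontier K" "x + s *\<^sub>R u \<in> frontier K" "x + s *\<^sub>R v \<in> frontier K" "x + s *\<^sub>R v + s *\<^sub>R u \<in> frontier K"
    "x' \<in> frontier K" "x' + s' *\<^sub>R u \<in> frontier K" "x' + s' *\<^sub>R v' \<in> frontier K" "x' + s' *\<^sub>R v' + s' *\<^sub>R u \<in> frontier K"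
    using I I' unfolding inscribed_def by (auto simp: algebra_simps)
  then have inK: "x \<in> K" "x + s *\<^sub>R u \<in> K" "x + s *\<^sub>R v \<in> K" "x + s *\<^sub>R v + s *\<^sub>R u \<in> K"
    "x' \<in> K" "x' + s' *\<^sub>R u \<in> K" "x' + s' *\<^sub>R v' \<in> K" "x' + s' *\<^sub>R v' + s' *\<^sub>R u \<in> K"
    using frontier_iff by auto
  have s': "0 < s'" using s by simp
  \<comment> \<open>\<open>D\<close>, \<open>H\<close> and \<open>D'\<close>, \<open>H'\<close> are
    the components along and across \<open>u\<close> of the second sides of the two rhombi;
    \<open>l\<close>, \<open>k\<close> are those of \<open>x' - x\<close>.\<close>
  define H H' D D' k l where "H = s * cross2 u v" "H' = s' * cross2 u v'" "D = s * (u \<bullet> v)" "D' = s' * (u \<bullet> v')"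
    "k = cross2 u x' - cross2 u x" "l = u \<bullet> x' - u \<bullet> x"
  note defs = this
  have H: "0 < H" "0 < H'" using inscribed_cross_pos[OF I s(1)] inscribed_cross_pos[OF I' s'] s s' by (auto simp: defs)
  have k: "0 < k"
  proof (rule ccontr)
    assume "\<not> 0 < k"
    then consider "cross2 u x = cross2 u x'" | "cross2 u x' < cross2 u x" by (fastforce simp: defs)
    then show False
    proof cases
      case 1 then show ?thesis using chord_unique_on_line(2)[OF n(1) 1 F(1,2) s(1) F(5,6) s'] s by simp
    next
      case 2
      have "min s' s < s"
        by (rule chord_between_length[OF n(1) F(1,2) s(1) inK(5,6) inK(3,4) 2]) (use H in \<open>simp add: defs\<close>)
      then show ?thesis using s by simp
    qed
  qed
  have kH: "k + H' < H"
  proof (rule ccontr)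
    assume "\<not> k + H' < H"
    then consider "cross2 u (x + s *\<^sub>R v) = cross2 u (x' + s' *\<^sub>R v')" | "cross2 u (x + s *\<^sub>R v) < cross2 u (x' + s' *\<^sub>R v')"
      by (fastforce simp: defs)
    then show False
    proof cases
      case 1 then show ?thesis using chord_unique_on_line(2)[OF n(1) 1 F(3,4) s(1) F(7,8) s'] s by simp
    next
      case 2
      have "min s s' < s"
        by (rule chord_between_length[OF n(1) F(3,4) s(1) inK(1,2) inK(7,8) _ 2]) (use H in \<open>simp add: defs\<close>)
      then show ?thesis using s by simp
    qed
  qed
  have P: "cross2 u x < cross2 u x'" "cross2 u x' < cross2 u (x' + s' *\<^sub>R v')"
    and Q: "cross2 u (x' + s' *\<^sub>R v') < cross2 u (x + s *\<^sub>R v)"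
    using k kH H by (auto simp: defs)
  \<comment> \<open>\<open>chord_between\<close> is applied to the lower and to the upper chord of
    the longer rhombus; adding the inequalities eliminates \<open>k\<close> and
    \<open>l\<close>.\<close>
  have "H' * l < k * D'" "k * D' < H' * (l + s' - s)"
    using chord_between[OF n(1) F(5,6) s' inK(1,2) inK(7,8) P]
    by (auto simp: defs inner_add_right algebra_simps)
  moreover have "(H - k) * D' < H' * (D - l)" "H' * (D + s - l - s') < (H - k) * D'"
    using chord_between[OF n(1) F(7,8) s' inK(5,6) inK(3,4) P(2) Q]
    by (auto simp: defs inner_add_right algebra_simps)
  ultimately have w: "H * D' - H' * D < H' * (s' - s)" "- (H * D' - H' * D) < H' * (s' - s)"
    by (simp_all add: algebra_simps)
  define w where "w = H * D' - H' * D"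
  have abs: "\<bar>w\<bar> < H' * (s' - s)" using w unfolding w_def by linarith
  have sq: "D^2 + H^2 = s^2" "D'^2 + H'^2 = s'^2"
    using inner_cross_square[OF n(1,2)] inner_cross_square[OF n(1,3)]
    by (simp_all add: defs power_mult_distrib flip: distrib_left)
  \<comment> \<open>Lagrange's identity, which yields the Cauchy-Schwarz bound for the two side
    vectors.\<close>
  have "(D*D' + H*H')^2 + w^2 = (D^2 + H^2) * (D'^2 + H'^2)"
    unfolding w_def by (simp add: power2_eq_square algebra_simps)
  then have "(D*D' + H*H')^2 + w^2 = (s * s')^2" unfolding sq by (simp add: power_mult_distrib)
  then have "(D*D' + H*H')^2 \<le> (s * s')^2" using zero_le_power2[of w] by linarith
  then have e1: "D*D' + H*H' \<le> s * s'" by (rule power2_le_imp_le) (use s s' in simp)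
  have "D'^2 \<le> s'^2" using sq(2) zero_le_power2[of H'] by linarith
  then have "\<bar>D'\<bar> \<le> s'" using s' abs_le_square_iff[of D' s'] by simp
  then have "\<bar>w\<bar> * \<bar>D'\<bar> \<le> \<bar>w\<bar> * s'" by (intro mult_left_mono) auto
  then have e2: "w * D' \<le> \<bar>w\<bar> * s'" using abs_ge_self[of "w * D'"] by (simp add: abs_mult)
  \<comment> \<open>Replacing \<open>s'^2\<close> by \<open>D'^2 + H'^2\<close> splits the product
    into an inner product and a multiple of \<open>w\<close>; the bounds on both force
    \<open>H < H'\<close>, against \<open>k + H' < H\<close>.\<close>
  have "H * s'^2 = (D*D' + H*H') * H' + w * D'"
    unfolding sq(2)[symmetric] w_def by (simp add: power2_eq_square algebra_simps)
  also have "\<dots> \<le> (s * s') * H' + \<bar>w\<bar> * s'"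
    using e1 e2 H by (intro add_mono mult_right_mono) auto
  also have "\<dots> < (s * s') * H' + (H' * (s' - s)) * s'" using abs s' by simp
  also have "\<dots> = H' * s'^2" by (simp add: power2_eq_square algebra_simps)
  finally have "H < H'" using s' by simp
  then show False using kH k by simp
qed

text \<open>The sides agree by the previous lemma. If the chords then lay at different heights,
  there would be three parallel chords of the same length.\<close>

lemma inscribed_unique:
  assumes I: "inscribed u v x s" and I': "inscribed u v' x' s'" and s: "0 < s" "0 < s'"
  shows "v = v' \<and> x = x' \<and> s = s'"
proof -
  have ss: "s = s'" using inscribed_unique_aux[OF I I'] inscribed_unique_aux[OF I' I] s by (meson linorder_cases)
  have n: "norm u = 1" using I unfolding inscribed_def by auto
  have *: "cross2 u x = cross2 u x' \<and> cross2 u (x + s *\<^sub>R v) = cross2 u (x' + s *\<^sub>R v')"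
  proof -
    have no3: False if "cross2 u a < cross2 u b" "cross2 u b < cross2 u c"
      "a \<in> frontier K" "a + s *\<^sub>R u \<in> frontier K" "b \<in> frontier K" "b + s *\<^sub>R u \<in> frontier K"
      "c \<in> frontier K" "c + s *\<^sub>R u \<in> frontier K" for a b c
    proof -
      have "min s s < s"
        by (rule chord_between_length[OF n that(5,6) s(1) _ _ _ _ that(1,2)]) (use that frontier_iff in auto)
      then show False by simp
    qed
    have F: "x \<in> frontier K" "x + s *\<^sub>R u \<in> frontier K" "x + s *\<^sub>R v \<in> frontier K" "x + s *\<^sub>R v + s *\<^sub>R u \<in> frontier K"
      "x' \<in> frontier K" "x' + s *\<^sub>R u \<in> frontier K" "x' + s *\<^sub>R v' \<in> frontier K" "x' + s *\<^sub>R v' + s *\<^sub>R u \<in> frontier K"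
      using I I' ss unfolding inscribed_def by (auto simp: algebra_simps)
    have lt: "cross2 u x < cross2 u (x + s *\<^sub>R v)" "cross2 u x' < cross2 u (x' + s *\<^sub>R v')"
      using inscribed_cross_pos[OF I s(1)] inscribed_cross_pos[OF I' s(2)] s by auto
    have e: "cross2 u x = cross2 u x'"
      using no3[OF _ lt(2) F(1,2) F(5-8)] no3[OF _ lt(1) F(5,6) F(1-4)] by (meson linorder_cases)
    moreover have "cross2 u (x + s *\<^sub>R v) = cross2 u (x' + s *\<^sub>R v')"
      using no3[OF lt(1) _ F(1-4) F(7,8)] no3[OF lt(2) _ F(5-8) F(3,4)] by (meson linorder_cases)
    ultimately show ?thesis by blast
  qed
  have x: "x = x'"
    by (rule chord_unique_on_line(1)[OF n conjunct1[OF *], of s s])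
      (use I I' s ss in \<open>auto simp: inscribed_def\<close>)
  have "x + s *\<^sub>R v = x' + s *\<^sub>R v'"
    by (rule chord_unique_on_line(1)[OF n conjunct2[OF *], of s s])
      (use I I' s ss in \<open>auto simp: inscribed_def algebra_simps\<close>)
  then show ?thesis using x ss s by simp
qed

end

section \<open>Existence of an inscribed rhombus in every direction\<close>

context strict_body
begin

definition longest_chord :: "real^2 \<Rightarrow> real^2 \<Rightarrow> real \<Rightarrow> bool" where
  "longest_chord u x L \<longleftrightarrow> x \<in> K \<and> x + L *\<^sub>R u \<in> K \<and> (\<forall>y l. y \<in> K \<longrightarrow> y + l *\<^sub>R u \<in> K \<longrightarrow> l \<le> L)"

lemma chords_compact:
  assumes "norm u = 1"
  shows "compact {z. fst z \<in> K \<and> fst z + snd z *\<^sub>R u \<in> K}"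
proof (rule compact_eq_bounded_closed[THEN iffD2], intro conjI)
  obtain B where B: "\<And>x. x \<in> K \<Longrightarrow> norm x \<le> B"
    using compact_K compact_imp_bounded bounded_iff by metis
  have "{z. fst z \<in> K \<and> fst z + snd z *\<^sub>R u \<in> K} \<subseteq> K \<times> {-2*B..2*B}"
  proof clarsimp
    fix a b assume ab: "a \<in> K" "a + b *\<^sub>R u \<in> K"
    have "\<bar>b\<bar> = norm ((a + b *\<^sub>R u) - a)" using assms by simp
    also have "\<dots> \<le> norm (a + b *\<^sub>R u) + norm a" by (rule norm_triangle_ineq4)
    also have "\<dots> \<le> 2*B" using B[OF ab(1)] B[OF ab(2)] by simp
    finally show "- (2*B) \<le> b \<and> b \<le> 2*B" by linarith
  qed
  then show "bounded {z. fst z \<in> K \<and> fst z + snd z *\<^sub>R u \<in> K}"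
    by (rule bounded_subset[rotated]) (use compact_K in \<open>auto simp: bounded_Times compact_imp_bounded\<close>)
  have "closed K" using compact_K compact_imp_closed by blast
  then have "closed (fst -` K \<inter> (\<lambda>z. fst z + snd z *\<^sub>R u) -` K)"
    by (intro closed_Int closed_vimage continuous_intros)
  then show "closed {z. fst z \<in> K \<and> fst z + snd z *\<^sub>R u \<in> K}"
    by (simp add: vimage_def Int_def)
qed

lemma longest_chord_exists:
  assumes "norm u = 1"
  obtains x L where "longest_chord u x L"
proof -
  let ?C = "{z. fst z \<in> K \<and> fst z + snd z *\<^sub>R u \<in> K}"
  obtain y where "y \<in> K" using interior_K interior_subset by blast
  then have "(y, 0) \<in> ?C" by simp
  then have "?C \<noteq> {}" by blast
  moreover have "continuous_on ?C snd" by (intro continuous_intros)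
  ultimately obtain z where "z \<in> ?C" "\<forall>w\<in>?C. snd w \<le> snd z"
    using continuous_attains_sup[OF chords_compact[OF assms], of snd] by blast
  then have "longest_chord u (fst z) (snd z)" unfolding longest_chord_def by fastforce
  then show ?thesis using that by blast
qed

lemma longest_chord_flip:
  assumes "longest_chord u x L"
  shows "longest_chord (- u) (x + L *\<^sub>R u) L"
proof -
  have *: "\<And>y l. y \<in> K \<Longrightarrow> y + l *\<^sub>R u \<in> K \<Longrightarrow> l \<le> L"
    using assms unfolding longest_chord_def by blast
  have "l \<le> L" if "y \<in> K" "y + l *\<^sub>R (- u) \<in> K" for y l
    using *[of "y - l *\<^sub>R u" l] that by simp
  then show ?thesis using assms unfolding longest_chord_def by auto
qed

lemma interior_move:
  assumes "x \<in> interior K" and n: "norm d = 1"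
  obtains e where "0 < e" "\<And>t. \<bar>t\<bar> \<le> e \<Longrightarrow> x + t *\<^sub>R d \<in> K"
proof -
  obtain e where e: "0 < e" "cball x e \<subseteq> K" using assms(1) mem_interior_cball by metis
  have "x + t *\<^sub>R d \<in> K" if "\<bar>t\<bar> \<le> e" for t
    using e(2) that n by (auto simp: dist_norm subset_iff)
  then show ?thesis using that e by blast
qed

lemma longest_chord_frontier:
  assumes L: "longest_chord u x L" and u: "norm u = 1"
  shows "x \<in> frontier K" "x + L *\<^sub>R u \<in> frontier K"
proof -
  have *: "x + L *\<^sub>R u \<notin> interior K" if L: "longest_chord u x L" and u: "norm u = 1" for u x
  proof
    assume "x + L *\<^sub>R u \<in> interior K"
    then obtain e where e: "0 < e" "\<And>t. \<bar>t\<bar> \<le> e \<Longrightarrow> (x + L *\<^sub>R u) + t *\<^sub>R u \<in> K"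
      using interior_move[OF _ u] by blast
    have "x + (L + e) *\<^sub>R u \<in> K" using e(2)[of e] e(1) by (simp add: algebra_simps)
    then have "L + e \<le> L" using L unfolding longest_chord_def by blast
    then show False using e by simp
  qed
  have "x \<notin> interior K" using *[OF longest_chord_flip[OF L]] u by simp
  then show "x \<in> frontier K" "x + L *\<^sub>R u \<in> frontier K"
    using *[OF L u] L frontier_iff unfolding longest_chord_def by auto
qed

text \<open>\<open>d\<close> is a small multiple of \<open>P - w\<close> for a point
  \<open>P\<close> of \<open>K\<close> above \<open>x\<close>: \<open>w\<close> then moves along a
  segment inside \<open>K\<close>, and \<open>x\<close> stays within a ball inside
  \<open>K\<close>.\<close>

lemma higher_point:
  assumes u: "norm u = 1" and x: "x \<in> interior K" and w: "w \<in> K" "cross2 u w = cross2 u x"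
  obtains d where "0 < cross2 u d" "x + d \<in> K" "w + d \<in> K"
proof -
  define n :: "real^2" where "n = (\<chi> i. if i = 1 then - u$2 else u$1)"
  have n: "norm n = 1" "cross2 u n = 1"
    using norm1_2[OF u] by (simp_all add: n_def norm_eq_1 inner_2 cross2_def)
  obtain e where e: "0 < e" "\<And>t. \<bar>t\<bar> \<le> e \<Longrightarrow> x + t *\<^sub>R n \<in> K"
    using interior_move[OF x n(1)] by blast
  define P where "P = x + e *\<^sub>R n"
  have P: "P \<in> K" using e by (simp add: P_def)
  have ch: "cross2 u (P - w) = e" using n w by (simp add: P_def)
  have ne: "P - w \<noteq> 0" using ch e by (auto simp: cross2_def)
  obtain e' where e': "0 < e'" "\<And>t. \<bar>t\<bar> \<le> e' \<Longrightarrow> x + t *\<^sub>R (inverse (norm (P - w)) *\<^sub>R (P - w)) \<in> K"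
    using interior_move[OF x, of "inverse (norm (P - w)) *\<^sub>R (P - w)"] ne by auto
  define t where "t = min 1 (e' * inverse (norm (P - w)))"
  have t: "0 < t" "t \<le> 1" using e' ne by (auto simp: t_def)
  have "x + (t * norm (P - w)) *\<^sub>R (inverse (norm (P - w)) *\<^sub>R (P - w)) \<in> K"
  proof (rule e'(2))
    have "t * norm (P - w) \<le> e' * inverse (norm (P - w)) * norm (P - w)"
      unfolding t_def by (intro mult_right_mono) auto
    also have "\<dots> = e'" using ne by simp
    finally show "\<bar>t * norm (P - w)\<bar> \<le> e'" using ne t by simp
  qed
  moreover have "(t * N) *\<^sub>R (inverse N *\<^sub>R d) = t *\<^sub>R d" if "N \<noteq> 0" for N and d :: "real^2"
    using that by (simp add: mult.assoc)
  moreover have "norm (P - w) \<noteq> 0" using ne by simp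
  ultimately have 1: "x + t *\<^sub>R (P - w) \<in> K" by metis
  have "(1 - t) *\<^sub>R w + t *\<^sub>R P \<in> K" using convex_K P w t by (intro convexD) auto
  then have 2: "w + t *\<^sub>R (P - w) \<in> K" by (simp add: algebra_simps)
  have "0 < cross2 u (t *\<^sub>R (P - w))" using ch e t by simp
  then show ?thesis using that[of "t *\<^sub>R (P - w)"] 1 2 by blast
qed

text \<open>The highest chord of length \<open>s\<close> works: if one of its ends were interior,
  \<open>higher_point\<close> would lift it.\<close>

lemma upper_chord:
  assumes u: "norm u = 1" and L: "longest_chord u x0 L" and s: "0 \<le> s" "s \<le> L"
  obtains x where "x \<in> frontier K" "x + s *\<^sub>R u \<in> frontier K" "cross2 u x0 \<le> cross2 u x"
    "\<And>z. z \<in> K \<Longrightarrow> z + s *\<^sub>R u \<in> K \<Longrightarrow> cross2 u z \<le> cross2 u x"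
proof -
  let ?E = "{z \<in> K. z + s *\<^sub>R u \<in> K}"
  have L': "x0 \<in> K" "x0 + L *\<^sub>R u \<in> K" using L unfolding longest_chord_def by auto
  have x0: "x0 + s *\<^sub>R u \<in> K"
  proof (cases "L = 0")
    case False
    have "(1 - s/L) *\<^sub>R x0 + (s/L) *\<^sub>R (x0 + L *\<^sub>R u) \<in> K"
      using s False L' by (intro convexD[OF convex_K]) auto
    then show ?thesis using False by (simp add: algebra_simps)
  qed (use s L' in auto)
  then have "x0 \<in> ?E" using L' by simp
  moreover have "compact ?E"
  proof -
    have "closed ((\<lambda>z. z + s *\<^sub>R u) -` K)"
      using compact_K compact_imp_closed by (intro closed_vimage continuous_intros) auto
    from compact_Int_closed[OF compact_K this] show ?thesis by (simp add: vimage_def Int_def)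
  qed
  moreover have "continuous_on ?E (cross2 u)" unfolding cross2_def by (intro continuous_intros)
  ultimately obtain x where x: "x \<in> ?E" "\<And>z. z \<in> ?E \<Longrightarrow> cross2 u z \<le> cross2 u x"
    using continuous_attains_sup[of ?E "cross2 u"] by blast
  have "x \<notin> interior K"
  proof
    assume "x \<in> interior K"
    then obtain d where d: "0 < cross2 u d" "x + d \<in> K" "(x + s *\<^sub>R u) + d \<in> K"
      using higher_point[OF u, of x "x + s *\<^sub>R u"] x by auto
    then have "x + d \<in> ?E" by (simp add: algebra_simps)
    from x(2)[OF this] show False using d by simp
  qed
  moreover have "x + s *\<^sub>R u \<notin> interior K"
  proof
    assume "x + s *\<^sub>R u \<in> interior K"
    then obtain d where d: "0 < cross2 u d" "(x + s *\<^sub>R u) + d \<in> K" "x + d \<in> K"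
      using higher_point[OF u, of "x + s *\<^sub>R u" x] x by auto
    then have "x + d \<in> ?E" by (simp add: algebra_simps)
    from x(2)[OF this] show False using d by simp
  qed
  ultimately show ?thesis using that[of x] x x(2)[OF \<open>x0 \<in> ?E\<close>] frontier_iff by auto
qed

text \<open>Of two such chords at different heights, the lower one would lie between the upper one
  and a longest chord, hence be longer than \<open>s\<close>.\<close>

lemma upper_chord_unique:
  assumes u: "norm u = 1" and L: "longest_chord u x0 L" and s: "0 < s"
    and x: "x \<in> frontier K" "x + s *\<^sub>R u \<in> frontier K" "cross2 u x0 \<le> cross2 u x"
    and y: "y \<in> frontier K" "y + s *\<^sub>R u \<in> frontier K" "cross2 u x0 \<le> cross2 u y"
  shows "x = y"
proof -
  have *: False if x: "x \<in> frontier K" "x + s *\<^sub>R u \<in> frontier K" "cross2 u x0 \<le> cross2 u x"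
    and y: "y \<in> frontier K" "y + s *\<^sub>R u \<in> frontier K" and h: "cross2 u x < cross2 u y" for x y
  proof -
    have L': "x0 \<in> K" "x0 + L *\<^sub>R u \<in> K" using L unfolding longest_chord_def by auto
    have xy: "x \<in> K" "x + s *\<^sub>R u \<in> K" "y \<in> K" "y + s *\<^sub>R u \<in> K" using x y frontier_iff by auto
    have sL: "s \<le> L" using L xy unfolding longest_chord_def by blast
    consider "cross2 u x0 < cross2 u x" | "cross2 u x0 = cross2 u x" using x(3) by linarith
    then show False
    proof cases
      case 1
      have "min L s < s"
        by (rule chord_between_length[OF u x(1,2) s L' xy(3,4) 1 h])
      then show False using sL by simp
    next
      \<comment> \<open>The lower chord is itself a longest chord. The chord joining the midpoints
        also has length \<open>s = L\<close> but interior ends, so it could be prolonged.\<close>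
      case 2
      have e: "x0 = x" "L = s"
        using chord_unique_on_line[OF u 2 longest_chord_frontier[OF L u] _ x(1,2) s] s sL by auto
      have ne: "x \<noteq> y" "x + s *\<^sub>R u \<noteq> y + s *\<^sub>R u" using h by auto
      define z where "z = (1 - 1/2) *\<^sub>R x + (1/2) *\<^sub>R y"
      define z' where "z' = (1 - 1/2) *\<^sub>R (x + s *\<^sub>R u) + (1/2) *\<^sub>R (y + s *\<^sub>R u)"
      have z: "z \<in> interior K" "z' \<in> interior K"
        unfolding z_def z'_def using strictly_convexD[OF strict_K xy(1,3) ne(1), of "1/2"]
          strictly_convexD[OF strict_K xy(2,4) ne(2), of "1/2"] by simp_all
      have zz: "z' = z + s *\<^sub>R u"
      proof -
        have "(1/2) *\<^sub>R (s *\<^sub>R u) + (1/2) *\<^sub>R (s *\<^sub>R u) = s *\<^sub>R u" by (simp flip: scaleR_left_distrib)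
        then show ?thesis unfolding z_def z'_def by (simp add: scaleR_right_distrib)
      qed
      obtain d where d: "0 < d" "\<And>t. \<bar>t\<bar> \<le> d \<Longrightarrow> z' + t *\<^sub>R u \<in> K" using interior_move[OF z(2) u] by blast
      have "z + (s + d) *\<^sub>R u \<in> K" using d(2)[of d] d(1) unfolding zz by (simp add: algebra_simps)
      moreover have "z \<in> K" using z interior_subset by blast
      ultimately have "s + d \<le> L" using L unfolding longest_chord_def by blast
      then show False using d e by simp
    qed
  qed
  have "cross2 u x = cross2 u y" using *[OF x y(1,2)] *[OF y x(1,2)] by (meson linorder_cases)
  from chord_unique_on_line(1)[OF u this x(1,2) s y(1,2) s] show ?thesis .
qed

lemma frontier_chord_pair_rhombus:
  assumes u: "norm u = 1" and s: "0 < s"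
    and x: "x \<in> frontier K" "x + s *\<^sub>R u \<in> frontier K" and y: "y \<in> frontier K" "y + s *\<^sub>R u \<in> frontier K"
    and h: "cross2 u x \<le> cross2 u y" and len: "norm (y - x) = s"
  shows "inscribed u (inverse s *\<^sub>R (y - x)) x s"
proof -
  have "norm (inverse s *\<^sub>R (y - x)) = 1" "s *\<^sub>R (inverse s *\<^sub>R (y - x)) = y - x"
    using len s by simp_all
  moreover have "0 \<le> cross2 u (inverse s *\<^sub>R (y - x))" using h s by simp
  moreover have "x + s *\<^sub>R u + (y - x) = y + s *\<^sub>R u" by simp
  ultimately show ?thesis using u x y unfolding inscribed_def by (metis add_diff_cancel_left' diff_add_cancel add.commute)
qed

text \<open>For \<open>s\<close> between \<open>r\<close> and the maximum \<open>L\<close> there is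
  one chord of length \<open>s\<close> below the longest chord and one above. The distance of their
  starting points is at least \<open>2 * r\<close> for \<open>s = r\<close> and 0 for
  \<open>s = L\<close>, so it equals \<open>s\<close> somewhere in between.\<close>

lemma inscribed_exists:
  assumes u: "norm u = 1" and ball: "cball q (2 * r) \<subseteq> K" "0 < r"
  obtains v x s where "inscribed u v x s" "r \<le> s"
proof -
  obtain x0 L where L: "longest_chord u x0 L" using longest_chord_exists[OF u] by blast
  note F0 = longest_chord_frontier[OF L u]
  have nu: "norm (- u) = 1" using u by simp
  define n :: "real^2" where "n = (\<chi> i. if i = 1 then - u$2 else u$1)"
  have n: "norm n = 1" "cross2 u n = 1"
    using norm1_2[OF u] by (simp_all add: n_def norm_eq_1 inner_2 cross2_def)
  have bK: "q + a *\<^sub>R n + b *\<^sub>R u \<in> K" if "\<bar>a\<bar> \<le> r" "\<bar>b\<bar> \<le> r" for a b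
  proof -
    have "norm (a *\<^sub>R n + b *\<^sub>R u) \<le> \<bar>a\<bar> + \<bar>b\<bar>" using n u norm_triangle_ineq[of "a *\<^sub>R n" "b *\<^sub>R u"] by simp
    moreover have "dist (q + a *\<^sub>R n + b *\<^sub>R u) q = norm (a *\<^sub>R n + b *\<^sub>R u)"
      by (simp add: dist_norm add.assoc)
    ultimately have "dist q (q + a *\<^sub>R n + b *\<^sub>R u) \<le> 2 * r" using that by (simp add: dist_commute)
    then show ?thesis using ball by auto
  qed
  have "r \<le> L" using L bK[of 0 0] bK[of 0 r] ball(2) unfolding longest_chord_def by simp
  have lowL: "longest_chord (- u) (x0 + L *\<^sub>R u) L" using longest_chord_flip[OF L] .
  \<comment> \<open>\<open>P\<close> is compact and, by \<open>uniq\<close>, projects injectively to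
    the length. The inverse of a continuous injection on a compact set is continuous, so the two
    chords vary continuously with \<open>s\<close>.\<close>
  define P where "P = {z :: real \<times> (real^2) \<times> (real^2). r \<le> fst z \<and> fst z \<le> L
      \<and> fst (snd z) \<in> frontier K \<and> fst (snd z) + fst z *\<^sub>R u \<in> frontier K \<and> cross2 u (fst (snd z)) \<le> cross2 u x0
      \<and> snd (snd z) \<in> frontier K \<and> snd (snd z) + fst z *\<^sub>R u \<in> frontier K \<and> cross2 u x0 \<le> cross2 u (snd (snd z))}"
  have cf: "compact (frontier K)" using compact_K compact_frontier by blast
  have compP: "compact P"
  proof -
    have eq: "P = ({r..L} \<times> frontier K \<times> frontier K) \<inter>
        ((\<lambda>z. fst (snd z) + fst z *\<^sub>R u) -` frontier K \<inter> (\<lambda>z. snd (snd z) + fst z *\<^sub>R u) -` frontier K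
         \<inter> {z. cross2 u (fst (snd z)) \<le> cross2 u x0} \<inter> {z. cross2 u x0 \<le> cross2 u (snd (snd z))})"
      unfolding P_def by auto
    have "compact ({r..L} \<times> frontier K \<times> frontier K)" by (intro compact_Times compact_Icc cf)
    moreover have "closed ((\<lambda>z::real \<times> (real^2) \<times> (real^2). fst (snd z) + fst z *\<^sub>R u) -` frontier K \<inter> (\<lambda>z. snd (snd z) + fst z *\<^sub>R u) -` frontier K
         \<inter> {z. cross2 u (fst (snd z)) \<le> cross2 u x0} \<inter> {z. cross2 u x0 \<le> cross2 u (snd (snd z))})"
      unfolding cross2_def
      by (intro closed_Int closed_vimage closed_Collect_le continuous_intros frontier_closed)
    ultimately show ?thesis unfolding eq by (rule compact_Int_closed)
  qed
  have uniq: "z = w" if "z \<in> P" "w \<in> P" "fst z = fst w" for z w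
  proof -
    obtain s x y x' y' where zw: "z = (s, x, y)" "w = (s, x', y')"
      using \<open>fst z = fst w\<close> by (cases z; cases w) auto
    have s: "0 < s" using that ball zw unfolding P_def by auto
    have "y = y'"
      by (rule upper_chord_unique[OF u L s]) (use that zw in \<open>auto simp: P_def\<close>)
    moreover have "x + s *\<^sub>R u = x' + s *\<^sub>R u"
      by (rule upper_chord_unique[OF nu lowL s]) (use that zw in \<open>auto simp: P_def algebra_simps\<close>)
    ultimately show ?thesis using zw by simp
  qed
  have ex: "\<exists>x y. (s, x, y) \<in> P \<and> (\<forall>z. z \<in> K \<longrightarrow> z + s *\<^sub>R u \<in> K \<longrightarrow> cross2 u x \<le> cross2 u z \<and> cross2 u z \<le> cross2 u y)"
    if s: "r \<le> s" "s \<le> L" for s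
  proof -
    have s0: "0 \<le> s" using s ball by simp
    obtain y where y: "y \<in> frontier K" "y + s *\<^sub>R u \<in> frontier K" "cross2 u x0 \<le> cross2 u y"
      "\<And>z. z \<in> K \<Longrightarrow> z + s *\<^sub>R u \<in> K \<Longrightarrow> cross2 u z \<le> cross2 u y"
      using upper_chord[OF u L s0 s(2)] by blast
    obtain w where w: "w \<in> frontier K" "w + s *\<^sub>R (- u) \<in> frontier K" "cross2 (- u) (x0 + L *\<^sub>R u) \<le> cross2 (- u) w"
      "\<And>z. z \<in> K \<Longrightarrow> z + s *\<^sub>R (- u) \<in> K \<Longrightarrow> cross2 (- u) z \<le> cross2 (- u) w"
      using upper_chord[OF nu lowL s0 s(2)] by blast
    define x where "x = w - s *\<^sub>R u"
    have "x \<in> frontier K" "x + s *\<^sub>R u \<in> frontier K" "cross2 u x \<le> cross2 u x0" using w by (auto simp: x_def)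
    moreover have "cross2 u x \<le> cross2 u z" if "z \<in> K" "z + s *\<^sub>R u \<in> K" for z
      using w(4)[of "z + s *\<^sub>R u"] that by (simp add: x_def)
    ultimately show ?thesis using y s unfolding P_def by (intro exI[of _ x] exI[of _ y]) auto
  qed
  have img: "fst ` P = {r..L}"
  proof
    show "fst ` P \<subseteq> {r..L}" unfolding P_def by auto
    show "{r..L} \<subseteq> fst ` P" using ex by (force simp: image_iff)
  qed
  define g where "g = inv_into P fst"
  have g: "g (fst z) = z" if "z \<in> P" for z
    unfolding g_def using uniq that by (intro inv_into_f_f inj_onI) auto
  have "continuous_on (fst ` P) g"
    by (rule continuous_on_inv[OF _ compP]) (use g in \<open>auto intro: continuous_intros\<close>)
  then have cg: "continuous_on {r..L} g" unfolding img .
  define G where "G = (\<lambda>s. norm (snd (snd (g s)) - fst (snd (g s))) - s)"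
  have cG: "continuous_on {r..L} G" unfolding G_def by (intro continuous_intros cg)
  have gP: "g s \<in> P" "fst (g s) = s" if "s \<in> {r..L}" for s
    using that unfolding img[symmetric] using g by auto
  have "0 \<le> G r"
  proof -
    obtain x y where xy: "(r, x, y) \<in> P" "\<forall>z. z \<in> K \<longrightarrow> z + r *\<^sub>R u \<in> K \<longrightarrow> cross2 u x \<le> cross2 u z \<and> cross2 u z \<le> cross2 u y"
      using ex[of r] \<open>r \<le> L\<close> by auto
    have gr: "g r = (r, x, y)" using g[OF xy(1)] by simp
    have "cross2 u (q + r *\<^sub>R n) \<le> cross2 u y" "cross2 u x \<le> cross2 u (q + (-r) *\<^sub>R n)"
      using xy(2)[rule_format, OF _ bK[of r r]] bK[of r 0] xy(2)[rule_format, OF _ bK[of "-r" r]] bK[of "-r" 0] ball by auto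
    then have "2 * r \<le> cross2 u (y - x)" using n by simp
    also have "\<dots> \<le> norm (y - x)"
    proof -
      have "(cross2 u (y - x))^2 \<le> (norm (y - x))^2"
      proof -
        have "(norm (y - x))^2 = (u \<bullet> (y - x))^2 + (cross2 u (y - x))^2"
        proof -
          have "(norm (y - x))^2 = (y$1 - x$1)^2 + (y$2 - x$2)^2"
            unfolding power2_norm_eq_inner inner_2 by (simp add: power2_eq_square)
          also have "\<dots> = (u$1*u$1 + u$2*u$2) * ((y$1 - x$1)^2 + (y$2 - x$2)^2)"
            using norm1_2[OF u] by simp
          also have "\<dots> = (u \<bullet> (y - x))^2 + (cross2 u (y - x))^2"
            unfolding inner_2 cross2_def by (simp add: power2_eq_square algebra_simps)
          finally show ?thesis .
        qed
        then show ?thesis by simp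
      qed
      then show ?thesis using power2_le_imp_le norm_ge_zero by blast
    qed
    finally show ?thesis unfolding G_def gr using ball by simp
  qed
  moreover have "G L \<le> 0"
  proof -
    have "(L, x0, x0) \<in> P" using F0 \<open>r \<le> L\<close> unfolding P_def by simp
    from g[OF this] have "g L = (L, x0, x0)" by simp
    then show ?thesis unfolding G_def using \<open>r \<le> L\<close> ball by simp
  qed
  ultimately obtain s where s: "r \<le> s" "s \<le> L" "G s = 0"
    using IVT2'[of G L 0 r] cG \<open>r \<le> L\<close> by blast
  obtain x y where gs: "g s = (s, x, y)"
    using gP(2)[of s] s by (cases "g s") auto
  have P: "(s, x, y) \<in> P" using gP(1)[of s] s gs by simp
  have "inscribed u (inverse s *\<^sub>R (y - x)) x s"
  proof (rule frontier_chord_pair_rhombus[OF u])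
    show "0 < s" using s ball by simp
    show "norm (y - x) = s" using s(3) unfolding G_def gs by simp
  qed (use P in \<open>auto simp: P_def\<close>)
  then show ?thesis using that s by blast
qed

end

section \<open>Dependence on the direction and the balanced rhombus\<close>

lemma tendsto_eventually_less:
  fixes f g :: "'a \<Rightarrow> real"
  assumes "(f \<longlongrightarrow> a) F" "(g \<longlongrightarrow> b) F" "a < b"
  shows "\<forall>\<^sub>F x in F. f x < g x"
  using order_tendstoD(1)[OF tendsto_diff[OF assms(2,1)], of 0] assms(3) by simp

context strict_body
begin

text \<open>The two functions below take a rhombus with side directions \<open>u\<close>, \<open>v\<close>, corner \<open>x\<close> and side \<open>s\<close>.\<close>

definition strip_area :: "(real^2) \<times> (real^2) \<times> (real^2) \<times> real \<Rightarrow> real" where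
  "strip_area = (\<lambda>(u, v, x, s). measure lebesgue {z \<in> K. cross2 u x \<le> cross2 u z \<and> cross2 u z \<le> cross2 u (x + s *\<^sub>R v)})"

definition turn :: "(real^2) \<times> (real^2) \<times> (real^2) \<times> real \<Rightarrow> (real^2) \<times> (real^2) \<times> (real^2) \<times> real" where
  "turn = (\<lambda>(u, v, x, s). (v, - u, x + s *\<^sub>R u, s))"

lemma strip_area_turn_turn: "strip_area (turn (turn w)) = strip_area w"
proof -
  obtain u v x s where w: "w = (u, v, x, s)" by (cases w) auto
  show ?thesis unfolding w turn_def strip_area_def by (simp add: conj_commute)
qed

text \<open>Dominated convergence: the indicators converge off the two lines bounding the limit
  strip. For a unit vector these are genuine lines, hence null sets.\<close>

lemma strip_area_continuous: "continuous_on {w. norm (fst w) = 1} strip_area"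
  unfolding continuous_on_sequentially
proof (intro allI ballI impI, elim conjE)
  fix w :: "nat \<Rightarrow> (real^2) \<times> (real^2) \<times> (real^2) \<times> real" and \<rho>
  assume \<rho>: "\<rho> \<in> {w. norm (fst w) = 1}" and lim: "w \<longlonglongrightarrow> \<rho>"
  define a b :: "(real^2) \<times> (real^2) \<times> (real^2) \<times> real \<Rightarrow> real"
    where "a = (\<lambda>w. cross2 (fst w) (fst (snd (snd w))))"
      and "b = (\<lambda>w. cross2 (fst w) (fst (snd (snd w)) + snd (snd (snd w)) *\<^sub>R fst (snd w)))"
  define S where "S = (\<lambda>w. {z \<in> K. a w \<le> cross2 (fst w) z \<and> cross2 (fst w) z \<le> b w})"
  have sa: "strip_area w = integral\<^sup>L lebesgue (indicator (S w))" for w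
    by (simp add: strip_area_def S_def a_def b_def case_prod_beta)
  have Sm: "indicator (S w) \<in> borel_measurable lebesgue" for w
  proof -
    have "S w = K \<inter> ({z. a w \<le> cross2 (fst w) z} \<inter> {z. cross2 (fst w) z \<le> b w})" by (auto simp: S_def)
    moreover have "closed ({z. a w \<le> cross2 (fst w) z} \<inter> {z. cross2 (fst w) z \<le> b w})"
      unfolding cross2_def by (intro closed_Int closed_Collect_le continuous_intros)
    ultimately have "compact (S w)" using compact_Int_closed[OF compact_K] by simp
    then have "S w \<in> sets borel" by (rule borel_compact)
    then have "S w \<in> sets lebesgue" by (simp add: sets_completionI_sets)
    then show ?thesis by (rule borel_measurable_indicator)
  qed
  have K: "integrable lebesgue (indicator K :: real^2 \<Rightarrow> real)"
    using lmeasurable_compact[OF compact_K] by (intro integrable_real_indicator) (auto simp: fmeasurable_def)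
  have la: "(\<lambda>n. a (w n)) \<longlonglongrightarrow> a \<rho>" "(\<lambda>n. b (w n)) \<longlonglongrightarrow> b \<rho>"
    unfolding a_def b_def cross2_def by (intro tendsto_intros lim)+
  have lz: "(\<lambda>n. cross2 (fst (w n)) z) \<longlonglongrightarrow> cross2 (fst \<rho>) z" for z
    unfolding cross2_def by (intro tendsto_intros lim)
  define N where "N = {z. cross2 (fst \<rho>) z = a \<rho>} \<union> {z. cross2 (fst \<rho>) z = b \<rho>}"
  have "negligible N"
  proof -
    define n :: "real^2" where "n = (\<chi> i. if i = 1 then - (fst \<rho>)$2 else (fst \<rho>)$1)"
    have "n \<noteq> 0"
    proof
      assume "n = 0"
      then have "n$1 = 0" "n$2 = 0" by simp_all
      then show False using norm1_2[of "fst \<rho>"] \<rho> by (simp add: n_def)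
    qed
    moreover have "cross2 (fst \<rho>) z = n \<bullet> z" for z by (simp add: n_def inner_2 cross2_def)
    ultimately show ?thesis unfolding N_def by (simp add: negligible_Un negligible_hyperplane)
  qed
  then have "AE z in lebesgue. z \<notin> N"
    by (simp add: negligible_iff_null_sets AE_not_in)
  then have ae: "AE z in lebesgue. (\<lambda>n. indicator (S (w n)) z :: real) \<longlonglongrightarrow> indicator (S \<rho>) z"
  proof eventually_elim
    case (elim z)
    show ?case
    proof (cases "z \<in> K")
      case True
      consider "cross2 (fst \<rho>) z < a \<rho>" | "b \<rho> < cross2 (fst \<rho>) z" | "a \<rho> < cross2 (fst \<rho>) z" "cross2 (fst \<rho>) z < b \<rho>"
        using elim by (fastforce simp: N_def)
      then have "\<forall>\<^sub>F n in sequentially. (indicator (S (w n)) z :: real) = indicator (S \<rho>) z"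
      proof cases
        case 1
        then have "\<forall>\<^sub>F n in sequentially. cross2 (fst (w n)) z < a (w n)"
          by (rule tendsto_eventually_less[OF lz la(1)])
        then show ?thesis by eventually_elim (use 1 in \<open>auto simp: S_def indicator_def\<close>)
      next
        case 2
        then have "\<forall>\<^sub>F n in sequentially. b (w n) < cross2 (fst (w n)) z"
          by (rule tendsto_eventually_less[OF la(2) lz])
        then show ?thesis by eventually_elim (use 2 in \<open>auto simp: S_def indicator_def\<close>)
      next
        case 3
        then have "\<forall>\<^sub>F n in sequentially. a (w n) < cross2 (fst (w n)) z" "\<forall>\<^sub>F n in sequentially. cross2 (fst (w n)) z < b (w n)"
          using tendsto_eventually_less[OF la(1) lz] tendsto_eventually_less[OF lz la(2)] by blast+
        then show ?thesis by eventually_elim (use 3 True in \<open>auto simp: S_def indicator_def\<close>)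
      qed
      then show ?thesis by (rule tendsto_eventually)
    qed (simp add: S_def)
  qed
  have "(\<lambda>n. integral\<^sup>L lebesgue (indicator (S (w n)) :: real^2 \<Rightarrow> real)) \<longlonglongrightarrow> integral\<^sup>L lebesgue (indicator (S \<rho>))"
    by (rule integral_dominated_convergence[OF Sm Sm K ae]) (auto simp: S_def indicator_def)
  then show "(strip_area \<circ> w) \<longlonglongrightarrow> strip_area \<rho>" by (simp add: sa o_def)
qed

text \<open>The rhombus belonging to the direction \<open>u1\<close> is the one of \<open>u0\<close>
  with its strips exchanged, so \<open>h\<close> takes opposite values there; connectedness of the
  circle provides a zero.\<close>

lemma balanced_rhombus:
  obtains u v x s where "inscribed u v x s" "0 < s" "strip_area (u, v, x, s) = strip_area (turn (u, v, x, s))"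
proof -
  obtain q r where r: "0 < r" "cball q (2 * r) \<subseteq> K"
  proof -
    obtain q where "q \<in> interior K" using interior_K by blast
    then obtain e where "0 < e" "cball q e \<subseteq> K" using mem_interior_cball by metis
    then show ?thesis using that[of "e/2" q] by simp
  qed
  \<comment> \<open>The bound \<open>r\<close> excludes the point rhombi \<open>s = 0\<close>, for
    which uniqueness fails.\<close>
  define R where "R = {w. inscribed (fst w) (fst (snd w)) (fst (snd (snd w))) (snd (snd (snd w))) \<and> r \<le> snd (snd (snd w))}"
  have cf: "compact (frontier K)" using compact_K compact_frontier by blast
  obtain B where B: "\<And>x. x \<in> K \<Longrightarrow> norm x \<le> B"
    using compact_K compact_imp_bounded bounded_iff by metis
  have compR: "compact R"
  proof -
    let ?A = "sphere 0 1 \<times> sphere 0 1 \<times> frontier K \<times> {r..2*B} :: ((real^2) \<times> (real^2) \<times> (real^2) \<times> real) set"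
    let ?C = "{w :: (real^2) \<times> (real^2) \<times> (real^2) \<times> real. 0 \<le> cross2 (fst w) (fst (snd w))} \<inter>
      (\<lambda>w. fst (snd (snd w)) + snd (snd (snd w)) *\<^sub>R fst w) -` frontier K \<inter>
      (\<lambda>w. fst (snd (snd w)) + snd (snd (snd w)) *\<^sub>R fst (snd w)) -` frontier K \<inter>
      (\<lambda>w. fst (snd (snd w)) + snd (snd (snd w)) *\<^sub>R fst w + snd (snd (snd w)) *\<^sub>R fst (snd w)) -` frontier K"
    have "s \<le> 2*B" if I: "inscribed u v x s" for u v x s
    proof -
      have "x \<in> K" "x + s *\<^sub>R u \<in> K" "norm u = 1" using I frontier_iff unfolding inscribed_def by auto
      moreover have "\<bar>s\<bar> = norm ((x + s *\<^sub>R u) - x)" using \<open>norm u = 1\<close> by simp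
      moreover have "\<dots> \<le> norm (x + s *\<^sub>R u) + norm x" by (rule norm_triangle_ineq4)
      ultimately show ?thesis using B[of x] B[of "x + s *\<^sub>R u"] by linarith
    qed
    then have eq: "R = ?A \<inter> ?C" unfolding R_def by (fastforce simp: inscribed_def)
    have "compact ?A" by (intro compact_Times compact_Icc cf compact_sphere)
    moreover have "closed ?C" unfolding cross2_def
      by (intro closed_Int closed_vimage closed_Collect_le continuous_intros frontier_closed)
    ultimately show ?thesis unfolding eq by (rule compact_Int_closed)
  qed
  have turnR: "turn w \<in> R" if "w \<in> R" for w
    using that inscribed_turn(1) unfolding R_def turn_def by (auto simp: case_prod_beta)
  have uniq: "z = w" if zw: "z \<in> R" "w \<in> R" "fst z = fst w" for z w
  proof -
    obtain u v x s v' x' s' where e: "z = (u, v, x, s)" "w = (u, v', x', s')"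
      using zw(3) by (cases z; cases w) auto
    then show ?thesis
      using inscribed_unique[of u v x s v' x' s'] zw r unfolding R_def by auto
  qed
  have img: "fst ` R = sphere 0 1"
  proof
    show "fst ` R \<subseteq> sphere 0 1" unfolding R_def inscribed_def by auto
    show "sphere 0 1 \<subseteq> fst ` R"
    proof
      fix u :: "real^2" assume "u \<in> sphere 0 1"
      then have "norm u = 1" by simp
      from inscribed_exists[OF this r(2,1)] obtain v x s where "inscribed u v x s" "r \<le> s" .
      then have "(u, v, x, s) \<in> R" unfolding R_def by simp
      then show "u \<in> fst ` R" by force
    qed
  qed
  define g where "g = inv_into R fst"
  have g: "g (fst z) = z" if "z \<in> R" for z
    unfolding g_def using uniq that by (intro inv_into_f_f inj_onI) auto
  have gR: "g u \<in> R" if "u \<in> sphere 0 1" for u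
    using that g unfolding img[symmetric] by auto
  have "continuous_on (fst ` R) g"
    by (rule continuous_on_inv[OF _ compR]) (use g in \<open>auto intro: continuous_intros\<close>)
  then have cg: "continuous_on (sphere 0 1) g" unfolding img .
  define h where "h = (\<lambda>w. strip_area w - strip_area (turn w))"
  have ct: "continuous_on UNIV turn" unfolding turn_def case_prod_beta by (intro continuous_intros)
  have R1: "R \<subseteq> {w. norm (fst w) = 1}" unfolding R_def inscribed_def by auto
  have ch: "continuous_on R h"
  proof -
    have "continuous_on R (\<lambda>w. strip_area (turn w))"
    proof (rule continuous_on_compose2[OF strip_area_continuous])
      show "continuous_on R turn" using ct continuous_on_subset by blast
      show "turn ` R \<subseteq> {w. norm (fst w) = 1}" using turnR R1 by blast
    qed
    moreover have "continuous_on R strip_area" using strip_area_continuous R1 continuous_on_subset by blast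
    ultimately show ?thesis unfolding h_def by (intro continuous_intros)
  qed
  have chg: "continuous_on (sphere 0 1) (\<lambda>u. h (g u))"
    using continuous_on_compose2[OF ch cg] gR by blast
  have "connected ((\<lambda>u. h (g u)) ` sphere 0 1)"
  proof (rule connected_continuous_image[OF chg])
    show "connected (sphere (0::real^2) 1)" by (rule connected_sphere) simp
  qed
  then have conn: "is_interval ((\<lambda>u. h (g u)) ` sphere 0 1)" by (simp add: is_interval_connected_1)
  define u0 :: "real^2" where "u0 = axis 1 1"
  have u0: "u0 \<in> sphere 0 1" by (simp add: u0_def)
  define u1 where "u1 = fst (turn (g u0))"
  have t: "turn (g u0) \<in> R" using turnR gR u0 by blast
  then have u1: "u1 \<in> sphere 0 1" unfolding u1_def img[symmetric] by blast
  have "h (g u1) = - h (g u0)"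
    unfolding u1_def g[OF t] h_def by (simp add: strip_area_turn_turn)
  then have "h (g u0) \<in> (\<lambda>u. h (g u)) ` sphere 0 1" "- h (g u0) \<in> (\<lambda>u. h (g u)) ` sphere 0 1"
    using imageI[OF u0, of "\<lambda>u. h (g u)"] imageI[OF u1, of "\<lambda>u. h (g u)"] by simp_all
  then have "0 \<in> (\<lambda>u. h (g u)) ` sphere 0 1"
    using conn unfolding is_interval_1 by (smt (verit))
  then obtain u where u: "u \<in> sphere 0 1" "h (g u) = 0" by force
  obtain u' v x s where e: "g u = (u', v, x, s)" by (cases "g u") auto
  have "inscribed u' v x s" "r \<le> s" using gR[OF u(1)] unfolding e R_def by auto
  then show ?thesis using that[of u' v x s] u(2) r unfolding h_def e by simp
qed

end

section \<open>Reflections in lines\<close>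

lemma frame_coordinates:
  assumes "cross2 u v \<noteq> 0"
  shows "frame p u v (cross2 (z - p) v / cross2 u v, cross2 u (z - p) / cross2 u v) = z"
proof -
  define d where "d = cross2 u v"
  have d: "d \<noteq> 0" using assms d_def by simp
  define A B where "A = cross2 (z - p) v" and "B = cross2 u (z - p)"
  have "z$i = p$i + A / d * u$i + B / d * v$i" for i
  proof -
    consider "i = 1" | "i = 2" using exhaust_2 by blast
    then have "A * u$i + B * v$i = d * (z$i - p$i)"
      by cases (simp_all only: cross2_def d_def A_def B_def vector_minus_component, simp_all add: algebra_simps)
    then have "(A * u$i + B * v$i) / d = z$i - p$i" using d by simp
    then show ?thesis by (simp add: add_divide_distrib)
  qed
  then show ?thesis
    unfolding frame_def A_def[symmetric] B_def[symmetric] d_def[symmetric] by (simp add: vec_eq_iff)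
qed

lemma vimage_frame:
  assumes "cross2 u v \<noteq> 0"
  shows "frame p u v -` K = (\<lambda>z. (cross2 (z - p) v / cross2 u v, cross2 u (z - p) / cross2 u v)) ` K"
proof -
  have "w = (cross2 (frame p u v w - p) v / cross2 u v, cross2 u (frame p u v w - p) / cross2 u v)" for w
    using inj_frame[OF assms] frame_coordinates[OF assms] by (metis injD)
  then show ?thesis using frame_coordinates[OF assms, of p] by force
qed

lemma compact_vimage_frame:
  assumes "cross2 u v \<noteq> 0" "compact K"
  shows "compact (frame p u v -` K)"
  unfolding vimage_frame[OF assms(1)] cross2_def
  by (intro compact_continuous_image continuous_intros assms(2)) (use assms(1) in \<open>auto simp: cross2_def\<close>)

lemma convex_vimage_frame:
  assumes "convex K"
  shows "convex (frame p u v -` K)"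
proof (rule convexI)
  fix x y :: "real \<times> real" and a b :: real
  assume *: "x \<in> frame p u v -` K" "y \<in> frame p u v -` K" "0 \<le> a" "0 \<le> b" "a + b = 1"
  have "a *\<^sub>R frame p u v x + b *\<^sub>R frame p u v y \<in> K"
    using * assms by (intro convexD) auto
  also have "a *\<^sub>R frame p u v x + b *\<^sub>R frame p u v y = (a + b) *\<^sub>R p
      + (a * fst x + b * fst y) *\<^sub>R u + (a * snd x + b * snd y) *\<^sub>R v"
    by (simp add: frame_def case_prod_beta scaleR_right_distrib scaleR_left_distrib)
  finally show "a *\<^sub>R x + b *\<^sub>R y \<in> frame p u v -` K"
    using *(5) by (simp add: frame_def case_prod_beta)
qed

lemma line_affine_flat:
  fixes p w :: "'a::euclidean_space"
  assumes "w \<noteq> 0"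
  shows "range (\<lambda>t. p + t *\<^sub>R w) \<in> affine_flats 1"
proof -
  have e: "affine hull {p, p + w} = range (\<lambda>t. p + t *\<^sub>R w)"
    by (simp add: affine_hull_2_alt)
  have "affine (affine hull {p, p + w})" "aff_dim (affine hull {p, p + w}) = 1"
    using assms by (simp_all add: aff_dim_2)
  then show ?thesis unfolding e affine_flats_def by simp
qed

text \<open>The closest point is the foot of the perpendicular, by Pythagoras.\<close>

lemma refl_flat_line:
  fixes p w z :: "'a::euclidean_space"
  assumes "w \<noteq> 0"
  shows "refl_flat (range (\<lambda>t. p + t *\<^sub>R w)) z = 2 *\<^sub>R (p + ((z - p) \<bullet> w / (w \<bullet> w)) *\<^sub>R w) - z"
proof -
  let ?L = "range (\<lambda>t. p + t *\<^sub>R w)"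
  define c where "c = (z - p) \<bullet> w / (w \<bullet> w)"
  have aff: "affine ?L" using line_affine_flat[OF assms, of p] unfolding affine_flats_def by simp
  have ww: "w \<bullet> w \<noteq> 0" using assms by simp
  have "p + c *\<^sub>R w = closest_point ?L z"
  proof (rule closest_point_unique)
    show "convex ?L" "closed ?L" using aff affine_imp_convex affine_closed by blast+
    show "\<forall>y\<in>?L. dist z (p + c *\<^sub>R w) \<le> dist z y"
    proof
      fix y assume "y \<in> ?L"
      then obtain t where y: "y = p + t *\<^sub>R w" by blast
      have "(dist z y)^2 = (dist z (p + c *\<^sub>R w))^2 + ((c - t) * norm w)^2"
      proof -
        have "(z - (p + c *\<^sub>R w)) \<bullet> w = 0"
          using ww by (simp add: c_def inner_diff_left inner_add_left)
        then have "orthogonal (z - (p + c *\<^sub>R w)) ((c - t) *\<^sub>R w)" by (simp add: orthogonal_def)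
        from norm_add_Pythagorean[OF this]
        have "(norm ((z - (p + c *\<^sub>R w)) + (c - t) *\<^sub>R w))^2 = (norm (z - (p + c *\<^sub>R w)))^2 + (norm ((c - t) *\<^sub>R w))^2" .
        moreover have "(z - (p + c *\<^sub>R w)) + (c - t) *\<^sub>R w = z - y" unfolding y by (simp add: algebra_simps)
        moreover have "(norm ((c - t) *\<^sub>R w))^2 = ((c - t) * norm w)^2" by (simp add: power_mult_distrib)
        ultimately show ?thesis unfolding dist_norm by simp
      qed
      then have "(dist z (p + c *\<^sub>R w))^2 \<le> (dist z y)^2" by simp
      then show "dist z (p + c *\<^sub>R w) \<le> dist z y" by (rule power2_le_imp_le) simp
    qed
  qed auto
  then show ?thesis unfolding refl_flat_def c_def by simp
qed

lemma continuous_refl_line: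
  fixes p w :: "'a::euclidean_space"
  assumes "w \<noteq> 0"
  shows "continuous_on S (refl_flat (range (\<lambda>t. p + t *\<^sub>R w)))"
  unfolding refl_flat_line[OF assms, abs_def] using assms by (intro continuous_intros) auto

lemma borel_refl_line:
  fixes p w :: "'a::euclidean_space"
  assumes "w \<noteq> 0" "K \<in> sets borel"
  shows "refl_flat (range (\<lambda>t. p + t *\<^sub>R w)) -` K \<in> sets borel"
  using measurable_sets[OF borel_measurable_continuous_onI[OF continuous_refl_line[OF assms(1)]] assms(2)]
  by simp

lemma refl_flat_line_involution:
  fixes p w z :: "'a::euclidean_space"
  assumes "w \<noteq> 0"
  shows "refl_flat (range (\<lambda>t. p + t *\<^sub>R w)) (refl_flat (range (\<lambda>t. p + t *\<^sub>R w)) z) = z"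
proof -
  have ww: "w \<bullet> w \<noteq> 0" using assms by simp
  define c where "c = (z - p) \<bullet> w / (w \<bullet> w)"
  have cw: "(z - p) \<bullet> w = c * (w \<bullet> w)" using ww by (simp add: c_def)
  have "(2 *\<^sub>R (p + c *\<^sub>R w) - z - p) \<bullet> w = c * (w \<bullet> w)"
    using cw by (simp add: algebra_simps)
  then show ?thesis unfolding refl_flat_line[OF assms] c_def[symmetric] using ww by simp
qed

lemma involution_image:
  assumes "\<And>z. f (f z) = z"
  shows "f ` K = f -` K"
  using assms by (metis bij_betw_def bij_vimage_eq_inv_image involuntory_imp_bij inv_equality)

text \<open>Equality of the side lengths is essential: only then do the linear parts of the
  reflections in the diagonals exchange \<open>u\<close> with \<open>v\<close>, respectively
  \<open>u\<close> with \<open>- v\<close>.\<close>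

lemma frame_refl:
  fixes p u v :: "real^2"
  assumes n: "norm u = norm v" and ne: "u + v \<noteq> 0" "v - u \<noteq> 0"
  shows "refl_flat (range (\<lambda>t. p + t *\<^sub>R (u + v))) (frame p u v (a, b)) = frame p u v (b, a)"
    and "refl_flat (range (\<lambda>t. (p + u) + t *\<^sub>R (v - u))) (frame p u v (a, b)) = frame p u v (1 - b, 1 - a)"
proof -
  have uv: "u \<bullet> u = v \<bullet> v" using n by (simp add: norm_eq)
  have "(frame p u v (a, b) - p) \<bullet> (u + v) = (a + b) / 2 * ((u + v) \<bullet> (u + v))"
    using uv by (simp add: frame_def inner_add_left inner_add_right inner_commute field_simps)
  then have "refl_flat (range (\<lambda>t. p + t *\<^sub>R (u + v))) (frame p u v (a, b))
      = 2 *\<^sub>R (p + ((a + b)/2) *\<^sub>R (u + v)) - frame p u v (a, b)"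
    unfolding refl_flat_line[OF ne(1)] using ne(1) by simp
  also have "\<dots> = frame p u v (b, a)"
    by (simp add: frame_def vec_eq_iff field_simps)
  finally show "refl_flat (range (\<lambda>t. p + t *\<^sub>R (u + v))) (frame p u v (a, b)) = frame p u v (b, a)" .
  have "(frame p u v (a, b) - (p + u)) \<bullet> (v - u) = (1 - a + b) / 2 * ((v - u) \<bullet> (v - u))"
    using uv by (simp add: frame_def inner_add_left inner_add_right inner_diff_left inner_diff_right inner_commute field_simps)
  then have "refl_flat (range (\<lambda>t. (p + u) + t *\<^sub>R (v - u))) (frame p u v (a, b))
      = 2 *\<^sub>R ((p + u) + ((1 - a + b)/2) *\<^sub>R (v - u)) - frame p u v (a, b)"
    unfolding refl_flat_line[OF ne(2)] using ne(2) by simp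
  also have "\<dots> = frame p u v (1 - b, 1 - a)"
    by (simp add: frame_def vec_eq_iff field_simps)
  finally show "refl_flat (range (\<lambda>t. (p + u) + t *\<^sub>R (v - u))) (frame p u v (a, b)) = frame p u v (1 - b, 1 - a)" .
qed

section \<open>The inscribed rhombus as a unit square in affine coordinates\<close>

context strict_body
begin

text \<open>A supporting line of \<open>K\<close> at the corner opposite to \<open>x\<close>. The
  coefficients are nonnegative because the neighbouring corners lie in \<open>K\<close>, and not
  both zero because \<open>u\<close> and \<open>v\<close> are independent.\<close>

lemma inscribed_supports:
  assumes I: "inscribed u v x s" and s: "0 < s"
  shows "\<exists>c d. supports (frame x (s *\<^sub>R u) (s *\<^sub>R v) -` K) c d"
proof -
  let ?b = "x + s *\<^sub>R u + s *\<^sub>R v"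
  have F: "?b \<in> frontier K" "x + s *\<^sub>R u \<in> K" "x + s *\<^sub>R v \<in> K" using I frontier_iff unfolding inscribed_def by auto
  have bK: "?b \<in> K" "?b \<notin> interior K" using F frontier_iff by auto
  have "?b \<notin> rel_interior K" using bK interior_K rel_interior_nonempty_interior by metis
  then obtain a where a: "a \<noteq> 0" "\<And>z. z \<in> closure K \<Longrightarrow> a \<bullet> ?b \<le> a \<bullet> z"
    using supporting_hyperplane_rel_boundary[OF convex_K, of ?b] bK
    by (metis closure_subset supporting_hyperplane_rel_boundary subsetD convex_K closure_closed compact_K compact_imp_closed)
  define n where "n = - a"
  have n: "n \<noteq> 0" "\<And>z. z \<in> K \<Longrightarrow> n \<bullet> z \<le> n \<bullet> ?b" using a closure_subset unfolding n_def by auto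
  define c d where "c = n \<bullet> (s *\<^sub>R u)" and "d = n \<bullet> (s *\<^sub>R v)"
  have "0 \<le> c" using n(2)[OF F(3)] by (simp add: c_def inner_add_right)
  moreover have "0 \<le> d" using n(2)[OF F(2)] by (simp add: d_def inner_add_right)
  moreover have "c \<noteq> 0 \<or> d \<noteq> 0"
  proof (rule ccontr)
    assume "\<not> ?thesis"
    then have e: "n \<bullet> u = 0" "n \<bullet> v = 0" using s by (auto simp: c_def d_def)
    have "cross2 u v \<noteq> 0" using inscribed_cross_pos[OF I s] by simp
    moreover have "n$1 * cross2 u v = 0" "n$2 * cross2 u v = 0"
      using e unfolding inner_2 cross2_def by algebra+
    ultimately have "n = 0" by (simp add: vec_eq_iff forall_2)
    then show False using n by simp
  qed
  moreover have "c * (a - 1) + d * (b - 1) \<le> 0" if "(a, b) \<in> frame x (s *\<^sub>R u) (s *\<^sub>R v) -` K" for a b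
  proof -
    have "n \<bullet> (x + a *\<^sub>R (s *\<^sub>R u) + b *\<^sub>R (s *\<^sub>R v)) \<le> n \<bullet> ?b"
      using n(2) that by (simp add: frame_def)
    then show ?thesis unfolding c_def d_def by (simp add: inner_add_right algebra_simps)
  qed
  ultimately have "supports (frame x (s *\<^sub>R u) (s *\<^sub>R v) -` K) c d" unfolding supports_def by fastforce
  then show ?thesis by blast
qed

text \<open>Matches the quarter turn with the second part of \<open>inscribed_turn\<close>, so one
  support lemma serves all corners.\<close>

lemma rot_frame: "rot (frame x (s *\<^sub>R u) (s *\<^sub>R v) -` K) = frame (x + s *\<^sub>R v) (s *\<^sub>R (- v)) (s *\<^sub>R u) -` K"
proof (rule set_eqI)
  fix w :: "real \<times> real"
  show "w \<in> rot (frame x (s *\<^sub>R u) (s *\<^sub>R v) -` K) \<longleftrightarrow> w \<in> frame (x + s *\<^sub>R v) (s *\<^sub>R (- v)) (s *\<^sub>R u) -` K"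
    by (cases w) (simp add: frame_def algebra_simps)
qed

lemma inscribed_squared:
  assumes I: "inscribed u v x s" and s: "0 < s"
  shows "squared (frame x (s *\<^sub>R u) (s *\<^sub>R v) -` K)"
proof -
  let ?C = "frame x (s *\<^sub>R u) (s *\<^sub>R v) -` K"
  note I1 = inscribed_turn(2)[OF I] note I2 = inscribed_turn(2)[OF I1] note I3 = inscribed_turn(2)[OF I2]
  have "cross2 (s *\<^sub>R u) (s *\<^sub>R v) \<noteq> 0" using inscribed_cross_pos[OF I s] s by simp
  then have C: "compact ?C" using compact_vimage_frame compact_K by blast
  have cv: "convex ?C" by (rule convex_vimage_frame[OF convex_K])
  have corners: "(0, 0) \<in> ?C" "(1, 0) \<in> ?C" "(0, 1) \<in> ?C" "(1, 1) \<in> ?C"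
    using I frontier_iff unfolding inscribed_def frame_def by auto
  have "{0..1} \<times> {0..1} \<subseteq> ?C"
  proof clarify
    fix a b :: real assume ab: "a \<in> {0..1}" "b \<in> {0..1}"
    have 1: "(1 - a) *\<^sub>R (0, 0) + a *\<^sub>R (1, 0) \<in> ?C"
      by (rule convexD[OF cv corners(1,2)]) (use ab in auto)
    have 2: "(1 - a) *\<^sub>R (0, 1) + a *\<^sub>R (1, 1) \<in> ?C"
      by (rule convexD[OF cv corners(3,4)]) (use ab in auto)
    have "(1 - b) *\<^sub>R ((1 - a) *\<^sub>R (0, 0) + a *\<^sub>R (1, 0)) + b *\<^sub>R ((1 - a) *\<^sub>R (0, 1) + a *\<^sub>R (1, 1)) \<in> ?C"
      by (rule convexD[OF cv 1 2]) (use ab in auto)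
    also have "(1 - b) *\<^sub>R ((1 - a) *\<^sub>R (0, 0) + a *\<^sub>R (1, 0)) + b *\<^sub>R ((1 - a) *\<^sub>R (0, 1) + a *\<^sub>R (1, 1)) = (a, b)"
      by (simp add: algebra_simps)
    finally show "(a, b) \<in> ?C" .
  qed
  then show ?thesis
    unfolding squared_def rot_frame
    using C cv inscribed_supports[OF I s] inscribed_supports[OF I1 s] inscribed_supports[OF I2 s] inscribed_supports[OF I3 s]
    by blast
qed

text \<open>Each strip omits exactly two opposite caps; equality of the strips is therefore the
  balance condition of \<open>squared_overlap\<close>.\<close>

lemma strip_measure:
  assumes S: "squared S"
  shows "measure lborel (S \<inter> {w. 0 \<le> snd w \<and> snd w \<le> 1}) = measure lborel S - cap_area S - cap_area (rot (rot S))"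
    and "measure lborel (S \<inter> {w. 0 \<le> fst w \<and> fst w \<le> 1}) = measure lborel S - cap_area (rot S) - cap_area (rot (rot (rot S)))"
proof -
  have Sb: "S \<in> sets borel" "bounded S" using S squared_borel by auto
  have *: "measure lborel S = measure lborel A + measure lborel B + measure lborel D"
    if "S = A \<union> B \<union> D" "A \<in> sets borel" "B \<in> sets borel" "D \<in> sets borel" "A \<inter> B = {}" "(A \<union> B) \<inter> D = {}" for A B D
  proof -
    have b: "bounded A" "bounded B" "bounded D" using that(1) Sb(2) by (auto intro: bounded_subset)
    have "measure lborel S = measure lborel (A \<union> B) + measure lborel D"
      unfolding that(1) by (rule measure_Un_disjoint_bounded) (use that b in auto)
    also have "measure lborel (A \<union> B) = measure lborel A + measure lborel B"
      by (rule measure_Un_disjoint_bounded) (use that b in auto)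
    finally show ?thesis .
  qed
  have m: "{w::real\<times>real. 0 \<le> snd w \<and> snd w \<le> 1} \<in> sets borel" "{w::real\<times>real. 0 \<le> fst w \<and> fst w \<le> 1} \<in> sets borel"
    by (intro borel_closed closed_Collect_conj closed_Collect_le continuous_intros)+
  have "measure lborel S = measure lborel (S \<inter> {w. 0 \<le> snd w \<and> snd w \<le> 1}) + measure lborel (S \<inter> {w. 1 < snd w}) + measure lborel (S \<inter> {w. snd w < 0})"
    by (rule *) (use Sb m in auto)
  then show "measure lborel (S \<inter> {w. 0 \<le> snd w \<and> snd w \<le> 1}) = measure lborel S - cap_area S - cap_area (rot (rot S))"
    unfolding cap_area_rotated[OF Sb] by (simp add: cap_area_def)
  have "measure lborel S = measure lborel (S \<inter> {w. 0 \<le> fst w \<and> fst w \<le> 1}) + measure lborel (S \<inter> {w. 1 < fst w}) + measure lborel (S \<inter> {w. fst w < 0})"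
    by (rule *) (use Sb m in auto)
  then show "measure lborel (S \<inter> {w. 0 \<le> fst w \<and> fst w \<le> 1}) = measure lborel S - cap_area (rot S) - cap_area (rot (rot (rot S)))"
    unfolding cap_area_rotated[OF Sb] by simp
qed

lemma refl_overlap_bound:
  obtains p w where "w \<noteq> 0" "0.6948 * measure lebesgue K \<le> measure lebesgue (K \<inter> refl_flat (range (\<lambda>t. p + t *\<^sub>R w)) -` K)"
proof -
  obtain u v x s where I: "inscribed u v x s" and s: "0 < s" and bal: "strip_area (u, v, x, s) = strip_area (turn (u, v, x, s))"
    using balanced_rhombus .
  define J where "J = frame x (s *\<^sub>R u) (s *\<^sub>R v)"
  define C where "C = J -` K"
  define d where "d = cross2 (s *\<^sub>R u) (s *\<^sub>R v)"
  have cp: "0 < cross2 u v" by (rule inscribed_cross_pos[OF I s])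
  then have d: "0 < d" using s by (simp add: d_def)
  have n: "norm (s *\<^sub>R u) = norm (s *\<^sub>R v)" using I by (simp add: inscribed_def)
  have ne: "s *\<^sub>R u + s *\<^sub>R v \<noteq> 0" "s *\<^sub>R v - s *\<^sub>R u \<noteq> 0"
  proof -
    have z: "cross2 u 0 = 0" by (simp add: cross2_def)
    show "s *\<^sub>R u + s *\<^sub>R v \<noteq> 0"
    proof
      assume "s *\<^sub>R u + s *\<^sub>R v = 0"
      from arg_cong[OF this, of "cross2 u"] show False using cp s z by simp
    qed
    show "s *\<^sub>R v - s *\<^sub>R u \<noteq> 0"
    proof
      assume "s *\<^sub>R v - s *\<^sub>R u = 0"
      from arg_cong[OF this, of "cross2 u"] show False using cp s z by simp
    qed
  qed
  have S: "squared C" unfolding C_def J_def by (rule inscribed_squared[OF I s])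
  have Kb: "K \<in> sets borel" "bounded K" using compact_K borel_compact compact_imp_bounded by auto
  have mJ: "measure lebesgue A = d * measure lborel (J -` A)" if "A \<in> sets borel" "A \<subseteq> K" for A
  proof -
    have "cross2 (s *\<^sub>R u) (s *\<^sub>R v) \<noteq> 0" using d unfolding d_def by linarith
    from measure_frame[OF that(1) bounded_subset[OF Kb(2) that(2)] this, of x] show ?thesis
      using d unfolding J_def d_def by (simp only: abs_of_pos)
  qed
  have closed_strip: "{z \<in> K. a \<le> cross2 w z \<and> cross2 w z \<le> b} \<in> sets borel" for a b w
  proof -
    have "{z \<in> K. a \<le> cross2 w z \<and> cross2 w z \<le> b} = K \<inter> ({z. a \<le> cross2 w z} \<inter> {z. cross2 w z \<le> b})" by auto
    moreover have "closed ({z. a \<le> cross2 w z} \<inter> {z. cross2 w z \<le> b})"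
      unfolding cross2_def by (intro closed_Int closed_Collect_le continuous_intros)
    ultimately show ?thesis using Kb by (auto intro: borel_closed)
  qed
  have s1: "strip_area (u, v, x, s) = d * measure lborel (C \<inter> {w. 0 \<le> snd w \<and> snd w \<le> 1})"
  proof -
    have "J -` {z \<in> K. cross2 u x \<le> cross2 u z \<and> cross2 u z \<le> cross2 u (x + s *\<^sub>R v)} = C \<inter> {w. 0 \<le> snd w \<and> snd w \<le> 1}"
      using cp s by (auto simp: C_def J_def frame_def zero_le_mult_iff)
    then show ?thesis unfolding strip_area_def using mJ[OF closed_strip, of "cross2 u x" u] by simp
  qed
  have s2: "strip_area (turn (u, v, x, s)) = d * measure lborel (C \<inter> {w. 0 \<le> fst w \<and> fst w \<le> 1})"
  proof -
    have "J -` {z \<in> K. cross2 v (x + s *\<^sub>R u) \<le> cross2 v z \<and> cross2 v z \<le> cross2 v (x + s *\<^sub>R u + s *\<^sub>R (- u))} = C \<inter> {w. 0 \<le> fst w \<and> fst w \<le> 1}"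
      using cp s by (auto simp: C_def J_def frame_def cross2_commute[of u v] zero_le_mult_iff mult_le_0_iff)
    then show ?thesis unfolding strip_area_def turn_def
      using mJ[OF closed_strip, of "cross2 v (x + s *\<^sub>R u)" v "cross2 v (x + s *\<^sub>R u + s *\<^sub>R (- u))"] by simp
  qed
  have "cap_area C + cap_area (rot (rot C)) = cap_area (rot C) + cap_area (rot (rot (rot C)))"
    using bal d unfolding s1 s2 strip_measure[OF S] by simp
  from squared_overlap[OF S this]
  have ov: "2 * 0.6948 * measure lborel C \<le> measure lborel (C \<inter> {w. (snd w, fst w) \<in> C}) + measure lborel (C \<inter> {w. (1 - snd w, 1 - fst w) \<in> C})" .
  have mK: "measure lebesgue K = d * measure lborel C" using mJ[OF Kb(1)] by (simp add: C_def)
  let ?L1 = "range (\<lambda>t. x + t *\<^sub>R (s *\<^sub>R u + s *\<^sub>R v))" and ?L2 = "range (\<lambda>t. (x + s *\<^sub>R u) + t *\<^sub>R (s *\<^sub>R v - s *\<^sub>R u))"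
  have rb: "K \<inter> refl_flat (range (\<lambda>t. p + t *\<^sub>R w)) -` K \<in> sets borel" if "w \<noteq> 0" for p w :: "real^2"
    using Kb(1) by (intro sets.Int borel_refl_line[OF that])
  have r1: "measure lebesgue (K \<inter> refl_flat ?L1 -` K) = d * measure lborel (C \<inter> {w. (snd w, fst w) \<in> C})"
  proof -
    have "J -` (K \<inter> refl_flat ?L1 -` K) = C \<inter> {w. (snd w, fst w) \<in> C}"
      using frame_refl(1)[OF n ne, of x] by (auto simp: C_def J_def)
    then show ?thesis using mJ[OF rb[OF ne(1)]] by simp
  qed
  have r2: "measure lebesgue (K \<inter> refl_flat ?L2 -` K) = d * measure lborel (C \<inter> {w. (1 - snd w, 1 - fst w) \<in> C})"
  proof -
    have "J -` (K \<inter> refl_flat ?L2 -` K) = C \<inter> {w. (1 - snd w, 1 - fst w) \<in> C}"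
      using frame_refl(2)[OF n ne, of x] by (auto simp: C_def J_def)
    then show ?thesis using mJ[OF rb[OF ne(2)]] by simp
  qed
  have "2 * (0.6948 * measure lebesgue K) \<le> measure lebesgue (K \<inter> refl_flat ?L1 -` K) + measure lebesgue (K \<inter> refl_flat ?L2 -` K)"
    unfolding r1 r2 mK using mult_left_mono[OF ov, of d] d by (simp add: algebra_simps)
  then have "0.6948 * measure lebesgue K \<le> measure lebesgue (K \<inter> refl_flat ?L1 -` K)
      \<or> 0.6948 * measure lebesgue K \<le> measure lebesgue (K \<inter> refl_flat ?L2 -` K)" by linarith
  then show ?thesis using that ne by blast
qed

end

section \<open>\<open>Sym 1\<close> as a supremum over lines\<close>

lemma affine_flats_1E:
  assumes "L \<in> affine_flats 1"
  obtains p w where "w \<noteq> 0" "L = range (\<lambda>t. p + t *\<^sub>R w)"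
proof -
  have L: "affine L" "aff_dim L = 1" using assms unfolding affine_flats_def by auto
  obtain B where B: "affine hull B = affine hull L" "of_nat (card B) = aff_dim L + 1"
    using aff_dim_basis_exists[of L] by blast
  have "card B = 2" using B(2) L(2) by linarith
  then obtain p q where pq: "B = {p, q}" "p \<noteq> q" by (auto simp: card_2_iff)
  have "L = affine hull B" using B(1) L(1) by (simp add: hull_same)
  then have "L = range (\<lambda>t. p + t *\<^sub>R (q - p))" unfolding pq(1) by (simp add: affine_hull_2_alt)
  then show ?thesis using that[of "q - p" p] pq(2) by simp
qed

lemma refl_line_image:
  fixes p w :: "'a::euclidean_space"
  assumes "w \<noteq> 0"
  shows "refl_flat (range (\<lambda>t. p + t *\<^sub>R w)) ` K = refl_flat (range (\<lambda>t. p + t *\<^sub>R w)) -` K"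
  by (rule involution_image) (rule refl_flat_line_involution[OF assms])

text \<open>The reflection is the orthogonal map \<open>g\<close> followed by a translation.\<close>

lemma measure_refl_line:
  fixes p w :: "real^2"
  assumes w: "w \<noteq> 0" and A: "A \<in> lmeasurable"
  shows "refl_flat (range (\<lambda>t. p + t *\<^sub>R w)) -` A \<in> lmeasurable"
    "measure lebesgue (refl_flat (range (\<lambda>t. p + t *\<^sub>R w)) -` A) = measure lebesgue A"
proof -
  define g where "g = (\<lambda>z. (2 * (z \<bullet> w / (w \<bullet> w))) *\<^sub>R w - z)"
  have ww: "w \<bullet> w \<noteq> 0" using w by simp
  have "orthogonal_transformation g"
    unfolding orthogonal_transformation_def
  proof (intro conjI allI)
    show "linear g" unfolding g_def
      by (auto intro!: linearI simp: inner_add_left algebra_simps add_divide_distrib)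
    fix a b
    show "g a \<bullet> g b = a \<bullet> b" unfolding g_def using ww
      by (simp add: inner_diff_left inner_diff_right inner_commute field_simps)
  qed
  note G = measurable_orthogonal_image[OF this A] measure_orthogonal_image[OF this A]
  define c where "c = 2 *\<^sub>R p - (2 * (p \<bullet> w / (w \<bullet> w))) *\<^sub>R w"
  have "refl_flat (range (\<lambda>t. p + t *\<^sub>R w)) z = c + g z" for z
    unfolding refl_flat_line[OF w] c_def g_def
    by (simp add: inner_diff_left diff_divide_distrib algebra_simps)
  then have "refl_flat (range (\<lambda>t. p + t *\<^sub>R w)) ` A = (+) c ` (g ` A)"
    by (simp add: image_image)
  then have e: "refl_flat (range (\<lambda>t. p + t *\<^sub>R w)) -` A = (+) c ` (g ` A)"
    unfolding refl_line_image[OF w] .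
  show "refl_flat (range (\<lambda>t. p + t *\<^sub>R w)) -` A \<in> lmeasurable"
    unfolding e using G(1) by (rule measurable_translation)
  show "measure lebesgue (refl_flat (range (\<lambda>t. p + t *\<^sub>R w)) -` A) = measure lebesgue A"
    unfolding e measure_translation by (rule G(2))
qed

lemma convex_body_measurable:
  assumes "convex_body K"
  shows "K \<in> lmeasurable" "K \<in> sets borel" "0 < measure lebesgue K"
proof -
  have K: "compact K" "interior K \<noteq> {}" "convex K" using assms unfolding convex_body_def by auto
  show l: "K \<in> lmeasurable" using K(1) by (rule lmeasurable_compact)
  show "K \<in> sets borel" using K(1) by (rule borel_compact)
  have "\<not> negligible K" using K(2) negligible_subset[OF _ interior_subset] open_not_negligible[OF open_interior] by blast
  then show "0 < measure lebesgue K"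
    using l by (metis measure_nonneg less_eq_real_def negligible_iff_measure0)
qed

lemma Sym_le:
  fixes K :: "'a::euclidean_space set"
  assumes K: "convex_body K"
    and "\<And>p w. w \<noteq> 0 \<Longrightarrow> measure lebesgue (K \<inter> refl_flat (range (\<lambda>t. p + t *\<^sub>R w)) -` K) \<le> c * measure lebesgue K"
  shows "Sym 1 K \<le> c"
proof -
  obtain b :: 'a where "b \<in> Basis" by (meson ex_in_conv nonempty_Basis)
  then have "b \<noteq> 0" by (metis nonzero_Basis)
  then have ne: "affine_flats 1 \<noteq> ({} :: 'a set set)" using line_affine_flat by blast
  have "(SUP L\<in>affine_flats 1. measure lebesgue (K \<inter> refl_flat L ` K)) \<le> c * measure lebesgue K"
  proof (rule cSUP_least[OF ne])
    fix L :: "'a set" assume "L \<in> affine_flats 1"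
    then obtain p w where w: "w \<noteq> 0" "L = range (\<lambda>t. p + t *\<^sub>R w)" by (rule affine_flats_1E)
    show "measure lebesgue (K \<inter> refl_flat L ` K) \<le> c * measure lebesgue K"
      unfolding w(2) refl_line_image[OF w(1)] by (rule assms(2)[OF w(1)])
  qed
  then show ?thesis unfolding Sym_def using convex_body_measurable(3)[OF K] by (simp add: field_simps)
qed

text \<open>The area of \<open>K\<close> bounds every overlap, which makes the supremum an actual
  upper bound.\<close>

lemma Sym_ge:
  fixes K :: "'a::euclidean_space set"
  assumes K: "convex_body K" and w: "w \<noteq> 0"
  shows "measure lebesgue (K \<inter> refl_flat (range (\<lambda>t. p + t *\<^sub>R w)) -` K) \<le> Sym 1 K * measure lebesgue K"
proof -
  note m = convex_body_measurable[OF K]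
  have "measure lebesgue (K \<inter> refl_flat L ` K) \<le> measure lebesgue K" if L: "L \<in> affine_flats 1" for L
  proof -
    obtain q v where v: "v \<noteq> 0" "L = range (\<lambda>t. q + t *\<^sub>R v)" using L by (rule affine_flats_1E)
    have "refl_flat L ` K \<in> sets borel"
      unfolding v(2) refl_line_image[OF v(1)] by (rule borel_refl_line[OF v(1) m(2)])
    then have "K \<inter> refl_flat L ` K \<in> sets borel" using m(2) by blast
    then show ?thesis using m(1) by (intro measure_mono_fmeasurable) (auto simp: sets_completionI_sets)
  qed
  then have bdd: "bdd_above ((\<lambda>L. measure lebesgue (K \<inter> refl_flat L ` K)) ` affine_flats 1)"
    by (intro bdd_aboveI2[where M = "measure lebesgue K"]) auto
  have "measure lebesgue (K \<inter> refl_flat (range (\<lambda>t. p + t *\<^sub>R w)) ` K)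
      \<le> (SUP L\<in>affine_flats 1. measure lebesgue (K \<inter> refl_flat L ` K))"
    by (rule cSUP_upper[OF line_affine_flat[OF w] bdd])
  then show ?thesis unfolding Sym_def refl_line_image[OF w] using m(3) by simp
qed

section \<open>Passage from strictly convex to arbitrary bodies\<close>

lemma infdist_convex:
  fixes K :: "'a::euclidean_space set"
  assumes K: "convex K" "closed K" "K \<noteq> {}" and t: "0 \<le> t" "t \<le> 1"
  shows "infdist ((1 - t) *\<^sub>R x + t *\<^sub>R y) K \<le> (1 - t) * infdist x K + t * infdist y K"
proof -
  obtain a b where a: "a \<in> K" "infdist x K = dist x a" and b: "b \<in> K" "infdist y K = dist y b"
    using infdist_attains_inf[OF K(2,3)] by metis
  have "(1 - t) *\<^sub>R a + t *\<^sub>R b \<in> K" using K a b t by (intro convexD) auto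
  then have "infdist ((1 - t) *\<^sub>R x + t *\<^sub>R y) K \<le> dist ((1 - t) *\<^sub>R x + t *\<^sub>R y) ((1 - t) *\<^sub>R a + t *\<^sub>R b)"
    by (rule infdist_le)
  also have "\<dots> = norm ((1 - t) *\<^sub>R (x - a) + t *\<^sub>R (y - b))" by (simp add: dist_norm algebra_simps)
  also have "\<dots> \<le> norm ((1 - t) *\<^sub>R (x - a)) + norm (t *\<^sub>R (y - b))" by (rule norm_triangle_ineq)
  also have "\<dots> = (1 - t) * infdist x K + t * infdist y K" using t by (simp add: a b dist_norm)
  finally show ?thesis .
qed

text \<open>Strictly convex bodies decreasing to \<open>K\<close>, cut out by the strictly convex functions
  \<open>\<lambda>z. infdist z K + e * (norm z)^2\<close>.\<close>

definition rounding :: "'a::euclidean_space set \<Rightarrow> real \<Rightarrow> real \<Rightarrow> 'a set" where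
  "rounding K B e = {z. infdist z K + e * ((norm z)^2 - B^2) \<le> 0}"

text \<open>The distance to \<open>K\<close> is convex and the squared norm strictly convex, so
  points between two others satisfy the inequality strictly, which is an open condition. Subtracting
  \<open>B^2\<close> keeps \<open>K\<close> inside.\<close>

lemma rounding:
  fixes K :: "'a::euclidean_space set"
  assumes K: "convex K" "compact K" "K \<noteq> {}" and B: "\<And>z. z \<in> K \<Longrightarrow> norm z \<le> B" and e: "0 < e"
  shows "K \<subseteq> rounding K B e" "compact (rounding K B e)" "strictly_convex (rounding K B e)"
    and "z \<in> rounding K B e \<Longrightarrow> (norm z)^2 \<le> B^2" "z \<in> rounding K B e \<Longrightarrow> infdist z K \<le> e * B^2"
proof -
  let ?f = "\<lambda>z. infdist z K + e * ((norm z)^2 - B^2)"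
  obtain k where "k \<in> K" using K by blast
  then have B0: "0 \<le> B" using B norm_ge_zero order_trans by blast
  have cont: "continuous_on UNIV ?f" by (intro continuous_intros)
  have nb: "(norm z)^2 \<le> B^2" if "z \<in> rounding K B e" for z
  proof -
    have "e * ((norm z)^2 - B^2) \<le> 0" using that infdist_nonneg[of z K] unfolding rounding_def by auto
    then show ?thesis using e by (simp add: mult_le_0_iff)
  qed
  show "z \<in> rounding K B e \<Longrightarrow> (norm z)^2 \<le> B^2" by (rule nb)
  show "z \<in> rounding K B e \<Longrightarrow> infdist z K \<le> e * B^2"
  proof -
    assume "z \<in> rounding K B e"
    then have "infdist z K \<le> e * B^2 - e * (norm z)^2" unfolding rounding_def by (simp add: algebra_simps)
    also have "\<dots> \<le> e * B^2" using e by simp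
    finally show ?thesis .
  qed
  show "K \<subseteq> rounding K B e"
  proof
    fix z assume z: "z \<in> K"
    then have "(norm z)^2 \<le> B^2" using B by (simp add: power_mono)
    then show "z \<in> rounding K B e" using z e unfolding rounding_def by (simp add: mult_nonneg_nonpos)
  qed
  show "compact (rounding K B e)"
  proof (rule compact_eq_bounded_closed[THEN iffD2], intro conjI)
    have "norm z \<le> B" if "z \<in> rounding K B e" for z using nb[OF that] B0 by (rule power2_le_imp_le)
    then show "bounded (rounding K B e)" by (auto simp: bounded_iff)
    show "closed (rounding K B e)" unfolding rounding_def by (intro closed_Collect_le continuous_intros)
  qed
  show "strictly_convex (rounding K B e)"
    unfolding strictly_convex_def
  proof (intro ballI impI allI, elim conjE)
    fix x y :: 'a and t :: real
    assume xy: "x \<in> rounding K B e" "y \<in> rounding K B e" "x \<noteq> y" and t: "0 < t" "t < 1"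
    let ?m = "(1 - t) *\<^sub>R x + t *\<^sub>R y"
    have "(norm ?m)^2 = (1 - t) * (norm x)^2 + t * (norm y)^2 - t * (1 - t) * (norm (x - y))^2"
      unfolding power2_norm_eq_inner
      by (simp add: inner_add_left inner_add_right inner_diff_left inner_diff_right inner_commute algebra_simps)
    moreover have "0 < t * (1 - t) * (norm (x - y))^2" using t xy(3) by simp
    ultimately have sq: "(norm ?m)^2 < (1 - t) * (norm x)^2 + t * (norm y)^2" by linarith
    have "infdist ?m K \<le> (1 - t) * infdist x K + t * infdist y K"
      using K t by (intro infdist_convex) (auto simp: compact_imp_closed)
    moreover have "e * ((norm ?m)^2 - B^2) < e * ((1 - t) * (norm x)^2 + t * (norm y)^2 - B^2)"
      using sq e by simp
    moreover have "(1 - t) * ?f x + t * ?f y \<le> 0"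
      using xy t unfolding rounding_def by (intro add_nonpos_nonpos) (auto intro: mult_nonneg_nonpos)
    ultimately have "?f ?m < 0" by (simp add: algebra_simps)
    moreover have "open {z. ?f z < 0}" by (intro open_Collect_less continuous_intros)
    moreover have "{z. ?f z < 0} \<subseteq> rounding K B e" unfolding rounding_def by auto
    ultimately show "?m \<in> interior (rounding K B e)" by (meson interiorI mem_Collect_eq)
  qed
qed

text \<open>The line found for \<open>A n\<close> is used for \<open>K\<close> as it stands: the
  overlap shrinks by at most twice the area of \<open>A n - K\<close>, which tends to 0. No limit of
  lines is taken.\<close>

lemma Sym_lower_bound:
  fixes K :: "(real^2) set"
  assumes K: "convex_body K"
  shows "0.6948 \<le> Sym 1 K"
proof -
  have K': "convex K" "compact K" "interior K \<noteq> {}" using K unfolding convex_body_def by auto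
  then have ne: "K \<noteq> {}" by auto
  note m = convex_body_measurable[OF K]
  obtain B where B: "\<And>z. z \<in> K \<Longrightarrow> norm z \<le> B"
    using K'(2) compact_imp_bounded bounded_iff by metis
  define A where "A = (\<lambda>n::nat. rounding K B (inverse (real (Suc n))))"
  note R = rounding[OF K'(1,2) ne B]
  have A: "K \<subseteq> A n" "compact (A n)" "strictly_convex (A n)" for n
    unfolding A_def using R by auto
  have Am: "A n \<in> lmeasurable" "A n \<in> sets borel" for n using A(2) lmeasurable_compact borel_compact by auto
  have eq: "(\<Inter>n. A n) = K"
  proof
    show "(\<Inter>n. A n) \<subseteq> K"
    proof
      fix z assume z: "z \<in> (\<Inter>n. A n)"
      have "infdist z K \<le> inverse (real (Suc n)) * B^2" for n
        using R(5)[of "inverse (real (Suc n))" z] z unfolding A_def by auto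
      moreover have "(\<lambda>n. inverse (real (Suc n)) * B^2) \<longlonglongrightarrow> 0 * B^2"
        by (intro tendsto_intros LIMSEQ_inverse_real_of_nat)
      ultimately have "infdist z K \<le> 0" using LIMSEQ_le_const by (metis (no_types, lifting) mult_zero_left)
      then have "infdist z K = 0" using infdist_nonneg[of z K] by linarith
      then show "z \<in> K" using in_closed_iff_infdist_zero[of K z] K'(2) ne compact_imp_closed by auto
    qed
  qed (use A in auto)
  have dec: "decseq A"
  proof (rule decseq_SucI)
    fix n
    have "inverse (real (Suc n)) * ((norm z)^2 - B^2) \<le> inverse (real (Suc (Suc n))) * ((norm z)^2 - B^2)"
      if "(norm z)^2 \<le> B^2" for z :: "real^2"
      using that by (intro mult_right_mono_neg) (auto simp: field_simps)
    then show "A (Suc n) \<subseteq> A n"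
      using R(4)[of "inverse (real (Suc (Suc n)))"] unfolding A_def by (fastforce simp: rounding_def)
  qed
  have fin: "emeasure lebesgue (A i) \<noteq> \<infinity>" for i
    using fmeasurableD2[OF Am(1)[of i]] by simp
  have "range A \<subseteq> sets lebesgue" using fmeasurableD[OF Am(1)] by blast
  from Lim_measure_decseq[OF this dec fin]
  have lim: "(\<lambda>n. measure lebesgue (A n)) \<longlonglongrightarrow> measure lebesgue K" unfolding eq .
  have "0.6948 * measure lebesgue (A n) \<le> Sym 1 K * measure lebesgue K + 2 * (measure lebesgue (A n) - measure lebesgue K)" for n
  proof -
    have "interior (A n) \<noteq> {}" using interior_mono[OF A(1)[of n]] K'(3) by blast
    then interpret strict_body "A n" using A(2,3) by unfold_locales
    obtain p w where w: "w \<noteq> 0" "0.6948 * measure lebesgue (A n) \<le> measure lebesgue (A n \<inter> refl_flat (range (\<lambda>t. p + t *\<^sub>R w)) -` A n)"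
      by (rule refl_overlap_bound)
    let ?r = "refl_flat (range (\<lambda>t. p + t *\<^sub>R w))"
    have D: "A n - K \<in> lmeasurable" using Am m by (simp add: fmeasurable_Diff fmeasurableD)
    note rD = measure_refl_line[OF w(1) D, of p]
    have rK: "K \<inter> ?r -` K \<in> lmeasurable"
      using measure_refl_line(1)[OF w(1) m(1), of p] m(1) by (simp add: fmeasurable.Int)
    have "measure lebesgue (A n \<inter> ?r -` A n) \<le> measure lebesgue ((K \<inter> ?r -` K) \<union> (A n - K) \<union> ?r -` (A n - K))"
    proof (rule measure_mono_fmeasurable)
      show "A n \<inter> ?r -` A n \<in> sets lebesgue"
        using Am measure_refl_line(1)[OF w(1) Am(1), of p n] by (auto simp: fmeasurableD)
      show "(K \<inter> ?r -` K) \<union> (A n - K) \<union> ?r -` (A n - K) \<in> lmeasurable"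
        using rK D rD(1) by (intro fmeasurable.Un)
    qed auto
    also have "\<dots> \<le> measure lebesgue ((K \<inter> ?r -` K) \<union> (A n - K)) + measure lebesgue (?r -` (A n - K))"
      using rK D rD(1) by (intro measure_Un_le) (auto simp: fmeasurableD)
    also have "\<dots> \<le> measure lebesgue (K \<inter> ?r -` K) + measure lebesgue (A n - K) + measure lebesgue (?r -` (A n - K))"
      using rK D rD(1) by (intro add_right_mono measure_Un_le) (auto simp: fmeasurableD)
    also have "measure lebesgue (?r -` (A n - K)) = measure lebesgue (A n - K)" by (rule rD(2))
    also have "measure lebesgue (A n - K) = measure lebesgue (A n) - measure lebesgue K"
      by (rule measure_Diff)
        (use fmeasurableD2[OF Am(1)[of n]] fmeasurableD[OF Am(1)[of n]] fmeasurableD[OF m(1)] A(1) in auto)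
    finally have F: "measure lebesgue (A n \<inter> ?r -` A n) \<le> measure lebesgue (K \<inter> ?r -` K)
        + (measure lebesgue (A n) - measure lebesgue K) + (measure lebesgue (A n) - measure lebesgue K)" .
    have "a \<le> S + 2 * d" if "a \<le> b + d + d" "b \<le> S" for a b d S :: real
      using that by linarith
    from order_trans[OF w(2) this[OF F Sym_ge[OF K w(1)]]] show ?thesis .
  qed
  moreover have "(\<lambda>n. 0.6948 * measure lebesgue (A n)) \<longlonglongrightarrow> 0.6948 * measure lebesgue K"
    by (intro tendsto_intros lim)
  moreover have "(\<lambda>n. Sym 1 K * measure lebesgue K + 2 * (measure lebesgue (A n) - measure lebesgue K))
      \<longlonglongrightarrow> Sym 1 K * measure lebesgue K + 2 * (measure lebesgue K - measure lebesgue K)"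
    by (intro tendsto_intros lim)
  ultimately have "0.6948 * measure lebesgue K \<le> Sym 1 K * measure lebesgue K + 2 * (measure lebesgue K - measure lebesgue K)"
    using LIMSEQ_le by blast
  then show ?thesis using m(3) by simp
qed

lemma axiality_constant_le: "2/41 * (10 + 3 * sqrt 2) \<le> 0.6948"
proof -
  have "sqrt 2 \<le> 1.41422" by (rule real_le_lsqrt) (auto simp: power2_eq_square)
  then show ?thesis by simp
qed

section \<open>Folding a triangle\<close>

text \<open>Closed intervals count a common end point of adjacent pieces twice, which is harmless
  for majorants.\<close>

lemma has_bochner_integral_trapezoid:
  fixes a b c d :: real
  assumes "a \<le> b"
  shows "has_bochner_integral lborel (\<lambda>z. indicator {a..b} z * (c + d * z)) ((b - a) * ((c + d * a) + (c + d * b)) / 2)"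
proof -
  have "has_bochner_integral lborel (\<lambda>z. (c + d * z) * indicator {a..b} z)
      ((c*b + d*b^2/2) - (c*a + d*a^2/2))"
    using assms by (intro has_bochner_integral_FTC_Icc_real) (auto intro!: derivative_eq_intros continuous_intros)
  also have "(c*b + d*b^2/2) - (c*a + d*a^2/2) = (b - a) * ((c + d * a) + (c + d * b)) / 2"
    by (simp add: power2_eq_square field_simps)
  finally show ?thesis by (simp add: mult.commute)
qed

definition tent :: "real \<Rightarrow> real" where
  "tent x = min x (2 - x)"

text \<open>Length of the intersection of \<open>{0..tent x}\<close> with its mirror image in \<open>w x / 2\<close>.\<close>

definition fold_width :: "(real \<Rightarrow> real) \<Rightarrow> real \<Rightarrow> real" where
  "fold_width w x = max 0 (tent x - \<bar>tent x - w x\<bar>)"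

text \<open>An explicit majorant with known integral stands in for the integral of
  \<open>fold_width w\<close> over \<open>{0..2}\<close>.\<close>

definition fold_bounded :: "(real \<Rightarrow> real) \<Rightarrow> bool" where
  "fold_bounded w \<longleftrightarrow> (\<exists>g I. has_bochner_integral lborel g I \<and> I \<le> 2/3 \<and> (\<forall>x. 0 \<le> g x)
     \<and> (\<forall>x. 0 \<le> x \<and> x \<le> 2 \<longrightarrow> fold_width w x \<le> g x))"

text \<open>Folds widen as \<open>w\<close> approaches the tent, so badly placed lines may be
  replaced by better ones.\<close>

lemma fold_bounded_closer:
  assumes "fold_bounded w'" "\<And>x. 0 \<le> x \<Longrightarrow> x \<le> 2 \<Longrightarrow> \<bar>tent x - w' x\<bar> \<le> \<bar>tent x - w x\<bar>"
  shows "fold_bounded w"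
proof -
  have "fold_width w x \<le> fold_width w' x" if "0 \<le> x" "x \<le> 2" for x
    unfolding fold_width_def using assms(2)[OF that] by linarith
  then show ?thesis using assms(1) unfolding fold_bounded_def by (meson order_trans)
qed

lemma fold_bounded_mirror:
  assumes "fold_bounded (\<lambda>x. w (2 - x))"
  shows "fold_bounded w"
proof -
  obtain g I where g: "has_bochner_integral lborel g I" "I \<le> 2/3" "\<And>x. 0 \<le> g x"
      "\<And>x. 0 \<le> x \<Longrightarrow> x \<le> 2 \<Longrightarrow> fold_width (\<lambda>x. w (2 - x)) x \<le> g x"
    using assms unfolding fold_bounded_def by blast
  have "has_bochner_integral lborel (\<lambda>x. g (2 + (-1) * x)) (inverse \<bar>-1\<bar> *\<^sub>R I)"
    using lborel_has_bochner_integral_real_affine_iff[of "-1" g I 2] g(1) by simp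
  then have "has_bochner_integral lborel (\<lambda>x. g (2 - x)) I" by simp
  moreover have "fold_width w x \<le> g (2 - x)" if "0 \<le> x" "x \<le> 2" for x
    using g(4)[of "2 - x"] that by (simp add: fold_width_def tent_def min.commute)
  ultimately show ?thesis unfolding fold_bounded_def using g(2,3) by blast
qed

text \<open>For lines through the apex \<open>(1, 1)\<close> the graph of the fold width is a
  triangle of height 1 over \<open>{a..b}\<close>, with \<open>b - a = 4 / (4 - \<alpha>^2)\<close>;
  slope 1 is the worst case.\<close>

lemma fold_bounded_apex:
  assumes "0 \<le> \<alpha>" "\<alpha> \<le> 1"
  shows "fold_bounded (\<lambda>x. \<alpha> * x + (1 - \<alpha>))"
proof -
  define a b where "a = (1 - \<alpha>)/(2 - \<alpha>)" and "b = (3 + \<alpha>)/(2 + \<alpha>)"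
  have ab: "0 \<le> a" "a \<le> 1" "1 \<le> b" using assms by (auto simp: a_def b_def field_simps)
  define g where "g = (\<lambda>x. indicator {a..1} x * (-(1 - \<alpha>) + (2 - \<alpha>) * x) + indicator {1..b} x * ((3 + \<alpha>) + (-(2 + \<alpha>)) * x))"
  have ea: "(2 - \<alpha>) * a = 1 - \<alpha>" and eb: "(2 + \<alpha>) * b = 3 + \<alpha>" using assms by (auto simp: a_def b_def)
  have I: "has_bochner_integral lborel g
     ((1 - a) * ((-(1 - \<alpha>) + (2 - \<alpha>) * a) + (-(1 - \<alpha>) + (2 - \<alpha>) * 1)) / 2
      + (b - 1) * (((3 + \<alpha>) + (-(2 + \<alpha>)) * 1) + ((3 + \<alpha>) + (-(2 + \<alpha>)) * b)) / 2)"
    unfolding g_def using ab by (intro has_bochner_integral_add has_bochner_integral_trapezoid) auto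
  have "((1 - a) * ((-(1 - \<alpha>) + (2 - \<alpha>) * a) + (-(1 - \<alpha>) + (2 - \<alpha>) * 1)) / 2
      + (b - 1) * (((3 + \<alpha>) + (-(2 + \<alpha>)) * 1) + ((3 + \<alpha>) + (-(2 + \<alpha>)) * b)) / 2) = (b - a) / 2"
    unfolding ea using eb by (simp add: field_simps)
  also have "\<dots> \<le> 2/3"
  proof -
    have "\<alpha>^2 \<le> 1" using assms by (simp add: power_le_one)
    have ba: "b - a = 4 / (4 - \<alpha>^2)"
      unfolding a_def b_def using assms \<open>\<alpha>^2 \<le> 1\<close> by (simp add: field_simps power2_eq_square)
    have "b - a \<le> 4/3" unfolding ba using \<open>\<alpha>^2 \<le> 1\<close> by (simp add: field_simps)
    then show ?thesis by simp
  qed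
  finally have I2: "((1 - a) * ((-(1 - \<alpha>) + (2 - \<alpha>) * a) + (-(1 - \<alpha>) + (2 - \<alpha>) * 1)) / 2
      + (b - 1) * (((3 + \<alpha>) + (-(2 + \<alpha>)) * 1) + ((3 + \<alpha>) + (-(2 + \<alpha>)) * b)) / 2) \<le> 2/3" .
  have up: "a \<le> x \<Longrightarrow> 0 \<le> -(1 - \<alpha>) + (2 - \<alpha>) * x" "x \<le> a \<Longrightarrow> -(1 - \<alpha>) + (2 - \<alpha>) * x \<le> 0" for x
    using mult_left_mono[of a x "2 - \<alpha>"] mult_left_mono[of x a "2 - \<alpha>"] ea assms by auto
  have dn: "x \<le> b \<Longrightarrow> 0 \<le> (3 + \<alpha>) + (-(2 + \<alpha>)) * x" "b \<le> x \<Longrightarrow> (3 + \<alpha>) + (-(2 + \<alpha>)) * x \<le> 0" for x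
    using mult_left_mono[of x b "2 + \<alpha>"] mult_left_mono[of b x "2 + \<alpha>"] eb assms by (auto simp: algebra_simps)
  have g0: "0 \<le> g x" for x unfolding g_def using up(1)[of x] dn(1)[of x]
    by (auto simp: indicator_def simp del: add_uminus_conv_diff minus_diff_eq)
  have gx: "fold_width (\<lambda>x. \<alpha> * x + (1 - \<alpha>)) x \<le> g x" for x
  proof (cases "x \<le> 1")
    case True
    have "fold_width (\<lambda>x. \<alpha> * x + (1 - \<alpha>)) x \<le> max 0 (-(1 - \<alpha>) + (2 - \<alpha>) * x)"
      unfolding fold_width_def tent_def using True by (auto simp: algebra_simps max_def)
    also have "\<dots> \<le> g x"
    proof (cases "a \<le> x")
      case a: True
      have "g x \<ge> -(1 - \<alpha>) + (2 - \<alpha>) * x" unfolding g_def using a True dn(1)[of x] by (auto simp: indicator_def)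
      then show ?thesis using g0[of x] by simp
    next
      case False
      then show ?thesis using up(2)[of x] g0[of x] by simp
    qed
    finally show ?thesis .
  next
    case False
    have "fold_width (\<lambda>x. \<alpha> * x + (1 - \<alpha>)) x \<le> max 0 ((3 + \<alpha>) + (-(2 + \<alpha>)) * x)"
      unfolding fold_width_def tent_def using False by (auto simp: algebra_simps max_def)
    also have "\<dots> \<le> g x"
    proof (cases "x \<le> b")
      case b: True
      have "g x \<ge> (3 + \<alpha>) + (-(2 + \<alpha>)) * x" unfolding g_def using b False by (auto simp: indicator_def)
      then show ?thesis using g0[of x] by simp
    next
      case b: False
      then show ?thesis using dn(2)[of x] g0[of x] by simp
    qed
    finally show ?thesis .
  qed
  show ?thesis unfolding fold_bounded_def using I I2 g0 gx by blast
qed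

text \<open>The deficit from \<open>2/3\<close> of the area below is a multiple of \<open>P * R * (P + R - 2/3)\<^sup>2\<close>.\<close>

lemma fold_area_identity:
  fixes P R :: real
  shows "4/3 * ((P + 3*R) * (3*P + R))
    - (P + R) * ((1 - P)^2 * (3*P + R) + (2 - P - R) * ((P + 3*R) * (3*P + R)) + (1 - R)^2 * (P + 3*R))
    = 12 * P * R * (P + R - 2/3)^2"
  by (simp add: power2_eq_square field_simps)

text \<open>The line meets the legs of the tent at \<open>x = p\<close> and
  \<open>x = 2 - r\<close>, at heights \<open>p\<close> and \<open>r\<close>. Between these points
  the fold width is the line itself; outside it falls linearly to 0 at \<open>a\<close> and
  \<open>b\<close>.\<close>

lemma fold_bounded_generic:
  assumes ab: "0 \<le> \<alpha>" "0 \<le> \<beta>" "\<alpha> + \<beta> < 1"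
  shows "fold_bounded (\<lambda>x. \<alpha> * x + \<beta>)"
proof -
  have a1: "\<alpha> < 1" using ab by linarith
  define p r where "p = \<beta>/(1 - \<alpha>)" and "r = (2*\<alpha> + \<beta>)/(1 + \<alpha>)"
  define P R where "P = 1 - p" and "R = 1 - r"
  define a b where "a = \<beta>/(2 - \<alpha>)" and "b = (4 - \<beta>)/(2 + \<alpha>)"
  have p: "(1 - \<alpha>) * p = \<beta>" "0 \<le> p" "p < 1" using ab a1 by (auto simp: p_def field_simps)
  have r: "(1 + \<alpha>) * r = 2*\<alpha> + \<beta>" "0 \<le> r" "r < 1" using ab a1 by (auto simp: r_def field_simps)
  have PR: "0 < P" "0 < R" using p r by (auto simp: P_def R_def)
  have ea: "(2 - \<alpha>) * a = \<beta>" and eb: "(2 + \<alpha>) * b = 4 - \<beta>" using ab a1 by (auto simp: a_def b_def)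
  have al: "\<alpha> * (P + R) = P - R" using p(1) r(1) unfolding P_def R_def by (simp add: algebra_simps)
  have pa: "(2 - \<alpha>) * (p - a) = p" using ea p(1) by (simp add: algebra_simps)
  have bq: "(2 + \<alpha>) * (b - (2 - r)) = r" using eb r(1) by (simp add: algebra_simps)
  have a: "0 \<le> a" "a \<le> p"
  proof -
    show "0 \<le> a" using ab a1 by (simp add: a_def)
    have "p - a = p/(2 - \<alpha>)" using pa a1 by (simp add: field_simps)
    then show "a \<le> p" using p a1 by (smt (verit) divide_nonneg_nonneg)
  qed
  have b: "2 - r \<le> b"
  proof -
    have "b - (2 - r) = r/(2 + \<alpha>)" using bq ab by (simp add: field_simps)
    then show ?thesis using r ab by (smt (verit) divide_nonneg_nonneg)
  qed
  define g where "g = (\<lambda>x. indicator {a..p} x * (-\<beta> + (2 - \<alpha>) * x) + indicator {p..2 - r} x * (\<beta> + \<alpha> * x)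
      + indicator {2 - r..b} x * ((4 - \<beta>) + (-(2 + \<alpha>)) * x))"
  define I where "I = (p - a) * ((-\<beta> + (2 - \<alpha>) * a) + (-\<beta> + (2 - \<alpha>) * p)) / 2
      + (2 - r - p) * ((\<beta> + \<alpha> * p) + (\<beta> + \<alpha> * (2 - r))) / 2
      + (b - (2 - r)) * (((4 - \<beta>) + (-(2 + \<alpha>)) * (2 - r)) + ((4 - \<beta>) + (-(2 + \<alpha>)) * b)) / 2"
  have int: "has_bochner_integral lborel g I"
    unfolding g_def I_def using a b p r by (intro has_bochner_integral_add has_bochner_integral_trapezoid) auto
  have v: "-\<beta> + (2 - \<alpha>) * p = p" "\<beta> + \<alpha> * p = p" "\<beta> + \<alpha> * (2 - r) = r" "(4 - \<beta>) + (-(2 + \<alpha>)) * (2 - r) = r"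
    using p(1) r(1) by (simp_all add: algebra_simps)
  have I: "2 * I = (p - a) * p + (P + R) * (2 - P - R) + (b - (2 - r)) * r"
  proof -
    have 0: "-\<beta> + (2 - \<alpha>) * a = 0" "(4 - \<beta>) + (-(2 + \<alpha>)) * b = 0"
      using ea eb by (simp_all add: algebra_simps)
    show ?thesis unfolding I_def v 0 P_def R_def by (simp add: field_simps)
  qed
  have D: "0 < P + 3*R" "0 < 3*P + R" using PR by auto
  have e1: "(P + 3*R) * (p - a) = (P + R) * p"
  proof -
    have "(2 - \<alpha>) * (P + R) = P + 3*R" using al by (simp add: algebra_simps)
    then show ?thesis using pa by (metis mult.assoc mult.commute)
  qed
  have e2: "(3*P + R) * (b - (2 - r)) = (P + R) * r"
  proof -
    have "(2 + \<alpha>) * (P + R) = 3*P + R" using al by (simp add: algebra_simps)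
    then show ?thesis using bq by (metis mult.assoc mult.commute)
  qed
  \<comment> \<open>\<open>P\<close> and \<open>R\<close> determine the line, with
    \<open>2 - \<alpha> = (P + 3*R)/(P + R)\<close> and
    \<open>2 + \<alpha> = (3*P + R)/(P + R)\<close>; multiplying out prepares for
    \<open>fold_area_identity\<close>.\<close>
  have "2 * I * ((P + 3*R) * (3*P + R)) = ((P + 3*R) * (p - a)) * p * (3*P + R)
      + (P + R) * (2 - P - R) * ((P + 3*R) * (3*P + R)) + ((3*P + R) * (b - (2 - r))) * r * (P + 3*R)"
    unfolding I by (simp add: algebra_simps)
  also have "\<dots> = (P + R) * ((1 - P)^2 * (3*P + R) + (2 - P - R) * ((P + 3*R) * (3*P + R)) + (1 - R)^2 * (P + 3*R))"
    unfolding e1 e2 by (simp add: P_def R_def power2_eq_square algebra_simps)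
  also have "\<dots> \<le> 4/3 * ((P + 3*R) * (3*P + R))"
    using fold_area_identity[of P R] PR by (smt (verit) mult_nonneg_nonneg zero_le_power2)
  finally have "2 * I \<le> 4/3" using D by (meson mult_pos_pos mult_le_cancel_right_pos)
  then have I2: "I \<le> 2/3" by simp
  have up: "a \<le> x \<Longrightarrow> 0 \<le> -\<beta> + (2 - \<alpha>) * x" "x \<le> a \<Longrightarrow> -\<beta> + (2 - \<alpha>) * x \<le> 0" for x
    using mult_left_mono[of a x "2 - \<alpha>"] mult_left_mono[of x a "2 - \<alpha>"] ea a1 by auto
  have dn: "x \<le> b \<Longrightarrow> 0 \<le> (4 - \<beta>) + (-(2 + \<alpha>)) * x" "b \<le> x \<Longrightarrow> (4 - \<beta>) + (-(2 + \<alpha>)) * x \<le> 0" for x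
    using mult_left_mono[of x b "2 + \<alpha>"] mult_left_mono[of b x "2 + \<alpha>"] eb ab by (auto simp: algebra_simps)
  have md: "0 \<le> x \<Longrightarrow> 0 \<le> \<beta> + \<alpha> * x" for x using ab by simp
  have g0: "0 \<le> g x" for x unfolding g_def using up(1)[of x] dn(1)[of x] md[of x] p r a b
    by (intro add_nonneg_nonneg) (auto simp: indicator_def)
  have gx: "fold_width (\<lambda>x. \<alpha> * x + \<beta>) x \<le> g x" for x
  proof -
    have fw: "fold_width (\<lambda>x. \<alpha> * x + \<beta>) x \<le> max 0 (-\<beta> + (2 - \<alpha>) * x)"
        "fold_width (\<lambda>x. \<alpha> * x + \<beta>) x \<le> max 0 (\<beta> + \<alpha> * x)"
        "fold_width (\<lambda>x. \<alpha> * x + \<beta>) x \<le> max 0 ((4 - \<beta>) + (-(2 + \<alpha>)) * x)"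
      unfolding fold_width_def tent_def by (auto simp: algebra_simps max_def min_def)
    consider "x < a" | "a \<le> x" "x \<le> p" | "p \<le> x" "x \<le> 2 - r" | "2 - r \<le> x" "x \<le> b" | "b < x" by linarith
    then show ?thesis
    proof cases
      case 1 then show ?thesis using fw(1) up(2)[of x] g0[of x] by simp
    next
      case 2
      then have "-\<beta> + (2 - \<alpha>) * x \<le> g x" unfolding g_def using dn(1)[of x] md[of x] a b p r
        by (auto simp: indicator_def)
      then show ?thesis using fw(1) g0[of x] by simp
    next
      case 3
      then have "\<beta> + \<alpha> * x \<le> g x" unfolding g_def using dn(1)[of x] up(1)[of x] a b p r
        by (auto simp: indicator_def)
      then show ?thesis using fw(2) g0[of x] by simp
    next
      case 4
      then have "(4 - \<beta>) + (-(2 + \<alpha>)) * x \<le> g x" unfolding g_def using up(1)[of x] md[of x] a b p r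
        by (auto simp: indicator_def)
      then show ?thesis using fw(3) g0[of x] by simp
    next
      case 5 then show ?thesis using fw(3) dn(2)[of x] g0[of x] by simp
    qed
  qed
  show ?thesis unfolding fold_bounded_def using int I2 g0 gx by blast
qed

lemma fold_bounded_core:
  assumes "0 \<le> \<alpha>" "0 \<le> \<beta>" "\<alpha> + \<beta> \<le> 1"
  shows "fold_bounded (\<lambda>x. \<alpha> * x + \<beta>)"
proof (cases "\<alpha> + \<beta> = 1")
  case True
  then have "\<beta> = 1 - \<alpha>" by simp
  then show ?thesis using fold_bounded_apex[of \<alpha>] assms by simp
qed (use assms fold_bounded_generic in auto)

text \<open>Lines outside the core family are moved closer to the tent: those starting below the
  origin are turned into lines through it, those passing above the apex are lowered to it or, if
  steeper than the left leg, replaced by the line of that leg.\<close>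

lemma fold_bounded_increasing:
  assumes \<alpha>: "0 \<le> \<alpha>"
  shows "fold_bounded (\<lambda>x. \<alpha> * x + \<beta>)"
proof -
  consider "\<alpha> + \<beta> \<le> 1" "0 \<le> \<beta>" | "2*\<alpha> + \<beta> < 0" | "\<alpha> + \<beta> \<le> 1" "\<beta> < 0" "0 \<le> 2*\<alpha> + \<beta>"
    | "1 < \<alpha> + \<beta>" "\<alpha> \<le> 1" | "1 < \<alpha> + \<beta>" "1 < \<alpha>" by linarith
  then show ?thesis
  proof cases
    case 1 then show ?thesis using \<alpha> by (intro fold_bounded_core)
  next
    case 2
    have "fold_width (\<lambda>x. \<alpha> * x + \<beta>) x \<le> 0" if "0 \<le> x" "x \<le> 2" for x
    proof -
      have "\<alpha> * x \<le> \<alpha> * 2" using that \<alpha> by (intro mult_left_mono)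
      then show ?thesis using 2 that unfolding fold_width_def tent_def by auto
    qed
    then show ?thesis unfolding fold_bounded_def
      by (intro exI[of _ "\<lambda>_. 0"] exI[of _ 0]) (auto simp: has_bochner_integral_zero)
  next
    case 3
    \<comment> \<open>The line meets the right leg at \<open>(q, 2 - q)\<close>;
      \<open>\<alpha>'\<close> is the slope of the line joining this point to the origin.\<close>
    define q where "q = (2 - \<beta>)/(1 + \<alpha>)"
    have q: "(1 + \<alpha>) * q = 2 - \<beta>" "1 \<le> q" "q \<le> 2" using 3 \<alpha> by (auto simp: q_def field_simps)
    define \<alpha>' where "\<alpha>' = (2 - q)/q"
    have a': "\<alpha>' * q = 2 - q" "0 \<le> \<alpha>'" "\<alpha>' \<le> 1" using q by (auto simp: \<alpha>'_def field_simps)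
    have "fold_bounded (\<lambda>x. \<alpha>' * x + 0)" using a' by (intro fold_bounded_core) auto
    then show ?thesis
    proof (rule fold_bounded_closer)
      fix x :: real assume x: "0 \<le> x" "x \<le> 2"
      have d: "\<alpha> * x + \<beta> - \<alpha>' * x = (\<alpha> - \<alpha>') * (x - q)"
      proof -
        have "\<beta> = - (\<alpha> - \<alpha>') * q" using q(1) a'(1) by (simp add: algebra_simps)
        then show ?thesis by (simp add: algebra_simps)
      qed
      have "(\<alpha> - \<alpha>') * q = - \<beta>" using q(1) a'(1) by (simp add: algebra_simps)
      then have aa: "0 \<le> \<alpha> - \<alpha>'" using 3(2) q(2) by (metis less_eq_real_def mult_less_0_iff neg_0_less_iff_less not_less order_less_trans zero_less_one order_less_le_trans)
      show "\<bar>tent x - (\<alpha>' * x + 0)\<bar> \<le> \<bar>tent x - (\<alpha> * x + \<beta>)\<bar>"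
      proof (cases "x \<le> q")
        case True
        then have "\<alpha> * x + \<beta> \<le> \<alpha>' * x" using d aa by (metis diff_le_0_iff_le mult_nonneg_nonpos)
        moreover have "\<alpha>' * x \<le> x" using a' x mult_right_mono[of \<alpha>' 1 x] by simp
        moreover have "\<alpha>' * x \<le> \<alpha>' * q" using True a' by (intro mult_left_mono)
        ultimately show ?thesis using a'(1) True unfolding tent_def by auto
      next
        case False
        then have "\<alpha>' * x \<le> \<alpha> * x + \<beta>" using d aa by (metis diff_ge_0_iff_ge linorder_le_cases mult_nonneg_nonneg)
        moreover have "\<alpha>' * q \<le> \<alpha>' * x" using False a' by (intro mult_left_mono) auto
        ultimately show ?thesis using a'(1) False unfolding tent_def by auto
      qed
    qed
  next
    case 4
    show ?thesis
    proof (rule fold_bounded_closer[OF fold_bounded_apex[OF \<alpha> 4(2)]])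
      fix x :: real assume x: "0 \<le> x" "x \<le> 2"
      have "tent x \<le> \<alpha> * x + (1 - \<alpha>)"
      proof (cases "x \<le> 1")
        case True
        have "0 \<le> (1 - \<alpha>) * (1 - x)" using True 4 by simp
        then show ?thesis unfolding tent_def by (simp add: algebra_simps)
      next
        case False
        have "0 \<le> (1 + \<alpha>) * (x - 1)" using False \<alpha> by simp
        then show ?thesis unfolding tent_def by (simp add: algebra_simps)
      qed
      then show "\<bar>tent x - (\<alpha> * x + (1 - \<alpha>))\<bar> \<le> \<bar>tent x - (\<alpha> * x + \<beta>)\<bar>" using 4 by auto
    qed
  next
    case 5
    have "fold_bounded (\<lambda>x. 1 * x + (1 - 1))" by (rule fold_bounded_apex) auto
    then show ?thesis
    proof (rule fold_bounded_closer)
      fix x :: real assume x: "0 \<le> x" "x \<le> 2"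
      show "\<bar>tent x - (1 * x + (1 - 1))\<bar> \<le> \<bar>tent x - (\<alpha> * x + \<beta>)\<bar>"
      proof (cases "x \<le> 1")
        case False
        have "0 \<le> (\<alpha> - 1) * (x - 1)" using False 5 by simp
        then have "x \<le> \<alpha> * x + \<beta>" using 5 by (simp add: algebra_simps)
        then show ?thesis using False unfolding tent_def by auto
      qed (simp add: tent_def)
    qed
  qed
qed

theorem fold_bounded_affine: "fold_bounded (\<lambda>x. \<alpha> * x + \<beta>)"
proof (cases "0 \<le> \<alpha>")
  case False
  have "fold_bounded (\<lambda>x. (- \<alpha>) * x + (2*\<alpha> + \<beta>))" using False by (intro fold_bounded_increasing) simp
  then have "fold_bounded (\<lambda>x. \<alpha> * (2 - x) + \<beta>)" by (simp add: algebra_simps)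
  then show ?thesis by (rule fold_bounded_mirror)
qed (rule fold_bounded_increasing)

section \<open>Thin quadrilaterals\<close>

lemma tent_Lipschitz: "tent x \<le> tent y + \<bar>x - y\<bar>"
  unfolding tent_def by auto

lemma tent_le_1: "tent x \<le> 1"
  unfolding tent_def by auto

lemma sqrt2_bounds: "7/5 \<le> sqrt 2" "sqrt 2 \<le> 14143/10000"
proof -
  show "7/5 \<le> sqrt 2" by (rule real_le_rsqrt) (simp add: power2_eq_square)
  show "sqrt 2 \<le> 14143/10000" by (rule real_le_lsqrt) (auto simp: power2_eq_square)
qed

text \<open>Overlap of the tent cut at \<open>r\<close> with its mirror image in
  \<open>x = c\<close>, according to the position of \<open>c\<close>; completing squares shows that
  \<open>c = 2*r/3\<close> is the worst mirror. \<open>r\<close> is kept variable because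
  \<open>sqrt 2\<close> will be enlarged by a multiple of \<open>e^2\<close>.\<close>

lemma mirror_bounded:
  fixes r b :: real
  assumes r: "1 \<le> r" "r \<le> 3/2"
  obtains g I where "has_bochner_integral lborel g I" "I \<le> r^2/3" "\<And>x. 0 \<le> g x"
    "\<And>x. b - r \<le> x \<Longrightarrow> x \<le> r \<Longrightarrow> max 0 (min (tent x) (tent (b - x))) \<le> g x"
proof -
  define c where "c = b/2"
  have b: "b = 2*c" by (simp add: c_def)
  have r2: "0 \<le> r^2/3" by simp
  consider "r < c" | "1 \<le> c" "c \<le> r" | "c < 1" "0 \<le> 2*c - r" | "2*c < r" "0 \<le> c" | "c < 0" by linarith
  then show ?thesis
  proof cases
    case 1
    show ?thesis
      by (rule that[of "\<lambda>_. 0" 0]) (use 1 r2 in \<open>auto simp: b has_bochner_integral_zero\<close>)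
  next
    case 2
    let ?g = "\<lambda>x. indicator {2*c - r..c} x * ((2 - 2*c) + 1 * x) + indicator {c..r} x * (2 + (-1) * x)"
    let ?I = "(c - (2*c - r)) * (((2 - 2*c) + 1 * (2*c - r)) + ((2 - 2*c) + 1 * c)) / 2
      + (r - c) * ((2 + (-1) * c) + (2 + (-1) * r)) / 2"
    have "?I = (2 - c)^2 - (2 - r)^2" by (simp add: power2_eq_square field_simps)
    moreover have "(2 - c)^2 \<le> 1" using 2 r by (intro power_le_one) auto
    moreover have "1 - (2 - r)^2 = r^2/3 - 4/3 * (r - 3/2)^2" by (simp add: power2_eq_square field_simps)
    moreover have "0 \<le> 4/3 * (r - 3/2)^2" by simp
    ultimately have I: "?I \<le> r^2/3" by linarith
    show ?thesis
    proof (rule that[OF _ I])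
      show "has_bochner_integral lborel ?g ?I"
        using 2 by (intro has_bochner_integral_add has_bochner_integral_trapezoid) auto
      show "0 \<le> ?g x" for x using 2 r by (auto simp: indicator_def)
      show "max 0 (min (tent x) (tent (b - x))) \<le> ?g x" if "b - r \<le> x" "x \<le> r" for x
        using that 2 r unfolding b tent_def by (auto simp: indicator_def)
    qed
  next
    case 3
    let ?g = "\<lambda>x. indicator {2*c - r..c} x * (0 + 1 * x) + indicator {c..r} x * (2*c + (-1) * x)"
    let ?I = "(c - (2*c - r)) * ((0 + 1 * (2*c - r)) + (0 + 1 * c)) / 2
      + (r - c) * ((2*c + (-1) * c) + (2*c + (-1) * r)) / 2"
    have "?I = r^2/3 - 3 * (c - 2*r/3)^2" by (simp add: power2_eq_square field_simps)
    moreover have "0 \<le> 3 * (c - 2*r/3)^2" by simp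
    ultimately have I: "?I \<le> r^2/3" by linarith
    show ?thesis
    proof (rule that[OF _ I])
      show "has_bochner_integral lborel ?g ?I"
        using 3 r by (intro has_bochner_integral_add has_bochner_integral_trapezoid) auto
      show "0 \<le> ?g x" for x using 3 r by (auto simp: indicator_def)
      show "max 0 (min (tent x) (tent (b - x))) \<le> ?g x" if "b - r \<le> x" "x \<le> r" for x
        using that 3 r unfolding b tent_def by (auto simp: indicator_def)
    qed
  next
    case 4
    let ?g = "\<lambda>x. indicator {0..c} x * (0 + 1 * x) + indicator {c..2*c} x * (2*c + (-1) * x)"
    let ?I = "(c - 0) * ((0 + 1 * 0) + (0 + 1 * c)) / 2 + (2*c - c) * ((2*c + (-1) * c) + (2*c + (-1) * (2*c))) / 2"
    have "?I = c^2" by (simp add: power2_eq_square field_simps)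
    moreover have "c^2 \<le> (r/2)^2" using 4 by (intro power_mono) auto
    moreover have "(r/2)^2 \<le> r^2/3" by (simp add: power2_eq_square)
    ultimately have I: "?I \<le> r^2/3" by linarith
    show ?thesis
    proof (rule that[OF _ I])
      show "has_bochner_integral lborel ?g ?I"
        using 4 r by (intro has_bochner_integral_add has_bochner_integral_trapezoid) auto
      show "0 \<le> ?g x" for x using 4 r by (auto simp: indicator_def)
      show "max 0 (min (tent x) (tent (b - x))) \<le> ?g x" if "b - r \<le> x" "x \<le> r" for x
        using that 4 r unfolding b tent_def by (auto simp: indicator_def)
    qed
  next
    case 5
    show ?thesis
      by (rule that[of "\<lambda>_. 0" 0]) (use 5 r2 in \<open>auto simp: b tent_def has_bochner_integral_zero\<close>)
  qed
qed

text \<open>The cut by the line \<open>x = sqrt 2\<close> makes the maximal overlap \<open>r^2/3\<close> of the previous lemma equal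
  to the bound \<open>2/3\<close> for the folds along the base.\<close>

definition cut_triangle :: "(real \<times> real) set" where
  "cut_triangle = {(x, y). 0 \<le> x \<and> x \<le> sqrt 2 \<and> 0 \<le> y \<and> y \<le> tent x}"

lemma mem_cut_triangle: "(x, y) \<in> cut_triangle \<longleftrightarrow> 0 \<le> x \<and> x \<le> sqrt 2 \<and> 0 \<le> y \<and> y \<le> tent x"
  by (simp add: cut_triangle_def)

lemma cut_triangle_bounded: "bounded cut_triangle"
proof (rule bounded_subset)
  show "bounded ({0..sqrt 2} \<times> {0..1::real})" by (simp add: bounded_Times)
  show "cut_triangle \<subseteq> {0..sqrt 2} \<times> {0..1}"
  proof
    fix z assume "z \<in> cut_triangle"
    then show "z \<in> {0..sqrt 2} \<times> {0..1}" using tent_le_1[of "fst z"] by (cases z) (simp add: cut_triangle_def)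
  qed
qed

lemma cut_triangle_closed: "closed cut_triangle"
proof -
  have eq: "cut_triangle = {z. 0 \<le> fst z} \<inter> {z. fst z \<le> sqrt 2} \<inter> {z. 0 \<le> snd z} \<inter> {z. snd z \<le> min (fst z) (2 - fst z)}"
    unfolding cut_triangle_def tent_def by auto
  show ?thesis unfolding eq by (intro closed_Int closed_Collect_le continuous_intros)
qed

lemma measure_by_slices:
  fixes O' :: "(real \<times> real) set"
  assumes O: "O' \<in> sets borel" "bounded O'" and h: "has_bochner_integral lborel h H"
    and le: "\<And>x. measure lborel {y. (x, y) \<in> O'} \<le> h x"
  shows "measure lborel O' \<le> H"
  using has_bochner_integral_le[OF slices_fst[OF O] h le] .

lemma measure_slice_le:
  fixes O' :: "(real \<times> real) set"
  assumes O: "O' \<in> sets borel" "bounded O'" and sub: "\<And>y. (x, y) \<in> O' \<Longrightarrow> lo \<le> y \<and> y \<le> hi"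
  shows "measure lborel {y. (x, y) \<in> O'} \<le> max 0 (hi - lo)"
proof -
  have s: "{y. (x, y) \<in> O'} \<subseteq> {lo..hi}" using sub by auto
  have "measure lborel {y. (x, y) \<in> O'} \<le> measure lborel {lo..hi}"
    by (rule measure_mono_bounded[OF s]) (use borel_slice(2)[OF O(1)] in auto)
  then show ?thesis by (cases "lo \<le> hi") auto
qed

text \<open>A reflection of the plane in a line, conjugated by the contraction \<open>(x, y) \<mapsto> (x, e * y)\<close>;
  \<open>C\<close> and \<open>S\<close> are the cosine and sine of twice the angle of the line.\<close>

locale thin_reflection =
  fixes C S e b1 b2 :: real
  assumes CS: "C^2 + S^2 = 1" and e: "0 < e" "e \<le> 1/100"
    and displacement: "\<And>x y. (1 + C) * (C * x + e * S * y + b1 - x) + S * e * (S / e * x - C * y + b2 - y) = 0"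
begin

definition overlap :: "(real \<times> real) set" where
  "overlap = {(x, y). (x, y) \<in> cut_triangle \<and> (C * x + e * S * y + b1, S / e * x - C * y + b2) \<in> cut_triangle}"

lemma overlap_borel: "overlap \<in> sets borel" "bounded overlap"
proof -
  have eq: "overlap = cut_triangle \<inter> (\<lambda>z. (C * fst z + e * S * snd z + b1, S / e * fst z - C * snd z + b2)) -` cut_triangle"
    unfolding overlap_def by auto
  show "overlap \<in> sets borel" unfolding eq
    by (intro borel_closed closed_Int closed_vimage cut_triangle_closed continuous_intros)
  show "bounded overlap" unfolding eq using cut_triangle_bounded by (auto intro: bounded_subset)
qed

lemma overlapD:
  assumes "(x, y) \<in> overlap"
  shows "0 \<le> x" "x \<le> sqrt 2" "0 \<le> y" "y \<le> tent x" "y \<le> 1"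
    "0 \<le> C * x + e * S * y + b1" "C * x + e * S * y + b1 \<le> sqrt 2"
    "0 \<le> S / e * x - C * y + b2" "S / e * x - C * y + b2 \<le> tent (C * x + e * S * y + b1)" "S / e * x - C * y + b2 \<le> 1"
  using assms tent_le_1[of x] tent_le_1[of "C * x + e * S * y + b1"] unfolding overlap_def mem_cut_triangle by auto

lemma e2: "e^2 \<le> 1/10000" "0 < e^2"
proof -
  have "e^2 \<le> (1/100)^2" using e by (intro power_mono) auto
  then show "e^2 \<le> 1/10000" by (simp add: power2_eq_square)
qed (use e in simp)

lemma C_bounds: "\<bar>C\<bar> \<le> 1" "1 - S^2 \<le> \<bar>C\<bar>"
proof -
  have C2: "C^2 = 1 - S^2" using CS by simp
  then have "C^2 \<le> 1^2" by simp
  then show 1: "\<bar>C\<bar> \<le> 1" using abs_le_square_iff[of C 1] by simp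
  have "\<bar>C\<bar> * \<bar>C\<bar> \<le> \<bar>C\<bar> * 1" using 1 by (intro mult_left_mono) auto
  then show "1 - S^2 \<le> \<bar>C\<bar>" using C2 by (simp add: power2_eq_square)
qed

text \<open>The image height \<open>S/e * x - C * y + b2\<close> must lie between 0 and 1. As
  \<open>C * y\<close> has fixed sign and size at most 1, \<open>S/e * x\<close> is confined to an
  interval of length 2 and \<open>x\<close> to one of length 1/2.\<close>

lemma overlap_steep:
  assumes S: "4 * e \<le> \<bar>S\<bar>"
  shows "measure lborel overlap \<le> 1/2"
proof -
  define k where "k = S/e"
  have k: "4 \<le> \<bar>k\<bar>" using S e by (simp add: k_def field_simps)
  define t where "t = (if 0 \<le> C then - b2 else - 1 - b2)"
  have kx: "t \<le> k * x \<and> k * x \<le> t + 2" if "(x, y) \<in> overlap" for x y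
  proof -
    note D = overlapD[OF that, folded k_def]
    show ?thesis
    proof (cases "0 \<le> C")
      case True
      have "0 \<le> C * y" using True D by (intro mult_nonneg_nonneg)
      moreover have "C * y \<le> 1 * 1" using True D C_bounds(1) by (intro mult_mono) auto
      moreover have "t = - b2" using True by (simp add: t_def)
      ultimately show ?thesis using D(8,10) by linarith
    next
      case False
      have "0 \<le> (- C) * y" using False D by (intro mult_nonneg_nonneg) auto
      moreover have "(- C) * y \<le> 1 * 1" using False D C_bounds(1) by (intro mult_mono) auto
      moreover have "(- C) * y = - (C * y)" by simp
      moreover have "t = - 1 - b2" using False by (simp add: t_def)
      ultimately show ?thesis using D(8,10) by linarith
    qed
  qed
  define a where "a = (if 0 < k then t/k else (t + 2)/k)"
  have xa: "a \<le> x \<and> x \<le> a + 1/2" if "(x, y) \<in> overlap" for x y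
  proof (cases "0 < k")
    case True
    have "t/k \<le> x" "x \<le> (t + 2)/k" using kx[OF that] True by (auto simp: field_simps)
    moreover have "2/k \<le> 1/2" using True k by (simp add: field_simps)
    moreover have "a = t/k" "(t + 2)/k = t/k + 2/k" using True by (simp_all add: a_def add_divide_distrib)
    ultimately show ?thesis by linarith
  next
    case False
    then have kn: "k < 0" using k by auto
    have "(t + 2)/k \<le> x" "x \<le> t/k" using kx[OF that] kn by (auto simp: field_simps)
    moreover have "- (2/k) \<le> 1/2" using kn k by (simp add: field_simps)
    moreover have "a = (t + 2)/k" "(t + 2)/k = t/k + 2/k" using False by (simp_all add: a_def add_divide_distrib)
    ultimately show ?thesis by linarith
  qed
  have "has_bochner_integral lborel (\<lambda>x. indicator {a..a + 1/2} x * (1 + 0 * x)) ((a + 1/2 - a) * ((1 + 0 * a) + (1 + 0 * (a + 1/2))) / 2)"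
    by (rule has_bochner_integral_trapezoid) simp
  then have h: "has_bochner_integral lborel (\<lambda>x. indicator {a..a + 1/2} x * (1::real)) (1/2)" by simp
  show ?thesis
  proof (rule measure_by_slices[OF overlap_borel h])
    fix x
    show "measure lborel {y. (x, y) \<in> overlap} \<le> indicator {a..a + 1/2} x * 1"
    proof (cases "x \<in> {a..a + 1/2}")
      case True
      have "measure lborel {y. (x, y) \<in> overlap} \<le> max 0 (1 - 0)"
        by (rule measure_slice_le[OF overlap_borel]) (use overlapD in blast)
      then show ?thesis using True by simp
    next
      case False
      then have "{y. (x, y) \<in> overlap} = {}" using xa by auto
      then show ?thesis by simp
    qed
  qed
qed

text \<open>Here \<open>C\<close> is close to 1 and points hardly move sideways: up to order
  \<open>e^2\<close> every vertical slice is mirrored in the height \<open>w x / 2\<close>, so the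
  bound for folds applies.\<close>

lemma overlap_along:
  assumes S: "\<bar>S\<bar> < 4 * e" and C: "0 \<le> C"
  shows "measure lborel overlap \<le> 2/3 + 100 * e^2"
proof -
  have S2: "S^2 \<le> 16 * e^2"
    using abs_le_square_iff[of S "4 * e"] S e by (simp add: power_mult_distrib)
  have C1: "1 - 16 * e^2 \<le> C" "C \<le> 1" using C_bounds S2 C by auto
  define w where "w = (\<lambda>x. S/e * x + b2)"
  obtain g I where g: "has_bochner_integral lborel g I" "I \<le> 2/3" "\<And>x. 0 \<le> g x"
      "\<And>x. 0 \<le> x \<Longrightarrow> x \<le> 2 \<Longrightarrow> fold_width w x \<le> g x"
    using fold_bounded_affine[of "S/e" b2] unfolding fold_bounded_def w_def by blast
  have "has_bochner_integral lborel (\<lambda>x. indicator {0..sqrt 2} x * (20 * e^2 + 0 * x))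
     ((sqrt 2 - 0) * ((20 * e^2 + 0 * 0) + (20 * e^2 + 0 * sqrt 2)) / 2)"
    by (rule has_bochner_integral_trapezoid) simp
  note h = has_bochner_integral_add[OF g(1) this]
  have "measure lborel overlap \<le> I + ((sqrt 2 - 0) * ((20 * e^2 + 0 * 0) + (20 * e^2 + 0 * sqrt 2)) / 2)"
  proof (rule measure_by_slices[OF overlap_borel h])
    fix x
    show "measure lborel {y. (x, y) \<in> overlap} \<le> g x + indicator {0..sqrt 2} x * (20 * e^2 + 0 * x)"
    proof (cases "x \<in> {0..sqrt 2}")
      case True
      \<comment> \<open>\<open>4 * e^2\<close> accounts for the sideways displacement,
        \<open>16 * e^2\<close> for replacing \<open>C * y\<close> by \<open>y\<close>.\<close>
      let ?lo = "max 0 (w x - tent x - 4 * e^2)" and ?hi = "min (tent x) (w x + 16 * e^2)"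
      have "measure lborel {y. (x, y) \<in> overlap} \<le> max 0 (?hi - ?lo)"
      proof (rule measure_slice_le[OF overlap_borel])
        fix y assume y: "(x, y) \<in> overlap"
        note D = overlapD[OF y]
        define x' y' where "x' = C * x + e * S * y + b1" and "y' = S/e * x - C * y + b2"
        note D' = D[folded x'_def y'_def]
        \<comment> \<open>Before conjugation the displacement is
          \<open>(x' - x, e * (y' - y))\<close> and is orthogonal to the axis, whose direction is
          \<open>(1 + C, S)\<close> here. Since \<open>1 + C\<close> is at least 1, this bounds
          \<open>x' - x\<close>.\<close>
        have "(1 + C) * (x' - x) + S * e * (y' - y) = 0"
          using displacement[of x y] unfolding x'_def y'_def .
        then have "\<bar>(1 + C) * (x' - x)\<bar> = \<bar>S * e * (y' - y)\<bar>" by linarith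
        then have "(1 + C) * \<bar>x' - x\<bar> = \<bar>S\<bar> * e * \<bar>y' - y\<bar>" using C e by (simp add: abs_mult)
        moreover have "\<bar>x' - x\<bar> \<le> (1 + C) * \<bar>x' - x\<bar>" using C mult_right_mono[of 1 "1 + C" "\<bar>x' - x\<bar>"] by simp
        moreover have "\<bar>S\<bar> * e * \<bar>y' - y\<bar> \<le> (4 * e) * e * 1"
          using S e D' by (intro mult_mono) auto
        ultimately have "\<bar>x' - x\<bar> \<le> 4 * e^2" by (simp add: power2_eq_square)
        then have tx: "tent x' \<le> tent x + 4 * e^2" using tent_Lipschitz[of x' x] by linarith
        have "(1 - 16 * e^2) * y \<le> C * y" by (rule mult_right_mono[OF C1(1) D(3)])
        moreover have "C * y \<le> 1 * y" by (rule mult_right_mono[OF C1(2) D(3)])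
        moreover have "16 * e^2 * y \<le> 16 * e^2 * 1" using D e2 by (intro mult_left_mono) auto
        ultimately have Cy: "y - 16 * e^2 \<le> C * y" "C * y \<le> y" unfolding left_diff_distrib by linarith+
        have "y' = w x - C * y" unfolding y'_def w_def by simp
        then show "?lo \<le> y \<and> y \<le> ?hi" using D' Cy tx by auto
      qed
      also have "\<dots> \<le> fold_width w x + 20 * e^2"
      proof -
        have "max 0 (min t (v + 16 * E) - max 0 (v - t - 4 * E)) \<le> max 0 (t - \<bar>t - v\<bar>) + 20 * E"
          if "0 < E" for t v E :: real
          using that by linarith
        then show ?thesis unfolding fold_width_def using e2 by blast
      qed
      also have "\<dots> \<le> g x + 20 * e^2" using g(4)[of x] True sqrt2_bounds by auto
      finally show ?thesis using True by simp
    next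
      case False
      then have "{y. (x, y) \<in> overlap} = {}" using overlapD(1,2) by auto
      then show ?thesis using g(3)[of x] False by simp
    qed
  qed
  moreover have "sqrt 2 * (20 * e^2) \<le> 100 * e^2" using sqrt2_bounds e2 by simp
  ultimately show ?thesis using g(2) by (simp add: field_simps)
qed

text \<open>Here \<open>C\<close> is close to -1, and the map is nearly a mirror
  \<open>b1 - x\<close> combined with a vertical shift of each slice. Two slices share at most the
  length of the shorter one whatever the shift, so only \<open>mirror_bounded\<close> is
  needed.\<close>

lemma overlap_across:
  assumes S: "\<bar>S\<bar> < 4 * e" and C: "C < 0"
  shows "measure lborel overlap \<le> 2/3 + 100 * e^2"
proof -
  have S2: "S^2 \<le> 16 * e^2"
    using abs_le_square_iff[of S "4 * e"] S e by (simp add: power_mult_distrib)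
  define k where "k = - C"
  have k: "1 - 16 * e^2 \<le> k" "k \<le> 1" "C = - k" using C_bounds S2 C by (auto simp: k_def)
  \<comment> \<open>28 is \<open>16 * (3/2) + 4\<close>, from the bounds on
    \<open>(1 + C) * x\<close> and \<open>e * S * y\<close>. The enlargement places every relevant
    \<open>x\<close> in the range of \<open>mirror_bounded\<close>; with 16 more for replacing
    \<open>k * y\<close> by \<open>y\<close> the slice error becomes
    \<open>44 * e^2\<close>.\<close>
  define r where "r = sqrt 2 + 28 * e^2"
  have r: "1 \<le> r" "r \<le> 3/2" unfolding r_def using sqrt2_bounds e2 by linarith+
  obtain g I where g: "has_bochner_integral lborel g I" "I \<le> r^2/3" "\<And>x. 0 \<le> g x"
    "\<And>x. b1 - r \<le> x \<Longrightarrow> x \<le> r \<Longrightarrow> max 0 (min (tent x) (tent (b1 - x))) \<le> g x"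
    using mirror_bounded[OF r, of b1] by blast
  have "has_bochner_integral lborel (\<lambda>x. indicator {0..sqrt 2} x * (44 * e^2 + 0 * x))
     ((sqrt 2 - 0) * ((44 * e^2 + 0 * 0) + (44 * e^2 + 0 * sqrt 2)) / 2)"
    by (rule has_bochner_integral_trapezoid) simp
  note h = has_bochner_integral_add[OF g(1) this]
  have "measure lborel overlap \<le> I + ((sqrt 2 - 0) * ((44 * e^2 + 0 * 0) + (44 * e^2 + 0 * sqrt 2)) / 2)"
  proof (rule measure_by_slices[OF overlap_borel h])
    fix x
    have key: "\<bar>C * x + e * S * y + b1 - (b1 - x)\<bar> \<le> 28 * e^2" if "(x, y) \<in> overlap" for y
    proof -
      note D = overlapD[OF that]
      have "(1 + C) * x \<le> (16 * e^2) * (3/2)"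
        using D k sqrt2_bounds e2 by (intro mult_mono) auto
      moreover have "0 \<le> (1 + C) * x" using D k by (intro mult_nonneg_nonneg) auto
      moreover have "\<bar>e * S * y\<bar> \<le> 4 * e^2"
      proof -
        have "\<bar>e * S * y\<bar> = e * \<bar>S\<bar> * y" using e D by (simp add: abs_mult)
        also have "\<dots> \<le> e * (4 * e) * 1" using S e D by (intro mult_mono) auto
        finally show ?thesis by (simp add: power2_eq_square)
      qed
      moreover have "C * x + e * S * y + b1 - (b1 - x) = (1 + C) * x + e * S * y" by (simp add: algebra_simps)
      ultimately show ?thesis by linarith
    qed
    show "measure lborel {y. (x, y) \<in> overlap} \<le> g x + indicator {0..sqrt 2} x * (44 * e^2 + 0 * x)"
    proof (cases "{y. (x, y) \<in> overlap} = {}")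
      case False
      then obtain y0 where y0: "(x, y0) \<in> overlap" by auto
      have x: "0 \<le> x" "x \<le> sqrt 2" using overlapD[OF y0] by auto
      have xr: "b1 - r \<le> x" "x \<le> r" using key[OF y0] overlapD(7)[OF y0] x e2 unfolding r_def by linarith+
      let ?w = "S/e * x + b2" and ?t = "tent (b1 - x)"
      let ?lo = "max 0 (- ?w)" and ?hi = "min (tent x) (?t + 44 * e^2 - ?w)"
      have "measure lborel {y. (x, y) \<in> overlap} \<le> max 0 (?hi - ?lo)"
      proof (rule measure_slice_le[OF overlap_borel])
        fix y assume y: "(x, y) \<in> overlap"
        note D = overlapD[OF y]
        have tx: "tent (C * x + e * S * y + b1) \<le> ?t + 28 * e^2"
          using tent_Lipschitz[of "C * x + e * S * y + b1" "b1 - x"] key[OF y] by linarith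
        have "(1 - 16 * e^2) * y \<le> k * y" by (rule mult_right_mono[OF k(1) D(3)])
        moreover have "k * y \<le> 1 * y" by (rule mult_right_mono[OF k(2) D(3)])
        moreover have "16 * e^2 * y \<le> 16 * e^2 * 1" using D e2 by (intro mult_left_mono) auto
        ultimately have ky: "y - 16 * e^2 \<le> k * y" "k * y \<le> y" unfolding left_diff_distrib by linarith+
        have "0 \<le> ?w + k * y" "?w + k * y \<le> ?t + 28 * e^2" using D(8,9) tx k(3) by auto
        then show "?lo \<le> y \<and> y \<le> ?hi" using D(3,4) ky by auto
      qed
      also have "\<dots> \<le> max 0 (min (tent x) ?t) + 44 * e^2"
      proof -
        have "max 0 (min t (v + 44 * E - w) - max 0 (- w)) \<le> max 0 (min t v) + 44 * E" if "0 < E" for t v w E :: real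
          using that by linarith
        then show ?thesis using e2 by blast
      qed
      also have "\<dots> \<le> g x + 44 * e^2" using g(4)[OF xr] by simp
      finally show ?thesis using x by simp
    qed (use g(3)[of x] e2 in \<open>simp add: indicator_def\<close>)
  qed
  moreover have "r^2/3 + sqrt 2 * (44 * e^2) \<le> 2/3 + 100 * e^2"
  proof -
    have "r^2 = 2 + sqrt 2 * (56 * e^2) + 784 * e^2 * e^2"
      unfolding r_def by (simp add: power2_sum power2_eq_square algebra_simps)
    moreover have "784 * e^2 * e^2 \<le> 784 * e^2 * (1/10000)" using e2 by (intro mult_left_mono) auto
    moreover have "sqrt 2 * (56 * e^2) \<le> 14143/10000 * (56 * e^2)" "sqrt 2 * (44 * e^2) \<le> 14143/10000 * (44 * e^2)"
      using sqrt2_bounds e2 by (auto intro: mult_right_mono)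
    ultimately show ?thesis using e2 by linarith
  qed
  ultimately show ?thesis using g(2) by simp
qed

theorem overlap_bound: "measure lborel overlap \<le> 2/3 + 100 * e^2"
proof -
  consider "4 * e \<le> \<bar>S\<bar>" | "\<bar>S\<bar> < 4 * e" "0 \<le> C" | "\<bar>S\<bar> < 4 * e" "C < 0" by linarith
  then show ?thesis
  proof cases
    case 1 then show ?thesis using overlap_steep e2 by linarith
  next
    case 2 then show ?thesis by (rule overlap_along)
  next
    case 3 then show ?thesis by (rule overlap_across)
  qed
qed

end

section \<open>Areas and vertices of the contracted quadrilaterals\<close>

lemma has_bochner_integral_ramps:
  fixes a b c :: real
  assumes "a \<le> b" "b \<le> c"
  shows "has_bochner_integral lborel (\<lambda>x. indicator {a<..b} x * (0 + 1 * x) + indicator {b<..c} x * (d + (-1) * x))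
    ((b^2 - a^2)/2 + (d * (c - b) + (b^2 - c^2)/2))"
  using has_bochner_integral_add[OF has_bochner_integral_affine[OF assms(1), of 0 1] has_bochner_integral_affine[OF assms(2), of d "-1"]]
  by simp

lemma cut_triangle_borel: "cut_triangle \<in> sets borel"
  using cut_triangle_closed by (rule borel_closed)

lemma measure_cut_triangle: "measure lborel cut_triangle = 2 * sqrt 2 - 2"
proof -
  have "has_bochner_integral lborel (\<lambda>x. indicator {0<..1} x * (0 + 1 * x) + indicator {1<..sqrt 2} x * (2 + (-1) * x))
    ((1^2 - 0^2)/2 + (2 * (sqrt 2 - 1) + (1^2 - (sqrt 2)^2)/2))"
    using sqrt2_bounds by (intro has_bochner_integral_ramps) auto
  moreover have "(\<lambda>x. measure lborel {y. (x, y) \<in> cut_triangle})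
      = (\<lambda>x. indicator {0<..1} x * (0 + 1 * x) + indicator {1<..sqrt 2} x * (2 + (-1) * x))"
  proof
    fix x :: real
    show "measure lborel {y. (x, y) \<in> cut_triangle}
        = indicator {0<..1} x * (0 + 1 * x) + indicator {1<..sqrt 2} x * (2 + (-1) * x)"
    proof (cases "0 \<le> x \<and> x \<le> sqrt 2")
      case True
      then have "{y. (x, y) \<in> cut_triangle} = {0..tent x}" by (auto simp: mem_cut_triangle)
      moreover have "0 \<le> tent x" using True sqrt2_bounds by (simp add: tent_def)
      ultimately show ?thesis using True sqrt2_bounds by (auto simp: tent_def indicator_def)
    next
      case False
      then have "{y. (x, y) \<in> cut_triangle} = {}" by (auto simp: mem_cut_triangle)
      then show ?thesis using False sqrt2_bounds by (auto simp: indicator_def)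
    qed
  qed
  ultimately have "measure lborel cut_triangle = (1^2 - 0^2)/2 + (2 * (sqrt 2 - 1) + (1^2 - (sqrt 2)^2)/2)"
    using slices_fst[OF cut_triangle_borel cut_triangle_bounded] by (simp only: has_bochner_integral_eq)
  then show ?thesis by simp
qed

text \<open>The mirror \<open>x = 2 * sqrt 2 / 3\<close> is the worst case \<open>2*r/3\<close> of
  \<open>mirror_bounded\<close>, so that bound is attained.\<close>

lemma measure_cut_triangle_mirror:
  "2/3 \<le> measure lborel (cut_triangle \<inter> {z. (4 * sqrt 2 / 3 - fst z, snd z) \<in> cut_triangle})"
proof -
  define r c where "r = sqrt 2" and "c = 2 * sqrt 2 / 3"
  have rc: "2 * c = 4 * r / 3" "2 * c - r = r/3" by (simp_all add: r_def c_def)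
  have b: "7/5 \<le> r" "r \<le> 14143/10000" using sqrt2_bounds by (auto simp: r_def)
  let ?T = "cut_triangle \<inter> {z. (2 * c - fst z, snd z) \<in> cut_triangle}"
  have "(\<lambda>z::real\<times>real. (2 * c - fst z, snd z)) -` cut_triangle \<in> sets borel"
    by (intro borel_closed closed_vimage cut_triangle_closed continuous_intros)
  then have T: "?T \<in> sets borel" "bounded ?T"
    using cut_triangle_borel cut_triangle_bounded by (auto simp: vimage_def intro: bounded_subset)
  have h: "has_bochner_integral lborel (\<lambda>x. indicator {r/3<..c} x * (0 + 1 * x) + indicator {c<..r} x * (2 * c + (-1) * x))
    ((c^2 - (r/3)^2)/2 + (2 * c * (r - c) + (c^2 - r^2)/2))"
    using b by (intro has_bochner_integral_ramps) (auto simp: c_def r_def)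
  have "(c^2 - (r/3)^2)/2 + (2 * c * (r - c) + (c^2 - r^2)/2) = 2/3"
    by (simp add: c_def r_def power2_eq_square field_simps)
  with h have h: "has_bochner_integral lborel (\<lambda>x. indicator {r/3<..c} x * (0 + 1 * x) + indicator {c<..r} x * (2 * c + (-1) * x)) (2/3)"
    by simp
  have "2/3 \<le> measure lborel ?T"
  proof (rule has_bochner_integral_le[OF h slices_fst[OF T]])
    fix x
    have low: "m \<le> measure lborel {y. (x, y) \<in> ?T}" if "0 \<le> m" "m \<le> tent x" "m \<le> tent (2 * c - x)" "r/3 \<le> x" "x \<le> r" for m
    proof -
      have "0 \<le> 2 * c - x" "2 * c - x \<le> r" "0 \<le> x" using that rc b by linarith+
      then have "{0..m} \<subseteq> {y. (x, y) \<in> ?T}"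
        using that by (auto simp: mem_cut_triangle r_def[symmetric])
      then have "measure lborel {0..m} \<le> measure lborel {y. (x, y) \<in> ?T}"
        by (rule measure_mono_bounded) (use borel_slice(2)[OF T(1)] bounded_slice(2)[OF T(2)] in auto)
      then show ?thesis using that by simp
    qed
    have ck: "c = 2*r/3" by (simp add: c_def r_def)
    consider "r/3 < x" "x \<le> c" | "c < x" "x \<le> r" | "x \<le> r/3 \<or> r < x" by linarith
    then show "indicator {r/3<..c} x * (0 + 1 * x) + indicator {c<..r} x * (2 * c + (-1) * x) \<le> measure lborel {y. (x, y) \<in> ?T}"
    proof cases
      case 1
      then have m: "0 \<le> x" "x \<le> tent x" "x \<le> tent (2 * c - x)" "r/3 \<le> x" "x \<le> r"
        unfolding tent_def min_def using b ck by auto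
      have "x \<le> measure lborel {y. (x, y) \<in> ?T}" by (rule low[OF m])
      then show ?thesis using 1 by simp
    next
      case 2
      then have m: "0 \<le> 2 * c - x" "2 * c - x \<le> tent x" "2 * c - x \<le> tent (2 * c - x)" "r/3 \<le> x" "x \<le> r"
        unfolding tent_def min_def using b ck by auto
      have "2 * c - x \<le> measure lborel {y. (x, y) \<in> ?T}" by (rule low[OF m])
      then show ?thesis using 2 by simp
    next
      case 3
      then have "indicator {r/3<..c} x * (0 + 1 * x) + indicator {c<..r} x * (2 * c + (-1) * x) = (0::real)"
        using b by (auto simp: ck indicator_def)
      then show ?thesis by simp
    qed
  qed
  then show ?thesis by (simp add: c_def)
qed

definition thin_frame :: "real \<Rightarrow> real \<times> real \<Rightarrow> real^2" where
  "thin_frame e = frame 0 (axis 1 1) (axis 2 e)"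

definition thin_quad :: "real \<Rightarrow> (real^2) set" where
  "thin_quad e = {z. (z$1, z$2 / e) \<in> cut_triangle}"

lemma thin_frame_nth [simp]: "thin_frame e w $ 1 = fst w" "thin_frame e w $ 2 = e * snd w"
  by (simp_all add: thin_frame_def frame_def case_prod_beta axis_def)

lemma measure_thin:
  assumes "A \<in> sets borel" "bounded A" "0 < e"
  shows "measure lebesgue A = e * measure lborel (thin_frame e -` A)"
proof -
  have "cross2 (axis 1 1) (axis 2 e) = e" by (simp add: cross2_def axis_def)
  then show ?thesis using measure_frame[OF assms(1,2), of "axis 1 1" "axis 2 e" 0] assms(3)
    by (simp add: thin_frame_def)
qed

lemma thin_quad_image:
  assumes "0 < e"
  shows "thin_quad e = thin_frame e ` cut_triangle"
proof (rule set_eqI)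
  fix z
  have "z = thin_frame e (z$1, z$2 / e)" using assms by (simp add: vec_eq_iff forall_2)
  then show "z \<in> thin_quad e \<longleftrightarrow> z \<in> thin_frame e ` cut_triangle"
    unfolding thin_quad_def using assms by (auto simp: image_iff)
qed

lemma thin_quad_compact:
  assumes "0 < e"
  shows "compact (thin_quad e)"
proof -
  have "compact cut_triangle"
    unfolding compact_eq_bounded_closed using cut_triangle_bounded cut_triangle_closed by (rule conjI)
  then show ?thesis
    unfolding thin_quad_image[OF assms] thin_frame_def
    by (rule compact_continuous_image[OF continuous_on_frame])
qed

lemma convex_cut_triangle: "convex cut_triangle"
proof -
  have eq: "cut_triangle = {z. (-1, 0) \<bullet> z \<le> 0} \<inter> {z. (1, 0) \<bullet> z \<le> sqrt 2} \<inter> {z. (0, -1) \<bullet> z \<le> 0}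
     \<inter> {z. (-1, 1) \<bullet> z \<le> 0} \<inter> {z. (1, 1) \<bullet> z \<le> 2}"
    unfolding cut_triangle_def tent_def by (auto simp: inner_prod_def)
  show ?thesis unfolding eq by (intro convex_Int convex_halfspace_le)
qed

lemma thin_quad_convex: "0 < e \<Longrightarrow> convex (thin_quad e)"
proof -
  assume e: "0 < e"
  have "linear (thin_frame e)"
    by (rule linearI) (use e in \<open>simp_all add: vec_eq_iff forall_2 algebra_simps\<close>)
  then show ?thesis unfolding thin_quad_image[OF e] using convex_linear_image convex_cut_triangle by blast
qed

lemma measure_thin_quad:
  assumes "0 < e"
  shows "measure lebesgue (thin_quad e) = e * (2 * sqrt 2 - 2)"
proof -
  have "thin_frame e -` thin_quad e = cut_triangle" using assms unfolding thin_quad_def by auto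
  then show ?thesis
    using measure_thin[OF borel_compact compact_imp_bounded assms] thin_quad_compact[OF assms] measure_cut_triangle by simp
qed

lemma thin_quad_body:
  assumes "0 < e"
  shows "convex_body (thin_quad e)"
proof -
  have "0 < measure lebesgue (thin_quad e)" unfolding measure_thin_quad[OF assms] using assms sqrt2_bounds by simp
  then have "\<not> negligible (thin_quad e)" by (metis less_irrefl negligible_imp_measure0)
  then have "interior (thin_quad e) \<noteq> {}" using negligible_convex_interior thin_quad_convex[OF assms] by blast
  then show ?thesis using thin_quad_convex thin_quad_compact assms unfolding convex_body_def by blast
qed

lemma convex_quadrilateral_thin:
  assumes e: "0 < e"
  shows "convex_quadrilateral (thin_quad e)"
proof -
  define P :: "real \<Rightarrow> real \<Rightarrow> real^2" where "P = (\<lambda>x y. thin_frame e (x, y))"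
  have P: "P x y $ 1 = x" "P x y $ 2 = e * y" for x y by (simp_all add: P_def)
  define r where "r = sqrt 2"
  have b: "7/5 \<le> r" "r \<le> 14143/10000" using sqrt2_bounds by (auto simp: r_def)
  let ?S = "{P 0 0, P r 0, P r (2 - r), P 1 1}"
  have comb: "(1 - t) *\<^sub>R P x y + t *\<^sub>R P x' y' = P ((1 - t) * x + t * x') ((1 - t) * y + t * y')" for t x y x' y'
    by (simp add: vec_eq_iff forall_2 P algebra_simps)
  have neq: "P x y = P x' y' \<longleftrightarrow> x = x' \<and> y = y'" for x y x' y'
    using e by (auto simp: vec_eq_iff forall_2 P)
  have "card ?S = 4" using b by (simp add: neq)
  moreover have "thin_quad e = convex hull ?S"
  proof
    have "?S \<subseteq> thin_quad e"
      using e b unfolding thin_quad_def by (auto simp: P mem_cut_triangle tent_def r_def)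
    then show "convex hull ?S \<subseteq> thin_quad e" using thin_quad_convex[OF e] by (rule hull_minimal)
    let ?H = "convex hull ?S"
    have cH: "convex ?H" by (rule convex_convex_hull)
    have V: "P 0 0 \<in> ?H" "P r 0 \<in> ?H" "P r (2 - r) \<in> ?H" "P 1 1 \<in> ?H" by (auto intro: hull_inc)
    have mix: "P ((1 - t) * x + t * x') ((1 - t) * y + t * y') \<in> ?H"
      if "P x y \<in> ?H" "P x' y' \<in> ?H" "0 \<le> t" "t \<le> 1" for t x y x' y'
      unfolding comb[symmetric] by (rule convexD[OF cH that(1,2)]) (use that in auto)
    show "thin_quad e \<subseteq> ?H"
    proof
      fix z assume z: "z \<in> thin_quad e"
      define x y where "x = z$1" and "y = z$2 / e"
      have xy: "0 \<le> x" "x \<le> r" "0 \<le> y" "y \<le> x" "y \<le> 2 - x" using z unfolding thin_quad_def mem_cut_triangle tent_def x_def y_def r_def by auto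
      have zP: "z = P x y" using e by (simp add: vec_eq_iff forall_2 P x_def y_def)
      have bot: "P x 0 \<in> ?H" using mix[OF V(1,2), of "x/r"] xy b by simp
      have top: "P x (min x (2 - x)) \<in> ?H"
      proof (cases "x \<le> 1")
        case True
        then show ?thesis using mix[OF V(1,4), of x] xy by (simp add: min_def)
      next
        case False
        define t where "t = (x - 1)/(r - 1)"
        have t: "t * (r - 1) = x - 1" "0 \<le> t" "t \<le> 1" using False xy b by (auto simp: t_def field_simps)
        have E: "(1 - t) * 1 + t * r = x" "(1 - t) * 1 + t * (2 - r) = 2 - x" using t(1) by (simp_all add: algebra_simps)
        have "P x (2 - x) \<in> ?H" using mix[OF V(4,3) t(2,3)] unfolding E .
        then show ?thesis using False by (simp add: min_def)
      qed
      define m where "m = min x (2 - x)"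
      have m: "y \<le> m" using xy by (simp add: m_def)
      show "z \<in> ?H"
      proof (cases "m = 0")
        case True
        then show ?thesis using bot xy m zP by simp
      next
        case False
        then have "0 < m" using m xy by linarith
        then show ?thesis using mix[OF bot top[folded m_def], of "y/m"] m xy zP by (simp add: algebra_simps)
      qed
    qed
  qed
  moreover have "\<forall>x\<in>?S. x \<notin> convex hull (?S - {x})"
  proof -
    have sep: "x \<notin> convex hull (?S - {x})" if "\<And>y. y \<in> ?S \<Longrightarrow> y \<noteq> x \<Longrightarrow> a \<bullet> y \<le> k" "k < a \<bullet> x" for x a k
    proof -
      have "convex hull (?S - {x}) \<subseteq> {y. a \<bullet> y \<le> k}"
        by (rule hull_minimal) (use that(1) convex_halfspace_le in auto)
      then show ?thesis using that(2) by auto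
    qed
    have ax: "thin_frame f w \<bullet> P x y = fst w * x + f * e * (snd w * y)" for f w x y
      by (simp add: inner_vec_def sum_2 P)
    \<comment> \<open>Contracting by \<open>1/e\<close> is dual to contracting by \<open>e\<close>,
      so separating functionals can be chosen as for the uncontracted vertices.\<close>
    define A where "A = (\<lambda>i j. thin_frame (1/e) (i, j))"
    have A: "A i j \<bullet> P x y = i * x + j * y" for i j x y
      unfolding A_def ax using e by simp
    have "P 0 0 \<notin> convex hull (?S - {P 0 0})" by (rule sep[of _ "A (-1) 0" "-1"]) (use b in \<open>auto simp: A neq\<close>)
    moreover have "P r 0 \<notin> convex hull (?S - {P r 0})" by (rule sep[of _ "A 1 (-1)" "r - (2 - r)"]) (use b in \<open>auto simp: A neq\<close>)
    moreover have "P r (2 - r) \<notin> convex hull (?S - {P r (2 - r)})" by (rule sep[of _ "A 2 1" "3"]) (use b in \<open>auto simp: A neq\<close>)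
    moreover have "P 1 1 \<notin> convex hull (?S - {P 1 1})" by (rule sep[of _ "A 0 1" "2 - r"]) (use b in \<open>auto simp: A neq\<close>)
    ultimately show ?thesis by blast
  qed
  moreover have "interior (thin_quad e) \<noteq> {}" using thin_quad_body[OF e] unfolding convex_body_def by blast
  ultimately show ?thesis unfolding convex_quadrilateral_def by blast
qed

lemma thin_quad_overlap:
  assumes e: "0 < e" "e \<le> 1/100" and w: "w \<noteq> 0"
  shows "measure lebesgue (thin_quad e \<inter> refl_flat (range (\<lambda>t. p + t *\<^sub>R w)) -` thin_quad e) \<le> e * (2/3 + 100 * e^2)"
proof -
  define n where "n = w$1 * w$1 + w$2 * w$2"
  have ww: "w \<bullet> w = n" by (simp add: inner_2 n_def)
  have n: "n \<noteq> 0" using w ww by (metis inner_eq_zero_iff)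
  \<comment> \<open>Entries of the orthogonal projection onto the direction \<open>w\<close>. The
    reflection has linear part twice the projection minus the identity, whence
    \<open>C = 2*a1 - 1\<close> and \<open>S = 2*a12\<close>.\<close>
  define a1 a2 a12 where "a1 = w$1 * w$1 / n" and "a2 = w$2 * w$2 / n" and "a12 = w$1 * w$2 / n"
  have a: "a1 + a2 = 1" "a12 * a12 = a1 * a2"
    using n unfolding a1_def a2_def a12_def by (simp_all add: n_def add_divide_distrib[symmetric])
  define b1 b2 where "b1 = 2 * (a2 * p$1 - a12 * p$2)" and "b2 = 2 * (a1 * p$2 - a12 * p$1) / e"
  have eb2: "e * b2 = 2 * (a1 * p$2 - a12 * p$1)" using e by (simp add: b2_def)
  let ?r = "refl_flat (range (\<lambda>t. p + t *\<^sub>R w))"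
  have proj: "(z - p) \<bullet> w / (w \<bullet> w) * w$1 = a1 * (z$1 - p$1) + a12 * (z$2 - p$2)"
      "(z - p) \<bullet> w / (w \<bullet> w) * w$2 = a12 * (z$1 - p$1) + a2 * (z$2 - p$2)" for z
    unfolding ww unfolding a1_def a12_def a2_def inner_2 by (simp_all add: algebra_simps add_divide_distrib diff_divide_distrib)
  have a2': "a2 = 1 - a1" using a(1) by simp
  have refl_nth: "?r z $ i = 2 * (p$i + (z - p) \<bullet> w / (w \<bullet> w) * w$i) - z$i" for z i
    unfolding refl_flat_line[OF w] by simp
  have r1: "?r z $ 1 = (2*a1 - 1) * z$1 + (2*a12) * z$2 + b1" for z
    unfolding refl_nth proj by (simp add: b1_def a2' algebra_simps)
  have r2: "?r z $ 2 = (2*a12) * z$1 - (2*a1 - 1) * z$2 + e * b2" for z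
    unfolding refl_nth proj eb2 by (simp add: a2' algebra_simps)
  interpret thin_reflection "2*a1 - 1" "2*a12" e b1 b2
  proof
    show "(2*a1 - 1)^2 + (2*a12)^2 = 1"
      using a(2) unfolding a2' by (simp add: power2_eq_square algebra_simps)
    fix x y
    have "(2*a12) * e * ((2*a12)/e * x - (2*a1 - 1) * y + b2 - y)
        = (2*a12) * ((2*a12) * x - (2*a1 - 1) * (e*y) + e * b2 - e*y)"
      using e by (simp add: field_simps)
    moreover have "(1 + (2*a1 - 1)) * ((2*a1 - 1) * x + e * (2*a12) * y + b1 - x)
        + (2*a12) * ((2*a12) * x - (2*a1 - 1) * (e*y) + e * b2 - e*y) = 0"
      using a(2) unfolding eb2 b1_def a2' by algebra
    ultimately show "(1 + (2*a1 - 1)) * ((2*a1 - 1) * x + e * (2*a12) * y + b1 - x)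
        + (2*a12) * e * ((2*a12)/e * x - (2*a1 - 1) * y + b2 - y) = 0" by (simp only:)
  qed (use e in auto)
  have "thin_frame e -` (thin_quad e \<inter> ?r -` thin_quad e) = overlap"
  proof (rule set_eqI)
    fix z :: "real \<times> real"
    obtain x y where z: "z = (x, y)" by (cases z)
    have "((2*a12) * x - (2*a1 - 1) * (e * y) + e * b2) / e = (2*a12)/e * x - (2*a1 - 1) * y + b2"
      using e by (simp add: field_simps)
    moreover have "(2*a1 - 1) * x + (2*a12) * (e * y) + b1 = (2*a1 - 1) * x + e * (2*a12) * y + b1" by simp
    ultimately show "z \<in> thin_frame e -` (thin_quad e \<inter> ?r -` thin_quad e) \<longleftrightarrow> z \<in> overlap"
      unfolding z overlap_def thin_quad_def using e by (simp add: r1 r2 mult.left_commute[of e] mult.assoc)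
  qed
  moreover have "thin_quad e \<inter> ?r -` thin_quad e \<in> sets borel"
    using borel_compact[OF thin_quad_compact[OF e(1)]] by (intro sets.Int borel_refl_line[OF w])
  moreover have "bounded (thin_quad e \<inter> ?r -` thin_quad e)"
    using compact_imp_bounded[OF thin_quad_compact[OF e(1)]] by (rule bounded_subset) (rule Int_lower1)
  ultimately show ?thesis using measure_thin[of _ e] overlap_bound e by simp
qed

text \<open>A mirror perpendicular to the base commutes with the contraction, so the overlap of the
  uncontracted shape is merely scaled by \<open>e\<close>.\<close>

lemma Sym_thin_quad_ge:
  assumes e: "0 < e"
  shows "(sqrt 2 + 1) / 3 \<le> Sym 1 (thin_quad e)"
proof -
  define p :: "real^2" where "p = axis 1 (2 * sqrt 2 / 3)"
  define w :: "real^2" where "w = axis 2 1"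
  have w: "w \<noteq> 0" by (simp add: w_def axis_eq_0_iff)
  let ?r = "refl_flat (range (\<lambda>t. p + t *\<^sub>R w))"
  have ww: "w \<bullet> w = 1" by (simp add: w_def inner_axis_axis)
  have pw: "p$1 = 2 * sqrt 2 / 3" "p$2 = 0" "w$1 = 0" "w$2 = 1" by (simp_all add: p_def w_def axis_def)
  have r: "?r z $ 1 = 4 * sqrt 2 / 3 - z$1" "?r z $ 2 = z$2" for z
    unfolding refl_flat_line[OF w] ww by (simp_all add: pw inner_2)
  have "thin_frame e -` (thin_quad e \<inter> ?r -` thin_quad e) = cut_triangle \<inter> {z. (4 * sqrt 2 / 3 - fst z, snd z) \<in> cut_triangle}"
    using e unfolding thin_quad_def by (auto simp: r)
  moreover have "thin_quad e \<inter> ?r -` thin_quad e \<in> sets borel"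
    using borel_compact[OF thin_quad_compact[OF e]] by (intro sets.Int borel_refl_line[OF w])
  moreover have "bounded (thin_quad e \<inter> ?r -` thin_quad e)"
    using compact_imp_bounded[OF thin_quad_compact[OF e]] by (rule bounded_subset) (rule Int_lower1)
  ultimately have "e * (2/3) \<le> measure lebesgue (thin_quad e \<inter> ?r -` thin_quad e)"
    using measure_thin[of _ e] measure_cut_triangle_mirror e by simp
  also have "\<dots> \<le> Sym 1 (thin_quad e) * (e * (2 * sqrt 2 - 2))"
    using Sym_ge[OF thin_quad_body[OF e] w] unfolding measure_thin_quad[OF e] .
  finally have "e * (2/3) \<le> e * (Sym 1 (thin_quad e) * (2 * sqrt 2 - 2))" by (simp only: mult.left_commute)
  then have "2/3 \<le> Sym 1 (thin_quad e) * (2 * sqrt 2 - 2)" using e by (simp only: mult_le_cancel_left_pos)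
  \<comment> \<open>\<open>sqrt 2 + 1\<close> rationalizes the denominator, as
    \<open>(2 * sqrt 2 - 2) * (sqrt 2 + 1) = 2\<close>.\<close>
  then have "2/3 * (sqrt 2 + 1) \<le> Sym 1 (thin_quad e) * (2 * sqrt 2 - 2) * (sqrt 2 + 1)"
    by (rule mult_right_mono) simp
  also have "\<dots> = Sym 1 (thin_quad e) * (2 * (sqrt 2 * sqrt 2) - 2)" by (simp add: algebra_simps)
  finally show ?thesis by simp
qed

lemma Sym_thin_quad_le:
  assumes e: "0 < e" "e \<le> 1/100"
  shows "Sym 1 (thin_quad e) \<le> (2/3 + 100 * e^2) * (sqrt 2 + 1) / 2"
proof (rule Sym_le[OF thin_quad_body[OF e(1)]])
  fix p w :: "real^2" assume w: "w \<noteq> 0"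
  have "(2/3 + 100 * e^2) * (sqrt 2 + 1) / 2 * (e * (2 * sqrt 2 - 2)) = (2/3 + 100 * e^2) * e * (sqrt 2 * sqrt 2 - 1)"
    by (simp add: algebra_simps)
  also have "\<dots> = e * (2/3 + 100 * e^2)" by simp
  finally have eq: "(2/3 + 100 * e^2) * (sqrt 2 + 1) / 2 * (e * (2 * sqrt 2 - 2)) = e * (2/3 + 100 * e^2)" .
  show "measure lebesgue (thin_quad e \<inter> refl_flat (range (\<lambda>t. p + t *\<^sub>R w)) -` thin_quad e)
      \<le> (2/3 + 100 * e^2) * (sqrt 2 + 1) / 2 * measure lebesgue (thin_quad e)"
    unfolding measure_thin_quad[OF e(1)] eq by (rule thin_quad_overlap[OF e w])
qed

theorem theorem1p1:
  shows "(\<forall>K::(real^2) set. convex_body K \<longrightarrow> 2/41 * (10 + 3 * sqrt 2) \<le> Sym 1 K)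
    \<and> (\<exists>Q::nat \<Rightarrow> (real^2) set. (\<forall>j. convex_quadrilateral (Q j))
          \<and> (\<lambda>j. Sym 1 (Q j)) \<longlonglongrightarrow> (sqrt 2 + 1) / 3)
    \<and> 2/41 * (10 + 3 * sqrt 2) \<le> sigma TYPE(real^2) 1
    \<and> sigma TYPE(real^2) 1 \<le> (sqrt 2 + 1) / 3"
proof -
  have lower: "2/41 * (10 + 3 * sqrt 2) \<le> Sym 1 K" if "convex_body K" for K :: "(real^2) set"
    using Sym_lower_bound[OF that] axiality_constant_le by (rule order_trans[rotated])
  \<comment> \<open>The factor 1/100 keeps every term in the range where the overlap estimates are
    valid.\<close>
  define \<epsilon> where "\<epsilon> = (\<lambda>j. 1/100 * inverse (real (Suc j)))"
  have \<epsilon>: "0 < \<epsilon> j" "\<epsilon> j \<le> 1/100" for j by (auto simp: \<epsilon>_def field_simps)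
  have "\<epsilon> \<longlonglongrightarrow> 1/100 * 0" unfolding \<epsilon>_def by (intro tendsto_intros LIMSEQ_inverse_real_of_nat)
  then have "\<epsilon> \<longlonglongrightarrow> 0" by simp
  then have L: "(\<lambda>j. (2/3 + 100 * (\<epsilon> j)^2) * (sqrt 2 + 1) / 2) \<longlonglongrightarrow> (2/3 + 100 * 0^2) * (sqrt 2 + 1) / 2"
    by (intro tendsto_intros) auto
  have "(2/3 + 100 * 0^2) * (sqrt 2 + 1) / 2 = (sqrt 2 + 1) / 3" by simp
  note up = L[unfolded this]
  have lim: "(\<lambda>j. Sym 1 (thin_quad (\<epsilon> j))) \<longlonglongrightarrow> (sqrt 2 + 1) / 3"
  proof (rule tendsto_sandwich[OF _ _ tendsto_const up])
    show "\<forall>\<^sub>F j in sequentially. (sqrt 2 + 1) / 3 \<le> Sym 1 (thin_quad (\<epsilon> j))"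
      by (intro always_eventually allI Sym_thin_quad_ge \<epsilon>)
    show "\<forall>\<^sub>F j in sequentially. Sym 1 (thin_quad (\<epsilon> j)) \<le> (2/3 + 100 * (\<epsilon> j)^2) * (sqrt 2 + 1) / 2"
      by (intro always_eventually allI Sym_thin_quad_le \<epsilon>)
  qed
  let ?A = "{Sym 1 K | K::(real^2) set. convex_body K}"
  have A: "?A \<noteq> {}" using thin_quad_body[OF \<epsilon>(1)] by blast
  have "2/41 * (10 + 3 * sqrt 2) \<le> Inf ?A" by (rule cInf_greatest[OF A]) (use lower in auto)
  moreover have "Inf ?A \<le> Sym 1 (thin_quad (\<epsilon> j))" for j
  proof (rule cInf_lower)
    show "bdd_below ?A" unfolding bdd_below_def using lower by blast
  qed (use thin_quad_body[OF \<epsilon>(1)] in blast)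
  then have "Inf ?A \<le> (sqrt 2 + 1) / 3" using LIMSEQ_le_const[OF lim] by blast
  moreover have "\<exists>Q::nat \<Rightarrow> (real^2) set. (\<forall>j. convex_quadrilateral (Q j))
      \<and> (\<lambda>j. Sym 1 (Q j)) \<longlonglongrightarrow> (sqrt 2 + 1) / 3"
    by (intro exI[of _ "\<lambda>j. thin_quad (\<epsilon> j)"] conjI allI lim convex_quadrilateral_thin \<epsilon>)
  ultimately show ?thesis
    unfolding sigma_def using lower by (intro conjI allI impI)
qed

end
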